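(* Let $(G,\mu)$ be a weighted, unoriented, infinite, connected graph satisfying (LB), (AR)$_D$ for some $D>0$, and (UE)$_\beta$ for some $\beta\ge2$. If $D<\beta$, then for any $p\in(1,\infty)$ and any $\gamma\in(\frac D\beta,1)$ there exists $C>0$ such that $$\|\Delta^\gamma f\|_{L^p(G)}\le C\,\|\nabla f\|_{L^p(G)}\qquad\text{for all finitely supported functions } f\text{ on }G.$$
   Context: Graphs. $G$ is an infinite set with a symmetric weight $\mu_{xy}=\mu_{yx}\ge0$ on $G\times G$; $E_G=\{(x,y):\mu_{xy}>0\}$; $x\sim y$ means $(x,y)\in E_G$ ($x\sim x$ is allowed). $\delta(x,y)$ is the length of a shortest path from $x$ to $y$, and $G$ is connected ($\delta<\infty$). $m(x):=\sum_{y\sim x}\mu_{xy}$ (finite), $m(E)=\sum_{x\in E}m(x)$, $B(x,r)=\{y:\delta(x,y)<r\}$, $V(x,r)=m(B(x,r))$, and $\|f\|_{L^p(G)}=(\sum_x|f(x)|^pm(x))^{1/p}$. Operators. $|\nabla f|(x)=\big(\frac1{2m(x)}\sum_{y\sim x}\mu_{xy}|f(x)-f(y)|^2\big)^{1/2}$, and $\|\nabla f\|_{L^p(G)}$ means $\|\,|\nabla f|\,\|_{L^p(G)}$. $Pf(x)=\frac1{m(x)}\sum_{y\sim x}\mu_{xy}f(y)$ and $\Delta=I-P$, a bounded nonnegative self-adjoint operator on $L^2(G)$; $\Delta^\gamma$ is defined by functional calculus. The kernels $p_k$ are defined by $P^kf(x)=\sum_y p_k(x,y)f(y)m(y)$ for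 $k\ge0$ (so $p_0(x,y)=\mathbf 1_{x=y}/m(y)$). Conditions. - (LB): $(x,x)\in E_G$ for all $x\in G$ and there is $\epsilon>0$ with $\mu_{xy}\ge\epsilon m(x)$ for all $(x,y)\in E_G$. - (AR)$_D$: there is $C>0$ with $C^{-1}(1+r)^D\le V(x,r)\le C(1+r)^D$ for all $x\in G$, $r>0$. - (UE)$_\beta$: there are $C,c>0$ with $p_{k-1}(x,y)\le \frac{C}{V(x,k^{1/\beta})}\exp\big(-c[\delta(x,y)^\beta/k]^{1/(\beta-1)}\big)$ for all $x,y\in G$ and integers $k\ge1$. *)

theory Defs
  imports "HOL-Analysis.Analysis" "HOL-Computational_Algebra.Polynomial"
begin

text \<open>
  The vertex set is the type \<open>'a\<close>; a weighted graph is given by its weight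
  \<open>\<mu> :: 'a \<Rightarrow> 'a \<Rightarrow> real\<close>. Functions on the graph whose values are left polymorphic are
  used below both with real and with complex values.
\<close>

section \<open>Weighted graphs\<close>

definition edges :: "('a \<Rightarrow> 'a \<Rightarrow> real) \<Rightarrow> ('a \<times> 'a) set" where
  "edges \<mu> = {(x, y). \<mu> x y > 0}"

abbreviation nbrs :: "('a \<Rightarrow> 'a \<Rightarrow> real) \<Rightarrow> 'a \<Rightarrow> 'a set" where
  "nbrs \<mu> x \<equiv> {y. (x, y) \<in> edges \<mu>}"

text \<open>The summability clause says that every vertex has finite measure.\<close>

definition weighted_graph :: "('a \<Rightarrow> 'a \<Rightarrow> real) \<Rightarrow> bool" where
  "weighted_graph \<mu> \<longleftrightarrow>
     (\<forall>x y. \<mu> x y = \<mu> y x) \<and> (\<forall>x y. \<mu> x y \<ge> 0) \<and> (\<forall>x. (\<lambda>y. \<mu> x y) summable_on nbrs \<mu> x)"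

definition connected_graph :: "('a \<Rightarrow> 'a \<Rightarrow> real) \<Rightarrow> bool" where
  "connected_graph \<mu> \<longleftrightarrow> (\<forall>x y. (x, y) \<in> (edges \<mu>)\<^sup>*)"

text \<open>\<open>edges \<mu> ^^ n\<close> is the existence of a path of length \<open>n\<close>; the value is only meaningful
  if some path exists, as is the case in a connected graph.\<close>

definition graph_dist :: "('a \<Rightarrow> 'a \<Rightarrow> real) \<Rightarrow> 'a \<Rightarrow> 'a \<Rightarrow> nat" where
  "graph_dist \<mu> x y = (LEAST n. (x, y) \<in> edges \<mu> ^^ n)"

definition vmeas :: "('a \<Rightarrow> 'a \<Rightarrow> real) \<Rightarrow> 'a \<Rightarrow> real" where
  "vmeas \<mu> x = (\<Sum>\<^sub>\<infinity>y\<in>nbrs \<mu> x. \<mu> x y)"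

definition gball :: "('a \<Rightarrow> 'a \<Rightarrow> real) \<Rightarrow> 'a \<Rightarrow> real \<Rightarrow> 'a set" where
  "gball \<mu> x r = {y. real (graph_dist \<mu> x y) < r}"

text \<open>If the sum diverged, \<open>infsum\<close> would give the value \<open>0\<close>. This cannot be mistaken for a
  finite volume below, since (AR) bounds the volume from below by a positive number.\<close>

definition vol :: "('a \<Rightarrow> 'a \<Rightarrow> real) \<Rightarrow> 'a \<Rightarrow> real \<Rightarrow> real" where
  "vol \<mu> x r = (\<Sum>\<^sub>\<infinity>y\<in>gball \<mu> x r. vmeas \<mu> y)"

section \<open>Lebesgue spaces\<close>

definition Lp :: "('a \<Rightarrow> 'a \<Rightarrow> real) \<Rightarrow> real \<Rightarrow> ('a \<Rightarrow> 'b::real_normed_vector) set" where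
  "Lp \<mu> p = {f. (\<lambda>x. norm (f x) powr p * vmeas \<mu> x) summable_on UNIV}"

text \<open>The norm of \<open>f\<close> is finite iff \<open>f \<in> Lp \<mu> p\<close>; outside \<open>Lp \<mu> p\<close> the following real number is
  meaningless (namely \<open>0\<close>), so bounds on it have to be accompanied by membership in \<open>Lp \<mu> p\<close>.\<close>

definition Lp_norm :: "('a \<Rightarrow> 'a \<Rightarrow> real) \<Rightarrow> real \<Rightarrow> ('a \<Rightarrow> 'b::real_normed_vector) \<Rightarrow> real" where
  "Lp_norm \<mu> p f = (\<Sum>\<^sub>\<infinity>x. norm (f x) powr p * vmeas \<mu> x) powr (1 / p)"

section \<open>Gradient, Markov operator, Laplacian\<close>

definition grad :: "('a \<Rightarrow> 'a \<Rightarrow> real) \<Rightarrow> ('a \<Rightarrow> 'b::real_normed_vector) \<Rightarrow> 'a \<Rightarrow> real" where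
  "grad \<mu> f x =
     sqrt (1 / (2 * vmeas \<mu> x) * (\<Sum>\<^sub>\<infinity>y\<in>nbrs \<mu> x. \<mu> x y * (norm (f x - f y))\<^sup>2))"

definition Pop :: "('a \<Rightarrow> 'a \<Rightarrow> real) \<Rightarrow> ('a \<Rightarrow> 'b::real_normed_vector) \<Rightarrow> 'a \<Rightarrow> 'b" where
  "Pop \<mu> f x = (1 / vmeas \<mu> x) *\<^sub>R (\<Sum>\<^sub>\<infinity>y\<in>nbrs \<mu> x. \<mu> x y *\<^sub>R f y)"

definition Laplacian :: "('a \<Rightarrow> 'a \<Rightarrow> real) \<Rightarrow> ('a \<Rightarrow> 'b::real_normed_vector) \<Rightarrow> 'a \<Rightarrow> 'b" where
  "Laplacian \<mu> f x = f x - Pop \<mu> f x"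

text \<open>The kernel of \<open>P\<^sup>k\<close> with respect to the measure is obtained by testing against the
  indicator function of \<open>{y}\<close>. Lemma \<open>Pop_funpow_kernel\<close> below is its defining property.\<close>

definition kernel :: "('a \<Rightarrow> 'a \<Rightarrow> real) \<Rightarrow> nat \<Rightarrow> 'a \<Rightarrow> 'a \<Rightarrow> real" where
  "kernel \<mu> k x y = (Pop \<mu> ^^ k) (indicator {y}) x / vmeas \<mu> y"

section \<open>The conditions on the graph\<close>

definition cond_LB :: "('a \<Rightarrow> 'a \<Rightarrow> real) \<Rightarrow> bool" where
  "cond_LB \<mu> \<longleftrightarrow>
     (\<forall>x. (x, x) \<in> edges \<mu>) \<and> (\<exists>\<epsilon>>0. \<forall>(x, y)\<in>edges \<mu>. \<mu> x y \<ge> \<epsilon> * vmeas \<mu> x)"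

definition cond_AR :: "('a \<Rightarrow> 'a \<Rightarrow> real) \<Rightarrow> real \<Rightarrow> bool" where
  "cond_AR \<mu> D \<longleftrightarrow>
     (\<exists>C>0. \<forall>x. \<forall>r>0. inverse C * (1 + r) powr D \<le> vol \<mu> x r \<and> vol \<mu> x r \<le> C * (1 + r) powr D)"

definition cond_UE :: "('a \<Rightarrow> 'a \<Rightarrow> real) \<Rightarrow> real \<Rightarrow> bool" where
  "cond_UE \<mu> \<beta> \<longleftrightarrow>
     (\<exists>C>0. \<exists>c>0. \<forall>x y. \<forall>k\<ge>1.
        kernel \<mu> (k - 1) x y \<le> C / vol \<mu> x (real k powr (1 / \<beta>)) *
          exp (- c * (real (graph_dist \<mu> x y) powr \<beta> / real k) powr (1 / (\<beta> - 1))))"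

section \<open>Continuous functional calculus on \<open>L\<^sup>2\<close>\<close>

text \<open>
  Operators on \<open>L\<^sup>2\<close> are functions on all of \<open>'a \<Rightarrow> complex\<close> of which only the restriction to
  \<open>Lp \<mu> 2\<close> matters.
\<close>

definition L2_operator :: "('a \<Rightarrow> 'a \<Rightarrow> real) \<Rightarrow> (('a \<Rightarrow> complex) \<Rightarrow> 'a \<Rightarrow> complex) \<Rightarrow> bool" where
  "L2_operator \<mu> T \<longleftrightarrow>
     (\<forall>f\<in>Lp \<mu> 2. T f \<in> Lp \<mu> 2) \<and>
     (\<forall>f\<in>Lp \<mu> 2. \<forall>g\<in>Lp \<mu> 2. T (\<lambda>x. f x + g x) = (\<lambda>x. T f x + T g x)) \<and>
     (\<forall>c. \<forall>f\<in>Lp \<mu> 2. T (\<lambda>x. c * f x) = (\<lambda>x. c * T f x)) \<and>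
     (\<exists>K. \<forall>f\<in>Lp \<mu> 2. Lp_norm \<mu> 2 (T f) \<le> K * Lp_norm \<mu> 2 f)"

definition L2_opnorm :: "('a \<Rightarrow> 'a \<Rightarrow> real) \<Rightarrow> (('a \<Rightarrow> complex) \<Rightarrow> 'a \<Rightarrow> complex) \<Rightarrow> real" where
  "L2_opnorm \<mu> T = (SUP f\<in>{f \<in> Lp \<mu> 2. Lp_norm \<mu> 2 f \<le> 1}. Lp_norm \<mu> 2 (T f))"

definition L2_spectrum :: "('a \<Rightarrow> 'a \<Rightarrow> real) \<Rightarrow> (('a \<Rightarrow> complex) \<Rightarrow> 'a \<Rightarrow> complex) \<Rightarrow> complex set" where
  "L2_spectrum \<mu> T =
     {z. \<not> (\<exists>R. L2_operator \<mu> R \<and>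
              (\<forall>f\<in>Lp \<mu> 2. R (\<lambda>x. T f x - z * f x) = f \<and> (\<lambda>x. T (R f) x - z * R f x) = f))}"

definition poly_op :: "complex poly \<Rightarrow> (('a \<Rightarrow> complex) \<Rightarrow> 'a \<Rightarrow> complex) \<Rightarrow> ('a \<Rightarrow> complex) \<Rightarrow> 'a \<Rightarrow> complex" where
  "poly_op q T f x = (\<Sum>i\<le>degree q. coeff q i * (T ^^ i) f x)"

text \<open>
  For a bounded self-adjoint operator \<open>T\<close> and a continuous function \<open>\<phi>\<close> on its spectrum, \<open>\<phi>(T)\<close>
  is the value at \<open>\<phi>\<close> of the continuous extension, from polynomials to all continuous functions
  on the spectrum with the uniform norm, of the map \<open>q \<mapsto> q(T)\<close>. In other words, \<open>\<phi>(T)\<close> is the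
  limit in operator norm of \<open>q\<^sub>n(T)\<close> for every sequence of polynomials \<open>q\<^sub>n\<close> that converges to \<open>\<phi>\<close>
  uniformly on the spectrum. Since HOL functions are total, \<open>\<phi>(T)\<close> is set to \<open>0\<close> outside \<open>L\<^sup>2\<close>, which
  makes it unique as a function.
\<close>

definition has_fun_calc ::
    "('a \<Rightarrow> 'a \<Rightarrow> real) \<Rightarrow> (('a \<Rightarrow> complex) \<Rightarrow> 'a \<Rightarrow> complex) \<Rightarrow> (complex \<Rightarrow> complex) \<Rightarrow>
     (('a \<Rightarrow> complex) \<Rightarrow> 'a \<Rightarrow> complex) \<Rightarrow> bool" where
  "has_fun_calc \<mu> T \<phi> S \<longleftrightarrow>
     L2_operator \<mu> S \<and> (\<forall>f. f \<notin> Lp \<mu> 2 \<longrightarrow> S f = (\<lambda>x. 0)) \<and>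
     (\<forall>q. uniform_limit (L2_spectrum \<mu> T) (\<lambda>n. poly (q n)) \<phi> sequentially \<longrightarrow>
          (\<lambda>n. L2_opnorm \<mu> (\<lambda>f x. poly_op (q n) T f x - S f x)) \<longlonglongrightarrow> 0)"

definition fun_calc ::
    "('a \<Rightarrow> 'a \<Rightarrow> real) \<Rightarrow> (('a \<Rightarrow> complex) \<Rightarrow> 'a \<Rightarrow> complex) \<Rightarrow> (complex \<Rightarrow> complex) \<Rightarrow>
     ('a \<Rightarrow> complex) \<Rightarrow> 'a \<Rightarrow> complex" where
  "fun_calc \<mu> T \<phi> = (THE S. has_fun_calc \<mu> T \<phi> S)"

text \<open>The spectrum of the Laplacian consists of nonnegative reals, where the complex power is the
  real one, with \<open>0 powr \<gamma> = 0\<close>.\<close>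

definition Laplacian_powr :: "('a \<Rightarrow> 'a \<Rightarrow> real) \<Rightarrow> real \<Rightarrow> ('a \<Rightarrow> complex) \<Rightarrow> 'a \<Rightarrow> complex" where
  "Laplacian_powr \<mu> \<gamma> = fun_calc \<mu> (Laplacian \<mu>) (\<lambda>z. z powr complex_of_real \<gamma>)"

section \<open>The kernel represents the powers of the Markov operator\<close>

lemma summable_on_nbrs_bounded:
  fixes f :: "'a \<Rightarrow> 'b::banach"
  assumes "weighted_graph \<mu>" and "\<And>y. norm (f y) \<le> B"
  shows "(\<lambda>y. \<mu> x y *\<^sub>R f y) abs_summable_on nbrs \<mu> x"
proof -
  have "(\<lambda>y. \<mu> x y * B) summable_on nbrs \<mu> x"
    using assms(1) by (intro summable_on_cmult_left) (auto simp: weighted_graph_def)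
  then show ?thesis
    using assms by (elim summable_on_comparison_test)
      (auto simp: weighted_graph_def intro!: mult_left_mono)
qed

lemma norm_Pop_le:
  fixes f :: "'a \<Rightarrow> 'b::banach"
  assumes G: "weighted_graph \<mu>" and f: "\<And>y. norm (f y) \<le> B" and m: "vmeas \<mu> x > 0"
  shows "norm (Pop \<mu> f x) \<le> B"
proof -
  have \<mu>: "\<mu> x summable_on nbrs \<mu> x" and nonneg: "\<And>y. \<mu> x y \<ge> 0"
    using G by (auto simp: weighted_graph_def)
  have "norm (\<Sum>\<^sub>\<infinity>y\<in>nbrs \<mu> x. \<mu> x y *\<^sub>R f y) \<le> (\<Sum>\<^sub>\<infinity>y\<in>nbrs \<mu> x. norm (\<mu> x y *\<^sub>R f y))"
    by (rule norm_infsum_bound[OF summable_on_nbrs_bounded[OF G f]])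
  also have "\<dots> \<le> (\<Sum>\<^sub>\<infinity>y\<in>nbrs \<mu> x. \<mu> x y * B)"
    using nonneg f by (intro infsum_mono summable_on_nbrs_bounded[OF G f]
        summable_on_cmult_left \<mu>) (auto intro!: mult_left_mono)
  also have "\<dots> = vmeas \<mu> x * B"
    using \<mu> by (simp add: vmeas_def infsum_cmult_left)
  finally show ?thesis
    using m by (simp add: Pop_def field_simps)
qed

lemma norm_Pop_funpow_le:
  fixes f :: "'a \<Rightarrow> 'b::banach"
  assumes "weighted_graph \<mu>" and "\<And>y. norm (f y) \<le> B" and "\<And>x. vmeas \<mu> x > 0"
  shows "norm ((Pop \<mu> ^^ k) f x) \<le> B"
  by (induction k arbitrary: x) (auto intro: norm_Pop_le assms)

lemma Pop_sum_scaleR: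
  fixes c :: "'i \<Rightarrow> 'b::banach" and g :: "'i \<Rightarrow> 'a \<Rightarrow> real"
  assumes G: "weighted_graph \<mu>" and g: "\<And>i y. norm (g i y) \<le> B"
  shows "Pop \<mu> (\<lambda>x. \<Sum>i\<in>S. g i x *\<^sub>R c i) = (\<lambda>x. \<Sum>i\<in>S. Pop \<mu> (g i) x *\<^sub>R c i)"
proof
  fix x
  have s: "(\<lambda>y. \<mu> x y * g i y) summable_on nbrs \<mu> x" for i
    using summable_on_nbrs_bounded[OF G g] abs_summable_summable by fastforce
  have "(\<Sum>\<^sub>\<infinity>y\<in>nbrs \<mu> x. \<mu> x y *\<^sub>R (\<Sum>i\<in>S. g i y *\<^sub>R c i)) =
        (\<Sum>\<^sub>\<infinity>y\<in>nbrs \<mu> x. \<Sum>i\<in>S. (\<mu> x y * g i y) *\<^sub>R c i)"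
    by (simp add: scaleR_sum_right)
  also have "\<dots> = (\<Sum>i\<in>S. \<Sum>\<^sub>\<infinity>y\<in>nbrs \<mu> x. (\<mu> x y * g i y) *\<^sub>R c i)"
  proof (induction S rule: infinite_finite_induct)
    case (insert i S)
    have "(\<lambda>y. \<Sum>j\<in>S. (\<mu> x y * g j y) *\<^sub>R c j) summable_on nbrs \<mu> x"
      by (induction S rule: infinite_finite_induct)
        (auto intro!: summable_on_add summable_on_scaleR_left s)
    with insert show ?case
      by (simp add: infsum_add[OF summable_on_scaleR_left[OF s]])
  qed simp_all
  also have "\<dots> = (\<Sum>i\<in>S. (\<Sum>\<^sub>\<infinity>y\<in>nbrs \<mu> x. \<mu> x y * g i y) *\<^sub>R c i)"
    by (intro sum.cong refl infsum_scaleR_left s)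
  finally show "Pop \<mu> (\<lambda>x. \<Sum>i\<in>S. g i x *\<^sub>R c i) x = (\<Sum>i\<in>S. Pop \<mu> (g i) x *\<^sub>R c i)"
    by (simp add: Pop_def scaleR_sum_right)
qed

lemma Pop_funpow_kernel:
  fixes f :: "'a \<Rightarrow> 'b::banach"
  assumes G: "weighted_graph \<mu>" and m: "\<And>x. vmeas \<mu> x > 0" and f: "finite {y. f y \<noteq> 0}"
  shows "(Pop \<mu> ^^ k) f x = (\<Sum>\<^sub>\<infinity>y. (kernel \<mu> k x y * vmeas \<mu> y) *\<^sub>R f y)"
proof -
  define S where "S = {y. f y \<noteq> 0}"
  have f_eq: "f = (\<lambda>x. \<Sum>y\<in>S. indicator {y} x *\<^sub>R f y)"
  proof
    fix x
    have "(\<Sum>y\<in>S. indicator {y} x *\<^sub>R f y) = (\<Sum>y\<in>S. if x = y then f y else 0)"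
      by (intro sum.cong) (auto simp: indicator_def)
    then show "f x = (\<Sum>y\<in>S. indicator {y} x *\<^sub>R f y)"
      using f by (auto simp: S_def)
  qed
  have bd: "norm ((Pop \<mu> ^^ k) (indicator {y}) x :: real) \<le> 1" for k x and y :: 'a
    by (rule norm_Pop_funpow_le[OF G _ m]) (auto simp: indicator_def)
  have "(Pop \<mu> ^^ k) (\<lambda>x. \<Sum>y\<in>S. indicator {y} x *\<^sub>R f y) =
        (\<lambda>x. \<Sum>y\<in>S. (Pop \<mu> ^^ k) (indicator {y}) x *\<^sub>R f y)"
    by (induction k) (simp_all add: Pop_sum_scaleR[OF G bd])
  then have "(Pop \<mu> ^^ k) f x = (\<Sum>y\<in>S. (Pop \<mu> ^^ k) (indicator {y}) x *\<^sub>R f y)"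
    using f_eq by simp
  also have "\<dots> = (\<Sum>y\<in>S. (kernel \<mu> k x y * vmeas \<mu> y) *\<^sub>R f y)"
    using m by (intro sum.cong refl) (simp add: kernel_def less_imp_neq[symmetric])
  also have "\<dots> = (\<Sum>\<^sub>\<infinity>y\<in>S. (kernel \<mu> k x y * vmeas \<mu> y) *\<^sub>R f y)"
    using f by (simp add: S_def)
  also have "\<dots> = (\<Sum>\<^sub>\<infinity>y. (kernel \<mu> k x y * vmeas \<mu> y) *\<^sub>R f y)"
    by (rule infsum_cong_neutral) (auto simp: S_def)
  finally show ?thesis .
qed

end

theory Submission
  imports Defs "HOL-Computational_Algebra.Fundamental_Theorem_Algebra"
begin

text \<open>
  Write \<open>(1 - w) powr (\<gamma> - 1) = \<Sum>k. a\<^sub>k w\<^sup>k\<close> with \<open>0 \<le> a\<^sub>k \<le> (k + 1) powr (- \<gamma>)\<close>. Then \<open>\<Delta>\<^sup>\<gamma> f\<close> is the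
  pointwise limit of \<open>\<Sum>k<n. a\<^sub>k P\<^sup>k \<Delta>f\<close>, and Green's formula moves one gradient onto the kernel,
  so that everything follows from Schur's test and a bound on the \<open>L\<^sup>1\<close> norm of \<open>\<nabla>p\<^sub>k(x, \<cdot>)\<close>.

  The loops keep the spectrum of \<open>P\<close> away from \<open>-1\<close>, which gives \<open>\<bar>\<Delta>p\<^sub>k\<bar> \<le> C k powr (-1 - D/\<beta>)\<close>.
  Interpolation with (UE) yields \<open>\<parallel>\<Delta>p\<^sub>k(x, \<cdot>)\<parallel>\<^sub>1 \<le> C k powr (-1 + \<eta>)\<close> for every \<open>\<eta> > 0\<close>. The flow
  through an edge is bounded by the total mass of the sources, so \<open>\<bar>\<nabla>p\<^sub>k\<bar> \<le> C k powr (-1 + \<eta>)\<close> pointwise,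
  and a second interpolation with (UE) bounds the \<open>L\<^sup>1\<close> norm of \<open>\<nabla>p\<^sub>k\<close> by
  \<open>C k powr (-1 + 2\<eta> + D/\<beta>)\<close>. Summing against \<open>a\<^sub>k\<close> converges because \<open>\<gamma> > D/\<beta>\<close>.
\<close>

section \<open>The Hilbert space of square-summable functions\<close>

text \<open>\<open>Laplacian_powr\<close> is a limit over all polynomial approximations on the
  spectrum, so the series is identified with it through an inequality: the norm of a polynomial q of
  a self-adjoint operator is at most the supremum of |q| on the spectrum. It is proved directly,
  from self-adjointness and factorization over the complex numbers, and it also gives the 1/k decay
  of \<Delta>P^k. Each interpolation costs a factor of at most k^\<eta> and buys spatial decay: (UE)
  beats every power of the scaled distance, so the exponent (D + 2)/\<eta> is available and becomes
  D + 2 after raising to the power \<eta>, enough to sum over the graph. Summing costs the volume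
  k^(D/\<beta>) of a ball of radius k^(1/\<beta>). The sup bound for \<Delta>p_k contains the factor
  that cancels it; the flow bound for the gradient does not, which makes D/\<beta> the threshold for
  \<gamma>. Schur's test asks for row and column sums, but the gradient of p_k in its second
  argument is not symmetric in the two arguments. Hence the final bounds are pointwise, by a
  symmetric majorant built from \<open>W\<close>.\<close>

locale positive_measure =
  fixes \<mu> :: "'a \<Rightarrow> 'a \<Rightarrow> real"
  assumes vmeas_pos: "vmeas \<mu> x > 0"
begin

abbreviation "m \<equiv> vmeas \<mu>"
abbreviation L2 :: "('a \<Rightarrow> complex) set" where "L2 \<equiv> Lp \<mu> 2"
abbreviation nrm :: "('a \<Rightarrow> complex) \<Rightarrow> real" where "nrm \<equiv> Lp_norm \<mu> 2"

definition ip :: "('a \<Rightarrow> complex) \<Rightarrow> ('a \<Rightarrow> complex) \<Rightarrow> complex" where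
  "ip f g = (\<Sum>\<^sub>\<infinity>x. f x * cnj (g x) * of_real (m x))"

lemma vmeas_nonneg: "0 \<le> m x"
  using vmeas_pos[of x] by simp

lemma L2_iff: "f \<in> L2 \<longleftrightarrow> (\<lambda>x. (cmod (f x))\<^sup>2 * m x) summable_on UNIV"
  by (simp add: Lp_def)

lemma nrm_nonneg [simp]: "0 \<le> nrm f"
  by (simp add: Lp_norm_def)

lemma nrm_sq: "(nrm f)\<^sup>2 = (\<Sum>\<^sub>\<infinity>x. (cmod (f x))\<^sup>2 * m x)"
  by (simp add: Lp_norm_def powr_half_sqrt infsum_nonneg vmeas_nonneg)

text \<open>\<open>Lp_norm\<close> is 0 for a function outside \<open>L2\<close>, so a norm bound
  alone would prove nothing. Bounds on finite partial sums yield membership and the norm bound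
  together.\<close>

lemma L2_bounded_sums:
  assumes "\<And>F. finite F \<Longrightarrow> (\<Sum>x\<in>F. (cmod (f x))\<^sup>2 * m x) \<le> B\<^sup>2" and "0 \<le> B"
  shows "f \<in> L2" "nrm f \<le> B"
proof -
  show *: "f \<in> L2"
    unfolding L2_iff using assms
    by (intro nonneg_bdd_above_summable_on) (auto simp: bdd_above_def vmeas_nonneg)
  have "(nrm f)\<^sup>2 \<le> B\<^sup>2"
    unfolding nrm_sq using assms * by (intro infsum_le_finite_sums) (auto simp: L2_iff)
  then show "nrm f \<le> B"
    using assms(2) power2_le_imp_le by blast
qed

lemma finite_sum_le_nrm_sq:
  assumes "f \<in> L2" "finite F"
  shows "(\<Sum>x\<in>F. (cmod (f x))\<^sup>2 * m x) \<le> (nrm f)\<^sup>2"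
  unfolding nrm_sq using assms
  by (intro finite_sum_le_infsum) (auto simp: L2_iff vmeas_nonneg)

lemma pointwise_le_nrm:
  assumes "f \<in> L2"
  shows "cmod (f x) \<le> nrm f / sqrt (m x)"
proof -
  have "(cmod (f x))\<^sup>2 * m x \<le> (nrm f)\<^sup>2"
    using finite_sum_le_nrm_sq[OF assms, of "{x}"] by simp
  then have "sqrt ((cmod (f x))\<^sup>2 * m x) \<le> nrm f"
    by (simp add: real_le_lsqrt vmeas_nonneg)
  then show ?thesis
    using vmeas_pos[of x] by (simp add: real_sqrt_mult field_simps)
qed

lemma nrm_eq_0D: "f \<in> L2 \<Longrightarrow> nrm f = 0 \<Longrightarrow> f x = 0"
  using pointwise_le_nrm[of f x] by simp

lemma L2_scale: "f \<in> L2 \<Longrightarrow> (\<lambda>x. c * f x) \<in> L2"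
  and nrm_scale: "nrm (\<lambda>x. c * f x) = cmod c * nrm f"
proof -
  have eq: "(\<lambda>x. (cmod (c * f x))\<^sup>2 * m x) = (\<lambda>x. (cmod c)\<^sup>2 * ((cmod (f x))\<^sup>2 * m x))" for f
    by (auto simp: norm_mult power_mult_distrib)
  show "f \<in> L2 \<Longrightarrow> (\<lambda>x. c * f x) \<in> L2"
    unfolding L2_iff eq by (rule summable_on_cmult_right)
  have "(nrm (\<lambda>x. c * f x))\<^sup>2 = (cmod c * nrm f)\<^sup>2"
    unfolding nrm_sq power_mult_distrib eq by (simp add: infsum_cmult_right')
  then show "nrm (\<lambda>x. c * f x) = cmod c * nrm f"
    by (simp add: power2_eq_iff_nonneg)
qed

text \<open>With values weighted by \<open>sqrt (m x)\<close>, Minkowski and Cauchy-Schwarz for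
  \<open>L2_set\<close> become available on finite sets.\<close>

lemma L2_set_eq_sqrt:
  "L2_set (\<lambda>x. cmod (f x) * sqrt (m x)) F = sqrt (\<Sum>x\<in>F. (cmod (f x))\<^sup>2 * m x)"
  by (simp add: L2_set_def power_mult_distrib vmeas_nonneg)

lemma L2_set_le_nrm:
  assumes "f \<in> L2" "finite F"
  shows "L2_set (\<lambda>x. cmod (f x) * sqrt (m x)) F \<le> nrm f"
  using finite_sum_le_nrm_sq[OF assms] by (simp add: L2_set_eq_sqrt real_le_lsqrt)

lemma L2_bounded_L2_sets:
  assumes "\<And>F. finite F \<Longrightarrow> L2_set (\<lambda>x. cmod (f x) * sqrt (m x)) F \<le> B" and "0 \<le> B"
  shows "f \<in> L2" "nrm f \<le> B"
proof -
  have "(\<Sum>x\<in>F. (cmod (f x))\<^sup>2 * m x) \<le> B\<^sup>2" if "finite F" for F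
  proof -
    have "sqrt (\<Sum>x\<in>F. (cmod (f x))\<^sup>2 * m x) \<le> B"
      using assms(1)[OF that] by (simp add: L2_set_eq_sqrt)
    then show ?thesis
      using sqrt_le_D by blast
  qed
  then show "f \<in> L2" "nrm f \<le> B"
    using L2_bounded_sums[OF _ assms(2), of f] by auto
qed

lemma L2_sum: "\<lbrakk>\<And>i. i \<in> I \<Longrightarrow> f i \<in> L2\<rbrakk> \<Longrightarrow> (\<lambda>x. \<Sum>i\<in>I. f i x) \<in> L2"
  and nrm_sum_le: "\<lbrakk>\<And>i. i \<in> I \<Longrightarrow> f i \<in> L2\<rbrakk> \<Longrightarrow> nrm (\<lambda>x. \<Sum>i\<in>I. f i x) \<le> (\<Sum>i\<in>I. nrm (f i))"
proof -
  assume f: "\<And>i. i \<in> I \<Longrightarrow> f i \<in> L2"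
  have "L2_set (\<lambda>x. cmod (\<Sum>i\<in>I. f i x) * sqrt (m x)) F \<le> (\<Sum>i\<in>I. nrm (f i))" if F: "finite F" for F
    using f
  proof (induction I rule: infinite_finite_induct)
    case (insert i I)
    have "L2_set (\<lambda>x. cmod (\<Sum>i\<in>insert i I. f i x) * sqrt (m x)) F
        \<le> L2_set (\<lambda>x. cmod (f i x) * sqrt (m x) + cmod (\<Sum>i\<in>I. f i x) * sqrt (m x)) F"
      using insert.hyps
      by (intro L2_set_mono)
        (auto simp: distrib_right[symmetric] vmeas_nonneg intro!: mult_right_mono norm_triangle_ineq)
    also have "\<dots> \<le> L2_set (\<lambda>x. cmod (f i x) * sqrt (m x)) F + L2_set (\<lambda>x. cmod (\<Sum>i\<in>I. f i x) * sqrt (m x)) F"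
      by (rule L2_set_triangle_ineq)
    also have "\<dots> \<le> nrm (f i) + (\<Sum>i\<in>I. nrm (f i))"
      using insert F by (intro add_mono L2_set_le_nrm) auto
    finally show ?case
      using insert.hyps by simp
  qed (auto simp: L2_set_def)
  then show "(\<lambda>x. \<Sum>i\<in>I. f i x) \<in> L2" "nrm (\<lambda>x. \<Sum>i\<in>I. f i x) \<le> (\<Sum>i\<in>I. nrm (f i))"
    using L2_bounded_L2_sets[of "\<lambda>x. \<Sum>i\<in>I. f i x" "\<Sum>i\<in>I. nrm (f i)"] by (auto simp: sum_nonneg)
qed

lemma L2_add: "f \<in> L2 \<Longrightarrow> g \<in> L2 \<Longrightarrow> (\<lambda>x. f x + g x) \<in> L2"
  and nrm_add_le: "f \<in> L2 \<Longrightarrow> g \<in> L2 \<Longrightarrow> nrm (\<lambda>x. f x + g x) \<le> nrm f + nrm g"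
  using L2_sum[of "UNIV :: bool set" "\<lambda>b. if b then f else g"]
    nrm_sum_le[of "UNIV :: bool set" "\<lambda>b. if b then f else g"]
  by (auto simp: UNIV_bool add.commute)

lemma nrm_uminus: "nrm (\<lambda>x. - f x) = nrm f"
  using nrm_scale[of "-1" f] by simp

lemma L2_uminus: "f \<in> L2 \<Longrightarrow> (\<lambda>x. - f x) \<in> L2"
  using L2_scale[of f "-1"] by simp

lemma L2_diff: "f \<in> L2 \<Longrightarrow> g \<in> L2 \<Longrightarrow> (\<lambda>x. f x - g x) \<in> L2"
  and nrm_diff_le: "f \<in> L2 \<Longrightarrow> g \<in> L2 \<Longrightarrow> nrm (\<lambda>x. f x - g x) \<le> nrm f + nrm g"
  using L2_add[of f "\<lambda>x. - g x"] nrm_add_le[of f "\<lambda>x. - g x"]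
  by (auto simp: L2_uminus nrm_uminus)

lemma L2_zero: "(\<lambda>x. 0) \<in> L2"
  by (simp add: L2_iff)

lemma nrm_zero [simp]: "nrm (\<lambda>x. 0) = 0"
  using nrm_scale[of 0 "\<lambda>x. 0"] by simp

lemma L2_finite_support: "finite {x. f x \<noteq> 0} \<Longrightarrow> f \<in> L2"
  unfolding L2_iff by (rule finite_nonzero_values_imp_summable_on) (auto elim: rev_finite_subset)

lemma ip_abs_summable:
  assumes "f \<in> L2" "g \<in> L2"
  shows "(\<lambda>x. cmod (f x * cnj (g x) * of_real (m x))) summable_on UNIV"
proof (rule summable_on_comparison_test)
  show "(\<lambda>x. (cmod (f x))\<^sup>2 * m x + (cmod (g x))\<^sup>2 * m x) summable_on UNIV"
    using assms by (intro summable_on_add) (auto simp: L2_iff)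
next
  fix x
  have "2 * (cmod (f x) * cmod (g x)) \<le> (cmod (f x))\<^sup>2 + (cmod (g x))\<^sup>2"
    using sum_squares_bound[of "cmod (f x)" "cmod (g x)"] by (simp add: mult.assoc)
  then have "cmod (f x) * cmod (g x) \<le> (cmod (f x))\<^sup>2 + (cmod (g x))\<^sup>2"
    using mult_nonneg_nonneg[OF norm_ge_zero[of "f x"] norm_ge_zero[of "g x"]] by linarith
  then have "cmod (f x) * cmod (g x) * m x \<le> ((cmod (f x))\<^sup>2 + (cmod (g x))\<^sup>2) * m x"
    by (intro mult_right_mono vmeas_nonneg)
  then show "norm (f x * cnj (g x) * of_real (m x)) \<le> (cmod (f x))\<^sup>2 * m x + (cmod (g x))\<^sup>2 * m x"
    by (simp only: norm_mult complex_mod_cnj norm_of_real abs_of_nonneg vmeas_nonneg distrib_right)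
qed simp

lemma ip_summable: "f \<in> L2 \<Longrightarrow> g \<in> L2 \<Longrightarrow> (\<lambda>x. f x * cnj (g x) * of_real (m x)) summable_on UNIV"
  by (rule abs_summable_summable[OF ip_abs_summable])

lemma ip_add_left: "f \<in> L2 \<Longrightarrow> g \<in> L2 \<Longrightarrow> h \<in> L2 \<Longrightarrow> ip (\<lambda>x. f x + g x) h = ip f h + ip g h"
  unfolding ip_def distrib_right by (intro infsum_add ip_summable)

lemma ip_scale_left: "ip (\<lambda>x. c * f x) g = c * ip f g"
  unfolding ip_def mult.assoc by (rule infsum_cmult_right')

lemma ip_cnj: "cnj (ip f g) = ip g f"
  unfolding ip_def infsum_cnj[symmetric] by (simp add: mult_ac)

lemma ip_diff_left: "f \<in> L2 \<Longrightarrow> g \<in> L2 \<Longrightarrow> h \<in> L2 \<Longrightarrow> ip (\<lambda>x. f x - g x) h = ip f h - ip g h"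
  using ip_add_left[of f "\<lambda>x. - g x" h] ip_scale_left[of "-1" g h] L2_uminus[of g] by simp

lemma ip_scale_right: "ip f (\<lambda>x. c * g x) = cnj c * ip f g"
  by (subst (1 2) ip_cnj[symmetric]) (simp add: ip_scale_left)

lemma ip_diff_right: "f \<in> L2 \<Longrightarrow> g \<in> L2 \<Longrightarrow> h \<in> L2 \<Longrightarrow> ip h (\<lambda>x. f x - g x) = ip h f - ip h g"
  by (subst (1 2 3) ip_cnj[symmetric]) (simp add: ip_diff_left)

lemma ip_add_right: "f \<in> L2 \<Longrightarrow> g \<in> L2 \<Longrightarrow> h \<in> L2 \<Longrightarrow> ip h (\<lambda>x. f x + g x) = ip h f + ip h g"
  by (subst (1 2 3) ip_cnj[symmetric]) (simp add: ip_add_left)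

lemma ip_self: "f \<in> L2 \<Longrightarrow> ip f f = of_real ((nrm f)\<^sup>2)"
proof -
  assume "f \<in> L2"
  then have "((\<lambda>x. (cmod (f x))\<^sup>2 * m x) has_sum (nrm f)\<^sup>2) UNIV"
    by (simp add: nrm_sq L2_iff)
  then have "((\<lambda>x. of_real ((cmod (f x))\<^sup>2 * m x) :: complex) has_sum of_real ((nrm f)\<^sup>2)) UNIV"
    by (rule has_sum_of_real)
  then show ?thesis
    unfolding ip_def by (intro infsumI) (simp add: complex_norm_square del: of_real_power)
qed

lemma nrm_diff_sq:
  assumes "f \<in> L2" "g \<in> L2"
  shows "(nrm (\<lambda>x. f x - g x))\<^sup>2 = (nrm f)\<^sup>2 - 2 * Re (ip f g) + (nrm g)\<^sup>2"
proof -
  have "of_real ((nrm (\<lambda>x. f x - g x))\<^sup>2) = ip (\<lambda>x. f x - g x) (\<lambda>x. f x - g x)"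
    using assms by (intro ip_self[symmetric] L2_diff)
  also have "\<dots> = ip f f - ip f g - (cnj (ip f g) - ip g g)"
    using assms by (simp add: ip_diff_left ip_diff_right L2_diff ip_cnj)
  finally have "Re (of_real ((nrm (\<lambda>x. f x - g x))\<^sup>2)) = Re (ip f f - ip f g - (cnj (ip f g) - ip g g))"
    by (simp only:)
  then show ?thesis
    by (simp only: Re_complex_of_real minus_complex.sel cnj.sel ip_self assms)
qed

lemma Cauchy_Schwarz_ip:
  assumes f: "f \<in> L2" and g: "g \<in> L2"
  shows "cmod (ip f g) \<le> nrm f * nrm g"
proof -
  have *: "(\<Sum>x\<in>F. cmod (f x * cnj (g x) * of_real (m x))) \<le> nrm f * nrm g" if "finite F" for F
  proof -
    have "(\<Sum>x\<in>F. cmod (f x * cnj (g x) * of_real (m x))) =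
        (\<Sum>x\<in>F. \<bar>cmod (f x) * sqrt (m x)\<bar> * \<bar>cmod (g x) * sqrt (m x)\<bar>)"
      by (intro sum.cong refl) (simp add: norm_mult vmeas_nonneg abs_mult algebra_simps)
    also have "\<dots> \<le> L2_set (\<lambda>x. cmod (f x) * sqrt (m x)) F * L2_set (\<lambda>x. cmod (g x) * sqrt (m x)) F"
      by (rule L2_set_mult_ineq)
    also have "\<dots> \<le> nrm f * nrm g"
      using that f g by (intro mult_mono L2_set_le_nrm) (auto simp: L2_set_nonneg)
    finally show ?thesis .
  qed
  have "cmod (ip f g) \<le> (\<Sum>\<^sub>\<infinity>x. cmod (f x * cnj (g x) * of_real (m x)))"
    unfolding ip_def by (rule norm_infsum_bound[OF ip_abs_summable[OF f g]])
  also have "\<dots> \<le> nrm f * nrm g"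
    using * ip_abs_summable[OF f g] by (intro infsum_le_finite_sums) auto
  finally show ?thesis .
qed

text \<open>Completeness of \<open>L2\<close>, in the form used below: point evaluations are
  bounded, so a series with summable norms converges at each vertex; the tail estimate holds on each
  finite set for finite sums and survives the limit.\<close>

lemma L2_series:
  assumes g: "\<And>n. g n \<in> L2" and le: "\<And>n. nrm (g n) \<le> a n" and a: "summable a"
  shows "summable (\<lambda>n. g n x)"
    and "(\<lambda>x. \<Sum>n. g n x) \<in> L2"
    and "nrm (\<lambda>x. (\<Sum>n. g n x) - (\<Sum>n<N. g n x)) \<le> (\<Sum>n. a (n + N))"
proof -
  have an: "0 \<le> a n" for n
    using le[of n] nrm_nonneg[of "g n"] by linarith
  show s: "summable (\<lambda>n. g n x)" for x
  proof (rule summable_comparison_test')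
    show "summable (\<lambda>n. a n / sqrt (m x))"
      using a by (rule summable_divide)
    show "norm (g n x) \<le> a n / sqrt (m x)" for n
      using pointwise_le_nrm[OF g, of n x] le[of n] vmeas_nonneg[of x]
      by (meson divide_right_mono order_trans real_sqrt_ge_zero)
  qed
  have tail: "(\<lambda>x. (\<Sum>n. g n x) - (\<Sum>n<N. g n x)) \<in> L2 \<and>
      nrm (\<lambda>x. (\<Sum>n. g n x) - (\<Sum>n<N. g n x)) \<le> (\<Sum>n. a (n + N))" for N
  proof -
    have aN: "summable (\<lambda>n. a (n + N))"
      using a by (simp add: summable_iff_shift)
    have *: "L2_set (\<lambda>x. cmod ((\<Sum>n. g n x) - (\<Sum>n<N. g n x)) * sqrt (m x)) F \<le> (\<Sum>n. a (n + N))"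
      if F: "finite F" for F
    proof (rule LIMSEQ_le_const2)
      have "(\<lambda>M. \<Sum>n<M. g (n + N) x) \<longlonglongrightarrow> (\<Sum>n. g n x) - (\<Sum>n<N. g n x)" for x
        unfolding suminf_minus_initial_segment[OF s, symmetric]
        using s by (intro summable_LIMSEQ) (simp add: summable_iff_shift[of "\<lambda>n. g n x"])
      then show "(\<lambda>M. L2_set (\<lambda>x. cmod (\<Sum>n<M. g (n + N) x) * sqrt (m x)) F) \<longlonglongrightarrow>
          L2_set (\<lambda>x. cmod ((\<Sum>n. g n x) - (\<Sum>n<N. g n x)) * sqrt (m x)) F"
        unfolding L2_set_def by (intro tendsto_intros)
      have "L2_set (\<lambda>x. cmod (\<Sum>n<M. g (n + N) x) * sqrt (m x)) F \<le> (\<Sum>n. a (n + N))" for M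
      proof -
        have "L2_set (\<lambda>x. cmod (\<Sum>n<M. g (n + N) x) * sqrt (m x)) F \<le> nrm (\<lambda>x. \<Sum>n<M. g (n + N) x)"
          using g F by (intro L2_set_le_nrm L2_sum)
        also have "\<dots> \<le> (\<Sum>n<M. nrm (g (n + N)))"
          using g by (intro nrm_sum_le)
        also have "\<dots> \<le> (\<Sum>n<M. a (n + N))"
          by (intro sum_mono le)
        also have "\<dots> \<le> (\<Sum>n. a (n + N))"
          using aN an by (intro sum_le_suminf) auto
        finally show ?thesis .
      qed
      then show "\<exists>M0. \<forall>M\<ge>M0. L2_set (\<lambda>x. cmod (\<Sum>n<M. g (n + N) x) * sqrt (m x)) F \<le> (\<Sum>n. a (n + N))"
        by blast
    qed
    then show ?thesis
      using L2_bounded_L2_sets[of "\<lambda>x. (\<Sum>n. g n x) - (\<Sum>n<N. g n x)"] an suminf_nonneg[OF aN] by auto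
  qed
  show "(\<lambda>x. \<Sum>n. g n x) \<in> L2"
    using tail[of 0] by simp
  show "nrm (\<lambda>x. (\<Sum>n. g n x) - (\<Sum>n<N. g n x)) \<le> (\<Sum>n. a (n + N))"
    using tail by blast
qed

end

section \<open>Spectral estimates for bounded self-adjoint operators\<close>

context positive_measure
begin

lemma ex_unit_vector: "\<exists>f\<in>L2. nrm f = 1"
proof -
  fix x0 :: 'a
  define f :: "'a \<Rightarrow> complex" where "f x = (if x = x0 then 1 else 0)" for x
  have f: "f \<in> L2" by (rule L2_finite_support) (simp add: f_def)
  have "nrm f \<noteq> 0" using nrm_eq_0D[OF f, of x0] by (auto simp: f_def)
  then show ?thesis
    using nrm_scale[of "of_real (1 / nrm f)" f] L2_scale[OF f, of "of_real (1 / nrm f)"]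
    by (intro bexI[of _ "\<lambda>x. of_real (1 / nrm f) * f x"]) (auto simp: norm_divide)
qed

lemma L2_opnorm_bounds:
  assumes "\<And>f. f \<in> L2 \<Longrightarrow> nrm (A f) \<le> c * nrm f" "0 \<le> c"
  shows "0 \<le> L2_opnorm \<mu> A" "L2_opnorm \<mu> A \<le> c"
    and "f \<in> L2 \<Longrightarrow> nrm f \<le> 1 \<Longrightarrow> nrm (A f) \<le> L2_opnorm \<mu> A"
proof -
  define U where "U = {f \<in> L2. nrm f \<le> 1}"
  have le: "nrm (A f) \<le> c" if "f \<in> U" for f
  proof -
    have "c * nrm f \<le> c * 1" using that assms(2) by (intro mult_left_mono) (auto simp: U_def)
    then show ?thesis using assms(1)[of f] that by (simp add: U_def)
  qed
  have U: "(\<lambda>x. 0) \<in> U" by (simp add: U_def L2_zero)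
  have upper: "nrm (A f) \<le> L2_opnorm \<mu> A" if "f \<in> U" for f
    unfolding L2_opnorm_def U_def[symmetric] using that le
    by (intro cSUP_upper bdd_aboveI2[of _ _ c])
  show "f \<in> L2 \<Longrightarrow> nrm f \<le> 1 \<Longrightarrow> nrm (A f) \<le> L2_opnorm \<mu> A"
    using upper by (simp add: U_def)
  show "0 \<le> L2_opnorm \<mu> A"
    using upper[OF U] nrm_nonneg order_trans by blast
  show "L2_opnorm \<mu> A \<le> c"
    unfolding L2_opnorm_def U_def[symmetric] using U le by (intro cSUP_least) auto
qed

text \<open>The solution is the fixed point of \<open>g \<mapsto> g - t u (S g - f)\<close>, a contraction for small \<open>t\<close>.\<close>

lemma Lax_Milgram:
  assumes add: "\<And>f g. S (\<lambda>x. f x + g x) = (\<lambda>x. S f x + S g x)"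
    and scale: "\<And>c f. S (\<lambda>x. c * f x) = (\<lambda>x. c * S f x)"
    and S_L2: "\<And>f. f \<in> L2 \<Longrightarrow> S f \<in> L2"
    and bdd: "\<And>f. f \<in> L2 \<Longrightarrow> nrm (S f) \<le> K * nrm f"
    and u: "cmod u = 1" and c: "0 < c"
    and coercive: "\<And>f. f \<in> L2 \<Longrightarrow> c * (nrm f)\<^sup>2 \<le> Re (u * ip (S f) f)"
    and f: "f \<in> L2"
  shows "\<exists>g\<in>L2. S g = f"
proof -
  \<comment> \<open>The maximum ensures c \<le> L, so that the contraction factor is the square root
    of a nonnegative number.\<close>
  define L where "L = max c K"
  have L: "0 < L" "c \<le> L" and bddL: "nrm (S f) \<le> L * nrm f" if "f \<in> L2" for f
  proof -
    show "0 < L" "c \<le> L" using c by (auto simp: L_def)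
    have "K * nrm f \<le> L * nrm f" by (intro mult_right_mono) (auto simp: L_def)
    then show "nrm (S f) \<le> L * nrm f" using bdd[OF that] by simp
  qed
  note L = L[OF f]
  \<comment> \<open>This step size minimizes 1 - 2 t c + t^2 L^2, the bound for the squared
    contraction factor; the minimum is 1 - c^2 / L^2.\<close>
  define t where "t = c / L\<^sup>2"
  define \<rho> where "\<rho> = sqrt (1 - c\<^sup>2 / L\<^sup>2)"
  have "c\<^sup>2 \<le> L\<^sup>2" using L c by (intro power_mono) auto
  then have q: "0 \<le> 1 - c\<^sup>2 / L\<^sup>2" "1 - c\<^sup>2 / L\<^sup>2 < 1"
    using L c by (auto simp: divide_simps)
  then have \<rho>: "0 \<le> \<rho>" "\<rho> < 1"
    by (auto simp: \<rho>_def)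
  have \<rho>2: "\<rho>\<^sup>2 = 1 - t * c"
    unfolding \<rho>_def real_sqrt_pow2[OF q(1)] by (simp add: t_def power2_eq_square)
  define A where "A g x = g x - (of_real t * u) * S g x" for g x
  have diff: "S (\<lambda>x. f x - g x) = (\<lambda>x. S f x - S g x)" for f g
    using add[of f "\<lambda>x. - 1 * g x"] scale[of "-1" g] by simp
  have t: "t * L\<^sup>2 = c" using L by (simp add: t_def)
  have A_L2: "A g \<in> L2" and A_le: "nrm (A g) \<le> \<rho> * nrm g" if g: "g \<in> L2" for g
  proof -
    have TS: "(\<lambda>x. (of_real t * u) * S g x) \<in> L2"
      using g by (intro L2_scale S_L2)
    show "A g \<in> L2"
      unfolding A_def using g TS by (intro L2_diff)
    have "ip g (\<lambda>x. (of_real t * u) * S g x) = cnj (of_real t * u * ip (S g) g)"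
      by (simp only: ip_scale_right complex_cnj_mult ip_cnj)
    then have "Re (ip g (\<lambda>x. (of_real t * u) * S g x)) = t * Re (u * ip (S g) g)"
      by (simp add: algebra_simps)
    then have "(nrm (A g))\<^sup>2 = (nrm g)\<^sup>2 - 2 * (t * Re (u * ip (S g) g)) + (t * nrm (S g))\<^sup>2"
      unfolding A_def nrm_diff_sq[OF g TS] using u by (simp add: nrm_scale norm_mult power_mult_distrib)
    also have "\<dots> \<le> (nrm g)\<^sup>2 - 2 * (t * (c * (nrm g)\<^sup>2)) + (t * (L * nrm g))\<^sup>2"
    proof -
      have "t \<ge> 0" using c by (simp add: t_def)
      then show ?thesis
        using coercive[OF g] bddL[OF g]
        by (intro add_mono diff_mono order_refl mult_left_mono power_mono mult_nonneg_nonneg) auto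
    qed
    also have "\<dots> = (nrm g)\<^sup>2 * (1 - 2 * t * c + t * (t * L\<^sup>2))"
      by (simp add: algebra_simps power2_eq_square)
    also have "\<dots> = (\<rho> * nrm g)\<^sup>2"
      unfolding t power_mult_distrib \<rho>2 by algebra
    finally show "nrm (A g) \<le> \<rho> * nrm g"
      by (rule power2_le_imp_le) (simp add: \<rho>)
  qed
  \<comment> \<open>Terms of the Neumann series for the fixed point equation
    \<open>G = A G + t u f\<close>.\<close>
  define h where "h n = (A ^^ n) (\<lambda>x. (of_real t * u) * f x)" for n
  define B where "B = nrm (h 0)"
  have h_L2: "h n \<in> L2" for n
    by (induction n) (auto simp: h_def A_L2 intro: L2_scale f)
  have h_Suc: "h (Suc n) = A (h n)" for n by (simp add: h_def)
  have h_le: "nrm (h n) \<le> B * \<rho> ^ n" for n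
  proof (induction n)
    case (Suc n)
    have "nrm (h (Suc n)) \<le> \<rho> * nrm (h n)" unfolding h_Suc by (rule A_le[OF h_L2])
    also have "\<dots> \<le> \<rho> * (B * \<rho> ^ n)" using Suc \<rho> by (intro mult_left_mono)
    finally show ?case by (simp add: mult_ac)
  qed (simp add: B_def)
  have sB: "summable (\<lambda>n. B * \<rho> ^ n)"
    using \<rho> by (intro summable_mult summable_geometric) auto
  note series = L2_series[of h "\<lambda>n. B * \<rho> ^ n", OF h_L2 h_le sB]
  define G where "G x = (\<Sum>n. h n x)" for x
  define s where "s N x = (\<Sum>n<N. h n x)" for N x
  have G: "G \<in> L2" using series(2) by (simp add: G_def[abs_def])
  have s_L2: "s N \<in> L2" for N unfolding s_def by (intro L2_sum h_L2)
  have A_s: "A (s N) x = s (Suc N) x - (of_real t * u) * f x" for N x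
  proof -
    have "S (s N) x = (\<Sum>n<N. S (h n) x)"
    proof (induction N)
      case 0 then show ?case using scale[of 0 "\<lambda>x. 0"] by (simp add: s_def[abs_def])
    next
      case (Suc N) then show ?case using add[of "s N" "h N"] by (simp add: s_def[abs_def])
    qed
    then have "A (s N) x = (\<Sum>n<N. A (h n) x)"
      by (simp add: A_def s_def sum_subtractf sum_distrib_left)
    also have "\<dots> = (\<Sum>n<N. h (Suc n) x)" by (simp add: h_Suc)
    also have "\<dots> = s (Suc N) x - h 0 x"
      unfolding s_def sum.lessThan_Suc_shift by simp
    finally show ?thesis by (simp add: h_def)
  qed
  define r where "r N = (\<Sum>n. B * \<rho> ^ (n + N))" for N
  have r: "r \<longlonglongrightarrow> 0"
    unfolding r_def[abs_def] by (rule suminf_exist_split2[OF sB])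
  have Gs: "nrm (\<lambda>x. G x - s N x) \<le> r N" for N
    unfolding G_def s_def r_def by (rule series(3))
  define e where "e x = (of_real t * u) * (S G x - f x)" for x
  have e_L2: "e \<in> L2"
    unfolding e_def using G by (intro L2_scale L2_diff S_L2 f)
  \<comment> \<open>S is not applied termwise to the infinite sum. The partial sums solve the
    equation up to a shift of N, and the contraction estimate for A carries the tail bound over to
    the residual of G.\<close>
  have "nrm e \<le> r (Suc N) + \<rho> * r N" for N
  proof -
    have "e x = (G x - s (Suc N) x) - A (\<lambda>x. G x - s N x) x" for x
      using A_s[of N x] by (simp add: e_def A_def diff algebra_simps)
    then have "e = (\<lambda>x. (G x - s (Suc N) x) - A (\<lambda>x. G x - s N x) x)" by auto
    then have "nrm e \<le> nrm (\<lambda>x. G x - s (Suc N) x) + nrm (A (\<lambda>x. G x - s N x))"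
      using nrm_diff_le[OF L2_diff[OF G s_L2[of "Suc N"]] A_L2[OF L2_diff[OF G s_L2[of N]]]] by simp
    also have "\<dots> \<le> r (Suc N) + \<rho> * nrm (\<lambda>x. G x - s N x)"
      by (intro add_mono Gs A_le L2_diff G s_L2)
    also have "\<dots> \<le> r (Suc N) + \<rho> * r N"
      using \<rho> by (intro add_mono order_refl mult_left_mono Gs)
    finally show ?thesis .
  qed
  moreover have "(\<lambda>N. r (Suc N) + \<rho> * r N) \<longlonglongrightarrow> 0 + \<rho> * 0"
    by (intro tendsto_intros r LIMSEQ_Suc)
  ultimately have "nrm e \<le> 0 + \<rho> * 0"
    by (intro LIMSEQ_le_const) auto
  then have "nrm e = 0" using nrm_nonneg[of e] by simp
  then have "e x = 0" for x by (rule nrm_eq_0D[OF e_L2])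
  moreover have "of_real t * u \<noteq> 0" using c L u by (auto simp: t_def)
  ultimately have "S G = f" by (auto simp: e_def)
  then show ?thesis using G by blast
qed

text \<open>Numerical range argument: if the form of T - z, rotated by u, is bounded below by c,
  then T - z is onto by \<open>Lax_Milgram\<close> and, by Cauchy-Schwarz, injective with inverse
  bounded by 1/c. The free u separates z from the numerical range in any direction.\<close>

lemma not_in_spectrum:
  assumes add: "\<And>f g. T (\<lambda>x. f x + g x) = (\<lambda>x. T f x + T g x)"
    and scale: "\<And>c f. T (\<lambda>x. c * f x) = (\<lambda>x. c * T f x)"
    and T_L2: "\<And>f. f \<in> L2 \<Longrightarrow> T f \<in> L2"
    and bdd: "\<And>f. f \<in> L2 \<Longrightarrow> nrm (T f) \<le> K * nrm f"
    and u: "cmod u = 1" and c: "0 < c"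
    and coercive: "\<And>f. f \<in> L2 \<Longrightarrow> c * (nrm f)\<^sup>2 \<le> Re (u * (ip (T f) f - z * of_real ((nrm f)\<^sup>2)))"
  shows "z \<notin> L2_spectrum \<mu> T"
proof -
  define S where "S f x = T f x - z * f x" for f x
  have S_add: "S (\<lambda>x. f x + g x) = (\<lambda>x. S f x + S g x)" for f g
    unfolding S_def add by (simp add: algebra_simps)
  have S_scale: "S (\<lambda>x. c * f x) = (\<lambda>x. c * S f x)" for f c
    unfolding S_def scale by (simp add: algebra_simps)
  have S_diff: "S (\<lambda>x. f x - g x) = (\<lambda>x. S f x - S g x)" for f g
    using S_add[of f "\<lambda>x. - 1 * g x"] S_scale[of "-1" g] by simp
  have S_L2: "S f \<in> L2" if "f \<in> L2" for f
    unfolding S_def using that by (intro L2_diff L2_scale T_L2)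
  have S_bdd: "nrm (S f) \<le> (K + cmod z) * nrm f" if "f \<in> L2" for f
    using nrm_diff_le[OF T_L2[OF that] L2_scale[OF that, of z]] bdd[OF that]
    unfolding S_def by (simp add: nrm_scale algebra_simps)
  have S_coercive: "c * (nrm f)\<^sup>2 \<le> Re (u * ip (S f) f)" if "f \<in> L2" for f
    using coercive[OF that] that unfolding S_def
    by (simp add: ip_diff_left T_L2 L2_scale ip_scale_left ip_self)
  have lower: "c * nrm f \<le> nrm (S f)" if f: "f \<in> L2" for f
  proof (cases "nrm f = 0")
    case False
    then have pos: "0 < nrm f" using nrm_nonneg[of f] by linarith
    have "c * (nrm f)\<^sup>2 \<le> cmod (u * ip (S f) f)"
      using S_coercive[OF f] complex_Re_le_cmod order_trans by blast
    also have "\<dots> \<le> nrm (S f) * nrm f"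
      using u Cauchy_Schwarz_ip[OF S_L2[OF f] f] by (simp add: norm_mult)
    finally show ?thesis using pos by (simp add: power2_eq_square)
  qed simp
  have inj: "f = g" if "f \<in> L2" "g \<in> L2" "S f = S g" for f g
  proof -
    have "c * nrm (\<lambda>x. f x - g x) \<le> 0"
      using lower[OF L2_diff[OF that(1,2)]] that(3) by (simp add: S_diff)
    then have "nrm (\<lambda>x. f x - g x) = 0"
      using c nrm_nonneg[of "\<lambda>x. f x - g x"] by (simp add: mult_le_0_iff)
    then have "f x - g x = 0" for x by (rule nrm_eq_0D[OF L2_diff[OF that(1,2)]])
    then show ?thesis by auto
  qed
  have ex: "\<exists>g. g \<in> L2 \<and> S g = f" if "f \<in> L2" for f
    using Lax_Milgram[of S _ u c f, OF S_add S_scale S_L2 S_bdd u c S_coercive that] by (auto simp: Bex_def)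
  define R where "R f = (SOME g. g \<in> L2 \<and> S g = f)" for f
  have R: "R f \<in> L2" "S (R f) = f" if "f \<in> L2" for f
    using someI_ex[OF ex[OF that]] by (auto simp: R_def)
  have RS: "R (S f) = f" if "f \<in> L2" for f
    using that by - (rule inj, auto simp: R S_L2)
  \<comment> \<open>The choice R is linear because S is injective: both sides of each identity have
    the same image under S.\<close>
  have "L2_operator \<mu> R"
    unfolding L2_operator_def
  proof (intro conjI ballI allI exI)
    show "R f \<in> L2" if "f \<in> L2" for f by (rule R(1)[OF that])
    show "R (\<lambda>x. f x + g x) = (\<lambda>x. R f x + R g x)" if "f \<in> L2" "g \<in> L2" for f g
      using that by - (rule inj, auto simp: R S_add L2_add)
    show "R (\<lambda>x. c * f x) = (\<lambda>x. c * R f x)" if "f \<in> L2" for f c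
      using that by - (rule inj, auto simp: R S_scale L2_scale)
    show "nrm (R f) \<le> inverse c * nrm f" if "f \<in> L2" for f
    proof -
      have "c * nrm (R f) \<le> nrm f"
        using lower[OF R(1)[OF that]] unfolding R(2)[OF that] .
      then show ?thesis using c by (simp add: field_simps)
    qed
  qed
  moreover have "R (\<lambda>x. T f x - z * f x) = f" "(\<lambda>x. T (R f) x - z * R f x) = f" if "f \<in> L2" for f
    using RS[OF that] R(2)[OF that] unfolding S_def[abs_def] by simp_all
  ultimately show ?thesis
    unfolding L2_spectrum_def by blast
qed

end

text \<open>Additivity and homogeneity are required on all functions, so that the algebra of
  polynomials in T holds without membership conditions. The bounds \<open>lo\<close> and
  \<open>up\<close> on the quadratic form confine the spectrum.\<close>

locale selfadjoint_operator = positive_measure \<mu> for \<mu> :: "'a \<Rightarrow> 'a \<Rightarrow> real" +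
  fixes T :: "('a \<Rightarrow> complex) \<Rightarrow> 'a \<Rightarrow> complex" and K lo up :: real
  assumes T_add: "T (\<lambda>x. f x + g x) = (\<lambda>x. T f x + T g x)"
    and T_scale: "T (\<lambda>x. c * f x) = (\<lambda>x. c * T f x)"
    and T_L2: "f \<in> L2 \<Longrightarrow> T f \<in> L2"
    and T_bdd: "f \<in> L2 \<Longrightarrow> nrm (T f) \<le> K * nrm f"
    and T_sym: "f \<in> L2 \<Longrightarrow> g \<in> L2 \<Longrightarrow> ip (T f) g = ip f (T g)"
    and T_lower: "f \<in> L2 \<Longrightarrow> lo * (nrm f)\<^sup>2 \<le> Re (ip (T f) f)"
    and T_upper: "f \<in> L2 \<Longrightarrow> Re (ip (T f) f) \<le> up * (nrm f)\<^sup>2"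
begin

abbreviation "\<sigma> \<equiv> L2_spectrum \<mu> T"
abbreviation Q :: "complex poly \<Rightarrow> ('a \<Rightarrow> complex) \<Rightarrow> 'a \<Rightarrow> complex" where "Q q \<equiv> poly_op q T"

lemma Im_ip_T: "f \<in> L2 \<Longrightarrow> Im (ip (T f) f) = 0"
  using T_sym[of f f] ip_cnj[of "T f" f] by (metis cnj.simps(2) neg_equal_zero)

text \<open>Three rotations in \<open>not_in_spectrum\<close>: since the form of T is real, u = i
  sgn (Im z) excludes nonreal z with c = |Im z|; u = 1 and u = -1 exclude the reals below
  \<open>lo\<close> and above \<open>up\<close>.\<close>

lemma spectrum_real:
  assumes "z \<in> \<sigma>"
  shows "z = of_real (Re z)" "lo \<le> Re z" "Re z \<le> up"
proof -
  note N = not_in_spectrum[of T K, OF T_add T_scale T_L2 T_bdd]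
  have "Im z = 0"
  proof (rule ccontr)
    assume "Im z \<noteq> 0"
    define s where "s = sgn (Im z)"
    have "z \<notin> \<sigma>"
    proof (rule N[where u = "\<i> * of_real s" and c = "\<bar>Im z\<bar>"])
      show "cmod (\<i> * of_real s) = 1" "0 < \<bar>Im z\<bar>"
        using \<open>Im z \<noteq> 0\<close> by (auto simp: s_def norm_mult sgn_if)
      show "\<bar>Im z\<bar> * (nrm f)\<^sup>2 \<le> Re (\<i> * of_real s * (ip (T f) f - z * of_real ((nrm f)\<^sup>2)))"
        if "f \<in> L2" for f
        using Im_ip_T[OF that] by (simp add: s_def sgn_if del: of_real_power)
    qed auto
    then show False using assms by simp
  qed
  then show "z = of_real (Re z)"
    by (simp add: complex_eq_iff)
  show "lo \<le> Re z"
  proof (rule ccontr)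
    assume "\<not> lo \<le> Re z"
    have "z \<notin> \<sigma>"
    proof (rule N[where u = 1 and c = "lo - Re z"])
      show "(lo - Re z) * (nrm f)\<^sup>2 \<le> Re (1 * (ip (T f) f - z * of_real ((nrm f)\<^sup>2)))"
        if "f \<in> L2" for f
        using T_lower[OF that] by (simp add: algebra_simps del: of_real_power)
    qed (use \<open>\<not> lo \<le> Re z\<close> in auto)
    then show False using assms by simp
  qed
  show "Re z \<le> up"
  proof (rule ccontr)
    assume "\<not> Re z \<le> up"
    have "z \<notin> \<sigma>"
    proof (rule N[where u = "-1" and c = "Re z - up"])
      show "(Re z - up) * (nrm f)\<^sup>2 \<le> Re (- 1 * (ip (T f) f - z * of_real ((nrm f)\<^sup>2)))"
        if "f \<in> L2" for f
        using T_upper[OF that] by (simp add: algebra_simps del: of_real_power)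
    qed (use \<open>\<not> Re z \<le> up\<close> in auto)
    then show False using assms by simp
  qed
qed

section \<open>Polynomials in a self-adjoint operator\<close>

lemma T_zero: "T (\<lambda>x. 0) = (\<lambda>x. 0)"
  using T_scale[of 0 "\<lambda>x. 0"] by simp

lemma T_sum: "T (\<lambda>x. \<Sum>i\<in>I. f i x) = (\<lambda>x. \<Sum>i\<in>I. T (f i) x)"
  by (induction I rule: infinite_finite_induct) (simp_all add: T_zero T_add)

lemma Q_0: "Q 0 f = (\<lambda>x. 0)"
  by (simp add: poly_op_def[abs_def])

lemma Q_pCons: "Q (pCons a q) f = (\<lambda>x. a * f x + T (Q q f) x)"
proof
  fix x
  \<comment> \<open>For q = 0 the degree of \<open>pCons a q\<close> is 0 and not
    \<open>Suc (degree q)\<close>; the additional coefficient vanishes.\<close>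
  have "Q (pCons a q) f x = (\<Sum>i\<le>Suc (degree q). coeff (pCons a q) i * (T ^^ i) f x)"
    unfolding poly_op_def
    by (rule sum.mono_neutral_left) (auto simp: coeff_eq_0 degree_pCons_le intro: order_trans)
  also have "\<dots> = a * f x + (\<Sum>i\<le>degree q. coeff q i * T ((T ^^ i) f) x)"
    by (subst sum.atMost_Suc_shift) simp
  also have "(\<Sum>i\<le>degree q. coeff q i * T ((T ^^ i) f) x) = T (Q q f) x"
    unfolding poly_op_def[abs_def] T_sum T_scale ..
  finally show "Q (pCons a q) f x = a * f x + T (Q q f) x" .
qed

lemma Q_add: "Q (p + q) f = (\<lambda>x. Q p f x + Q q f x)"
  by (induction p q rule: poly_induct2) (simp_all add: Q_0 Q_pCons T_add algebra_simps)

lemma Q_smult: "Q (smult c q) f = (\<lambda>x. c * Q q f x)"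
  by (induction q) (simp_all add: Q_0 Q_pCons T_scale algebra_simps)

lemma Q_diff: "Q (p - q) f = (\<lambda>x. Q p f x - Q q f x)"
  using Q_add[of p "- q" f] Q_smult[of "-1" q f] by simp

lemma Q_mult: "Q (p * q) f = Q p (Q q f)"
  by (induction p) (simp_all add: Q_0 Q_pCons Q_add Q_smult)

lemma Q_const: "Q [:c:] f = (\<lambda>x. c * f x)"
  by (simp add: Q_pCons Q_0 T_zero)

lemma Q_sum: "Q (\<Sum>i\<in>I. p i) f = (\<lambda>x. \<Sum>i\<in>I. Q (p i) f x)"
  by (induction I rule: infinite_finite_induct) (simp_all add: Q_0 Q_add)

lemma Q_scale: "Q q (\<lambda>x. c * f x) = (\<lambda>x. c * Q q f x)"
  by (induction q) (simp_all add: Q_0 Q_pCons T_scale algebra_simps)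

lemma Q_L2: "f \<in> L2 \<Longrightarrow> Q q f \<in> L2"
  by (induction q) (simp_all add: Q_0 Q_pCons L2_zero L2_add L2_scale T_L2)

lemma T_Q: "T (Q q f) = Q q (T f)"
proof -
  have "Q [:0, 1:] g = T g" for g
    by (simp add: Q_pCons Q_0 T_zero)
  then show ?thesis
    using Q_mult[of "[:0, 1:]" q f] Q_mult[of q "[:0, 1:]" f] by (simp only: mult.commute)
qed

lemma Q_bounded: "\<exists>B\<ge>0. \<forall>f\<in>L2. nrm (Q q f) \<le> B * nrm f"
proof (induction q)
  case 0
  show ?case by (intro exI[of _ 0]) (simp add: Q_0)
next
  case (pCons a q)
  then obtain B where B: "B \<ge> 0" "\<And>f. f \<in> L2 \<Longrightarrow> nrm (Q q f) \<le> B * nrm f" by blast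
  show ?case
  proof (intro exI[of _ "cmod a + \<bar>K\<bar> * B"] conjI ballI)
    fix f assume f: "f \<in> L2"
    have "nrm (Q (pCons a q) f) \<le> nrm (\<lambda>x. a * f x) + nrm (T (Q q f))"
      unfolding Q_pCons by (intro nrm_add_le L2_scale T_L2 Q_L2 f)
    also have "nrm (T (Q q f)) \<le> K * nrm (Q q f)"
      by (intro T_bdd Q_L2 f)
    also have "\<dots> \<le> \<bar>K\<bar> * nrm (Q q f)" by (intro mult_right_mono) auto
    also have "\<dots> \<le> \<bar>K\<bar> * (B * nrm f)" by (intro mult_left_mono B f) auto
    finally show "nrm (Q (pCons a q) f) \<le> (cmod a + \<bar>K\<bar> * B) * nrm f"
      by (simp add: nrm_scale algebra_simps)
  qed (use B in auto)
qed

lemma ip_Q: "f \<in> L2 \<Longrightarrow> g \<in> L2 \<Longrightarrow> ip (Q q f) g = ip f (Q (map_poly cnj q) g)"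
proof (induction q arbitrary: g)
  case 0
  then show ?case by (simp add: Q_0 ip_def)
next
  case (pCons a q)
  have "ip (Q (pCons a q) f) g = a * ip f g + ip (T (Q q f)) g"
    using pCons.prems by (simp add: Q_pCons ip_add_left L2_scale T_L2 Q_L2 ip_scale_left)
  also have "ip (T (Q q f)) g = ip (Q q f) (T g)"
    using pCons.prems by (intro T_sym Q_L2)
  also have "\<dots> = ip f (T (Q (map_poly cnj q) g))"
    unfolding T_Q using pCons.prems by (intro pCons.IH T_L2)
  also have "a * ip f g + \<dots> = ip f (Q (map_poly cnj (pCons a q)) g)"
    using pCons by (simp add: map_poly_pCons Q_pCons ip_add_right L2_scale T_L2 Q_L2 ip_scale_right)
  finally show ?case .
qed

text \<open>q(T) is normal: its adjoint is again a polynomial in T and therefore commutes with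
  it.\<close>

lemma nrm_Q_cnj:
  assumes "f \<in> L2"
  shows "nrm (Q (map_poly cnj q) f) = nrm (Q q f)"
proof -
  let ?q = "map_poly cnj q"
  have qq: "map_poly cnj ?q = q"
    by (simp add: map_poly_map_poly o_def)
  have "ip (Q ?q f) (Q ?q f) = ip f (Q (q * ?q) f)"
    using assms by (simp add: ip_Q Q_L2 Q_mult qq)
  also have "\<dots> = ip (Q q f) (Q q f)"
    using assms by (subst mult.commute) (simp add: ip_Q Q_L2 Q_mult)
  finally have "(nrm (Q ?q f))\<^sup>2 = (nrm (Q q f))\<^sup>2"
    using assms by (simp add: ip_self Q_L2 flip: of_real_power)
  then show ?thesis by simp
qed

text \<open>Split q into linear factors over the complex numbers. Every root z lies off the
  spectrum, so the resolvent at z bounds T - z from below, and lower bounds multiply under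
  composition.\<close>

lemma Q_bounded_below:
  assumes "q \<noteq> 0" "\<And>z. z \<in> \<sigma> \<Longrightarrow> poly q z \<noteq> 0"
  shows "\<exists>\<kappa>>0. \<forall>f\<in>L2. \<kappa> * nrm f \<le> nrm (Q q f)"
  using assms
proof (induction "degree q" arbitrary: q)
  case 0
  then obtain c where c: "q = [:c:]" "c \<noteq> 0"
    by (metis degree_0_id pCons_eq_0_iff)
  then show ?case
    by (intro exI[of _ "cmod c"]) (simp add: Q_const nrm_scale)
next
  case (Suc n)
  have "\<not> constant (poly q)"
    using Suc.hyps(2) by (simp add: constant_degree)
  then obtain z where z: "poly q z = 0"
    using fundamental_theorem_of_algebra by blast
  then obtain r where r: "q = [:- z, 1:] * r"
    unfolding poly_eq_0_iff_dvd dvd_def by blast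
  have "r \<noteq> 0" using r Suc.prems by auto
  have "degree q = Suc (degree r)"
    using r \<open>r \<noteq> 0\<close> by (simp add: degree_mult_eq del: mult_pCons_left)
  then obtain \<kappa> where \<kappa>: "\<kappa> > 0" "\<And>f. f \<in> L2 \<Longrightarrow> \<kappa> * nrm f \<le> nrm (Q r f)"
    using Suc.hyps(1)[of r] Suc.hyps(2) Suc.prems \<open>r \<noteq> 0\<close> by (auto simp: r)
  have "z \<notin> \<sigma>" using Suc.prems z by blast
  then obtain R where R: "L2_operator \<mu> R" "\<And>f. f \<in> L2 \<Longrightarrow> R (\<lambda>x. T f x - z * f x) = f"
    unfolding L2_spectrum_def by blast
  then obtain B where B: "\<And>f. f \<in> L2 \<Longrightarrow> nrm (R f) \<le> B * nrm f"
    unfolding L2_operator_def by blast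
  have lower: "nrm f \<le> (\<bar>B\<bar> + 1) * nrm (Q [:- z, 1:] f)" if f: "f \<in> L2" for f
  proof -
    have eq: "Q [:- z, 1:] f = (\<lambda>x. T f x - z * f x)"
      by (simp add: Q_pCons Q_0 T_zero)
    have "nrm f = nrm (R (Q [:- z, 1:] f))"
      using R(2)[OF f] by (simp add: eq)
    also have "\<dots> \<le> B * nrm (Q [:- z, 1:] f)"
      by (intro B Q_L2 f)
    also have "\<dots> \<le> (\<bar>B\<bar> + 1) * nrm (Q [:- z, 1:] f)"
      by (intro mult_right_mono) auto
    finally show ?thesis .
  qed
  show ?case
  proof (intro exI[of _ "\<kappa> / (\<bar>B\<bar> + 1)"] conjI ballI)
    fix f assume f: "f \<in> L2"
    have "\<kappa> * nrm f \<le> nrm (Q r f)" by (rule \<kappa>(2)[OF f])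
    also have "\<dots> \<le> (\<bar>B\<bar> + 1) * nrm (Q q f)"
      unfolding r Q_mult by (intro lower Q_L2 f)
    finally show "\<kappa> / (\<bar>B\<bar> + 1) * nrm f \<le> nrm (Q q f)"
      by (simp add: field_simps)
  qed (use \<kappa> in auto)
qed

text \<open>Unit vectors on which \<open>q(T)\<close> almost attains its norm (whose square is \<open>M\<close>) are approximate eigenvectors of
  \<open>q(T)\<^sup>* q(T)\<close>. Hence \<open>M - q\<^sup>* q\<close> must vanish somewhere on the spectrum.\<close>

lemma Q_norm_root:
  obtains M where "\<And>f. f \<in> L2 \<Longrightarrow> (nrm (Q q f))\<^sup>2 \<le> M * (nrm f)\<^sup>2"
    and "[:of_real M:] - map_poly cnj q * q \<noteq> 0 \<Longrightarrow>
      \<exists>z\<in>\<sigma>. poly ([:of_real M:] - map_poly cnj q * q) z = 0"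
proof -
  obtain B where B: "B \<ge> 0" "\<And>f. f \<in> L2 \<Longrightarrow> nrm (Q q f) \<le> B * nrm f"
    using Q_bounded by blast
  define U where "U = {f \<in> L2. nrm f = 1}"
  define M where "M = (SUP f\<in>U. (nrm (Q q f))\<^sup>2)"
  have bdd: "bdd_above ((\<lambda>f. (nrm (Q q f))\<^sup>2) ` U)"
  proof (rule bdd_aboveI2)
    show "(nrm (Q q f))\<^sup>2 \<le> B\<^sup>2" if "f \<in> U" for f
      using that B(2)[of f] by (intro power_mono) (auto simp: U_def)
  qed
  have U: "U \<noteq> {}" using ex_unit_vector by (auto simp: U_def)
  have M_upper: "(nrm (Q q f))\<^sup>2 \<le> M" if "f \<in> U" for f
    unfolding M_def by (rule cSUP_upper[OF that bdd])
  have M: "(nrm (Q q f))\<^sup>2 \<le> M * (nrm f)\<^sup>2" if f: "f \<in> L2" for f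
  proof (cases "nrm f = 0")
    case True
    then show ?thesis using B(2)[OF f] nrm_nonneg[of "Q q f"] by simp
  next
    case False
    define c where "c = 1 / nrm f"
    have c: "c > 0" "c * nrm f = 1"
      using False nrm_nonneg[of f] by (auto simp: c_def less_le)
    have "(\<lambda>x. of_real c * f x) \<in> U"
      using f c by (simp add: U_def L2_scale nrm_scale)
    then have "(c * nrm (Q q f))\<^sup>2 \<le> M"
      using M_upper c by (fastforce simp: Q_scale nrm_scale)
    then have "(nrm (Q q f))\<^sup>2 / (nrm f)\<^sup>2 \<le> M"
      by (simp add: c_def power_divide)
    then show ?thesis
      using False by (simp add: pos_divide_le_eq)
  qed
  have "M \<ge> 0"
    using U M_upper by (meson all_not_in_conv order_trans zero_le_power2)
  define r where "r = [:of_real M:] - map_poly cnj q * q"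
  have approx: "\<exists>f\<in>U. nrm (Q r f) < \<kappa>" if "\<kappa> > 0" for \<kappa>
  proof -
    \<comment> \<open>The squared norm of r(T) f will be at most M times the defect of f; dividing
      by M + 1 keeps this product below \<kappa>^2 and covers M = 0.\<close>
    have "M - \<kappa>\<^sup>2 / (M + 1) < M"
      using that \<open>M \<ge> 0\<close> by simp
    then obtain f where f: "f \<in> U" "M - \<kappa>\<^sup>2 / (M + 1) < (nrm (Q q f))\<^sup>2"
      using less_cSUP_iff[OF U bdd] unfolding M_def by blast
    let ?s = "(nrm (Q q f))\<^sup>2"
    have fL: "f \<in> L2" "nrm f = 1" using f by (auto simp: U_def)
    have "Q r f = (\<lambda>x. of_real M * f x - Q (map_poly cnj q) (Q q f) x)"
      by (simp add: r_def Q_diff Q_const Q_mult)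
    moreover have "ip f (Q (map_poly cnj q) (Q q f)) = of_real ?s"
      using fL by (simp add: ip_Q[symmetric] Q_L2 ip_self)
    \<comment> \<open>By normality the conjugated polynomial may be replaced by q in the last norm,
      so that the bound by M applies a second time.\<close>
    ultimately have "(nrm (Q r f))\<^sup>2 = M\<^sup>2 - 2 * (M * ?s) + (nrm (Q q (Q q f)))\<^sup>2"
      using fL \<open>M \<ge> 0\<close>
      by (simp add: nrm_diff_sq L2_scale Q_L2 nrm_scale ip_scale_left nrm_Q_cnj flip: of_real_power)
    also have "\<dots> \<le> M\<^sup>2 - 2 * (M * ?s) + M * ?s"
      using M[OF Q_L2[OF fL(1), of q]] by simp
    also have "\<dots> = M * (M - ?s)"
      by (simp add: algebra_simps power2_eq_square)
    also have "\<dots> \<le> M * (\<kappa>\<^sup>2 / (M + 1))"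
      using f \<open>M \<ge> 0\<close> by (intro mult_left_mono) auto
    also have "\<dots> < \<kappa>\<^sup>2"
      using that \<open>M \<ge> 0\<close> by (simp add: field_simps)
    finally have "nrm (Q r f) < \<kappa>"
      using that power2_less_imp_less by fastforce
    then show ?thesis using f by blast
  qed
  have "\<exists>z\<in>\<sigma>. poly r z = 0" if "r \<noteq> 0"
  proof (rule ccontr)
    assume "\<not> (\<exists>z\<in>\<sigma>. poly r z = 0)"
    then obtain \<kappa> where \<kappa>: "\<kappa> > 0" "\<And>f. f \<in> L2 \<Longrightarrow> \<kappa> * nrm f \<le> nrm (Q r f)"
      using Q_bounded_below[OF \<open>r \<noteq> 0\<close>] by blast
    obtain f where "f \<in> U" "nrm (Q r f) < \<kappa>" using approx \<kappa>(1) by blast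
    then show False using \<kappa>(2)[of f] by (simp add: U_def)
  qed
  then show ?thesis using that M unfolding r_def by blast
qed

text \<open>For q = X the polynomial of \<open>Q_norm_root\<close> is M - X^2, which is nonzero
  whatever M is, so it has a root in the spectrum.\<close>

lemma spectrum_nonempty: "\<sigma> \<noteq> {}"
proof -
  obtain M where M: "[:of_real M:] - map_poly cnj [:0, 1:] * [:0, 1:] \<noteq> 0 \<Longrightarrow>
      \<exists>z\<in>\<sigma>. poly ([:of_real M:] - map_poly cnj [:0, 1:] * [:0, 1:]) z = 0"
    using Q_norm_root[of "[:0, 1:]"] by blast
  have "coeff ([:of_real M:] - map_poly cnj [:0, 1:] * [:0, 1:]) 2 \<noteq> 0"
    by (simp add: map_poly_pCons numeral_2_eq_2)
  then have "[:of_real M:] - map_poly cnj [:0, 1:] * [:0, 1:] \<noteq> 0"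
    by (metis coeff_0)
  then show ?thesis using M by blast
qed

text \<open>At a real root z of M - q* q, with q* the polynomial with conjugated coefficients, M
  equals |q(z)|^2. If that polynomial is identically zero, every point of the spectrum is a root,
  which is where nonemptiness enters.\<close>

lemma nrm_Q_le_spectrum: "\<exists>z\<in>\<sigma>. \<forall>f\<in>L2. nrm (Q q f) \<le> cmod (poly q z) * nrm f"
proof -
  obtain M where M: "\<And>f. f \<in> L2 \<Longrightarrow> (nrm (Q q f))\<^sup>2 \<le> M * (nrm f)\<^sup>2"
    and root: "[:of_real M:] - map_poly cnj q * q \<noteq> 0 \<Longrightarrow>
      \<exists>z\<in>\<sigma>. poly ([:of_real M:] - map_poly cnj q * q) z = 0"
    using Q_norm_root by blast
  obtain z where z: "z \<in> \<sigma>" "poly ([:of_real M:] - map_poly cnj q * q) z = 0"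
    using root spectrum_nonempty by (cases "[:of_real M:] - map_poly cnj q * q = 0") auto
  have "cnj z = z"
    using spectrum_real(1)[OF z(1)] by (metis complex_cnj_complex_of_real)
  then have "of_real M = cnj (poly q z) * poly q z"
    using z(2) by simp
  then have "complex_of_real M = of_real ((cmod (poly q z))\<^sup>2)"
    by (simp only: complex_norm_square mult.commute)
  then have MM: "M = (cmod (poly q z))\<^sup>2"
    by (simp only: of_real_eq_iff)
  have "nrm (Q q f) \<le> cmod (poly q z) * nrm f" if "f \<in> L2" for f
    using M[OF that] unfolding MM power_mult_distrib[symmetric]
    by (rule power2_le_imp_le) simp
  then show ?thesis using z(1) by blast
qed

lemma nrm_Q_le:
  assumes "\<And>z. z \<in> \<sigma> \<Longrightarrow> cmod (poly q z) \<le> e" "f \<in> L2"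
  shows "nrm (Q q f) \<le> e * nrm f"
proof -
  obtain z where z: "z \<in> \<sigma>" "nrm (Q q f) \<le> cmod (poly q z) * nrm f"
    using nrm_Q_le_spectrum[of q] assms(2) by blast
  have "cmod (poly q z) * nrm f \<le> e * nrm f"
    using assms(1)[OF z(1)] by (rule mult_right_mono) simp
  then show ?thesis using z(2) by linarith
qed

text \<open>\<open>fun_calc\<close> quantifies over all approximating sequences, yet one sequence p
  suffices: any other differs from p by polynomials that are uniformly small on the spectrum, hence
  small in norm by \<open>nrm_Q_le\<close>. Applying a competing S' to p itself gives
  uniqueness.\<close>

lemma fun_calc_eqI:
  assumes lim: "uniform_limit \<sigma> (\<lambda>n. poly (p n)) \<phi> sequentially"
    and S: "L2_operator \<mu> S" and S0: "\<And>f. f \<notin> L2 \<Longrightarrow> S f = (\<lambda>x. 0)"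
    and e: "e \<longlonglongrightarrow> 0" and e0: "\<And>n. 0 \<le> e n"
    and pS: "\<And>n f. f \<in> L2 \<Longrightarrow> nrm (\<lambda>x. Q (p n) f x - S f x) \<le> e n * nrm f"
  shows "fun_calc \<mu> T \<phi> = S"
  unfolding fun_calc_def
proof (rule the_equality)
  have S_L2: "S f \<in> L2" if "f \<in> L2" for f
    using S that by (auto simp: L2_operator_def)
  show "has_fun_calc \<mu> T \<phi> S"
    unfolding has_fun_calc_def
  proof (intro conjI allI impI S S0)
    fix q assume q: "uniform_limit \<sigma> (\<lambda>n. poly (q n)) \<phi> sequentially"
    show "(\<lambda>n. L2_opnorm \<mu> (\<lambda>f x. Q (q n) f x - S f x)) \<longlonglongrightarrow> 0"
    proof (rule LIMSEQ_I)
      fix r :: real assume r: "0 < r"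
      have "\<forall>\<^sub>F n in sequentially. (\<forall>z\<in>\<sigma>. dist (poly (p n) z) (\<phi> z) < r/4) \<and>
          (\<forall>z\<in>\<sigma>. dist (poly (q n) z) (\<phi> z) < r/4) \<and> e n < r/4"
        using uniform_limitD[OF lim, of "r/4"] uniform_limitD[OF q, of "r/4"] order_tendstoD(2)[OF e, of "r/4"] r
        by (intro eventually_conj) (auto simp del: less_divide_eq_numeral1)
      then obtain N where N: "\<And>n z. n \<ge> N \<Longrightarrow> z \<in> \<sigma> \<Longrightarrow> dist (poly (p n) z) (\<phi> z) < r/4"
          "\<And>n z. n \<ge> N \<Longrightarrow> z \<in> \<sigma> \<Longrightarrow> dist (poly (q n) z) (\<phi> z) < r/4" "\<And>n. n \<ge> N \<Longrightarrow> e n < r/4"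
        by (auto simp: eventually_sequentially)
      have "norm (L2_opnorm \<mu> (\<lambda>f x. Q (q n) f x - S f x) - 0) < r" if n: "n \<ge> N" for n
      proof -
        have pq: "cmod (poly (q n - p n) z) \<le> r/2" if "z \<in> \<sigma>" for z
          using N(1)[OF n that] N(2)[OF n that] dist_triangle2[of "poly (q n) z" "poly (p n) z" "\<phi> z"]
          by (simp add: dist_norm)
        \<comment> \<open>The pieces add up to 3/4 r, since the supremum over the unit ball
          preserves only a non-strict inequality and a bound below r is wanted.\<close>
        have "nrm (\<lambda>x. Q (q n) f x - S f x) \<le> 3/4 * r * nrm f" if f: "f \<in> L2" for f
        proof -
          have "(\<lambda>x. Q (q n) f x - S f x) = (\<lambda>x. Q (q n - p n) f x + (Q (p n) f x - S f x))"
            by (simp add: Q_diff)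
          then have "nrm (\<lambda>x. Q (q n) f x - S f x) \<le> nrm (Q (q n - p n) f) + nrm (\<lambda>x. Q (p n) f x - S f x)"
            using nrm_add_le[OF Q_L2[OF f] L2_diff[OF Q_L2[OF f] S_L2[OF f]]] by simp
          also have "\<dots> \<le> r/2 * nrm f + e n * nrm f"
            by (intro add_mono nrm_Q_le pq pS f)
          also have "\<dots> \<le> r/2 * nrm f + r/4 * nrm f"
            using N(3)[OF n] by (intro add_mono order_refl mult_right_mono) auto
          finally show ?thesis by (simp add: algebra_simps)
        qed
        from L2_opnorm_bounds(1,2)[OF this] r show ?thesis by simp
      qed
      then show "\<exists>N. \<forall>n\<ge>N. norm (L2_opnorm \<mu> (\<lambda>f x. Q (q n) f x - S f x) - 0) < r"
        by blast
    qed
  qed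
next
  fix S' assume "has_fun_calc \<mu> T \<phi> S'"
  then have S': "L2_operator \<mu> S'" and S'0: "\<And>f. f \<notin> L2 \<Longrightarrow> S' f = (\<lambda>x. 0)"
    and lim': "(\<lambda>n. L2_opnorm \<mu> (\<lambda>f x. Q (p n) f x - S' f x)) \<longlonglongrightarrow> 0"
    using lim by (auto simp: has_fun_calc_def)
  have S_L2: "S f \<in> L2" "S' f \<in> L2" if "f \<in> L2" for f
    using S S' that by (auto simp: L2_operator_def)
  obtain B' where B': "\<And>f. f \<in> L2 \<Longrightarrow> nrm (S' f) \<le> B' * nrm f"
    using S' unfolding L2_operator_def by blast
  \<comment> \<open>\<open>L2_opnorm\<close> sees the unit ball only; other f are scaled into it
    afterwards by \<open>1 / (1 + nrm f)\<close>, which is safe for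
    \<open>nrm f = 0\<close>.\<close>
  have eq1: "S' f = S f" if f: "f \<in> L2" "nrm f \<le> 1" for f
  proof -
    have "nrm (\<lambda>x. S' f x - S f x) \<le> e n + L2_opnorm \<mu> (\<lambda>f x. Q (p n) f x - S' f x)" for n
    proof -
      obtain B where B: "B \<ge> 0" "\<And>f. f \<in> L2 \<Longrightarrow> nrm (Q (p n) f) \<le> B * nrm f"
        using Q_bounded by blast
      have bd: "nrm (\<lambda>x. Q (p n) g x - S' g x) \<le> (B + \<bar>B'\<bar>) * nrm g" if g: "g \<in> L2" for g
      proof -
        have "B' * nrm g \<le> \<bar>B'\<bar> * nrm g" by (intro mult_right_mono) auto
        then show ?thesis
          using nrm_diff_le[OF Q_L2[OF g, of "p n"] S_L2(2)[OF g]] B(2)[OF g] B'[OF g]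
          by (simp add: algebra_simps)
      qed
      have "(\<lambda>x. S' f x - S f x) = (\<lambda>x. (Q (p n) f x - S f x) - (Q (p n) f x - S' f x))"
        by auto
      then have "nrm (\<lambda>x. S' f x - S f x) \<le>
          nrm (\<lambda>x. Q (p n) f x - S f x) + nrm (\<lambda>x. Q (p n) f x - S' f x)"
        using nrm_diff_le[OF L2_diff[OF Q_L2[OF f(1)] S_L2(1)[OF f(1)]]
            L2_diff[OF Q_L2[OF f(1)] S_L2(2)[OF f(1)]], of "p n" "p n"] by simp
      moreover have "nrm (\<lambda>x. Q (p n) f x - S f x) \<le> e n * 1"
        using pS[OF f(1), of n] mult_left_mono[OF f(2) e0[of n]] by linarith
      moreover have "nrm (\<lambda>x. Q (p n) f x - S' f x) \<le> L2_opnorm \<mu> (\<lambda>f x. Q (p n) f x - S' f x)"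
        using L2_opnorm_bounds(3)[OF bd] B f by simp
      ultimately show ?thesis by simp
    qed
    then have "nrm (\<lambda>x. S' f x - S f x) \<le> 0 + 0"
      by (intro LIMSEQ_le_const[OF tendsto_add[OF e lim']]) auto
    then have "nrm (\<lambda>x. S' f x - S f x) = 0"
      using nrm_nonneg[of "\<lambda>x. S' f x - S f x"] by simp
    then have "S' f x - S f x = 0" for x
      by (rule nrm_eq_0D[OF L2_diff[OF S_L2(2) S_L2(1)], OF f(1) f(1)])
    then show ?thesis by auto
  qed
  have "S' f = S f" if f: "f \<in> L2" for f
  proof -
    define c where "c = 1 / (1 + nrm f)"
    have c: "c > 0" "c * nrm f \<le> 1" by (auto simp: c_def divide_simps add_pos_nonneg)
    have "S' (\<lambda>x. of_real c * f x) = S (\<lambda>x. of_real c * f x)"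
      using f c by (intro eq1) (auto simp: L2_scale nrm_scale)
    moreover have "S' (\<lambda>x. of_real c * f x) = (\<lambda>x. of_real c * S' f x)"
        "S (\<lambda>x. of_real c * f x) = (\<lambda>x. of_real c * S f x)"
      using S S' f by (auto simp: L2_operator_def)
    ultimately show ?thesis using c by (auto simp: fun_eq_iff)
  qed
  then show "S' = S" using S0 S'0 by (metis ext)
qed

end

section \<open>Binomial series of fractional powers\<close>

text \<open>Coefficients of \<open>(1 - w) powr (\<gamma> - 1)\<close>; their differences are those of \<open>(1 - w) powr \<gamma>\<close>.\<close>

definition frac_coeff :: "real \<Rightarrow> nat \<Rightarrow> real" where
  "frac_coeff \<gamma> k = pochhammer (1 - \<gamma>) k / fact k"

definition frac_diff :: "real \<Rightarrow> nat \<Rightarrow> real" where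
  "frac_diff \<gamma> k = (case k of 0 \<Rightarrow> 1 | Suc j \<Rightarrow> frac_coeff \<gamma> (Suc j) - frac_coeff \<gamma> j)"

lemma frac_coeff_0 [simp]: "frac_coeff \<gamma> 0 = 1"
  by (simp add: frac_coeff_def)

lemma frac_coeff_Suc: "frac_coeff \<gamma> (Suc k) = frac_coeff \<gamma> k * (1 - \<gamma> / real (Suc k))"
  by (simp add: frac_coeff_def pochhammer_Suc field_simps)

text \<open>The difference of consecutive coefficients is the Pochhammer quotient for -\<gamma>,
  that is, a coefficient of the generalized binomial series.\<close>

lemma frac_diff_eq: "frac_diff \<gamma> k = (-1) ^ k * (\<gamma> gchoose k)"
proof (cases k)
  case 0
  then show ?thesis by (simp add: frac_diff_def)
next
  case (Suc j)
  have "frac_diff \<gamma> k = - \<gamma> * (pochhammer (1 - \<gamma>) j / fact (Suc j))"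
    unfolding Suc frac_diff_def nat.case frac_coeff_Suc
    by (simp add: frac_coeff_def right_diff_distrib diff_divide_distrib divide_divide_eq_left mult.commute del: of_nat_Suc)
  also have "\<dots> = pochhammer (- \<gamma>) (Suc j) / fact (Suc j)"
    by (simp add: pochhammer_rec)
  finally show ?thesis
    by (simp add: gbinomial_pochhammer Suc flip: power_add mult_2)
qed

context
  fixes \<gamma> :: real
  assumes \<gamma>: "0 < \<gamma>" "\<gamma> < 1"
begin

text \<open>Each factor satisfies 1 - \<gamma>/(k+1) \<le> exp (-\<gamma>/(k+1)) \<le> ((k+2)/(k+1))
  powr (-\<gamma>), and the product of the right-hand sides telescopes.\<close>

lemma frac_coeff_bounds: "0 \<le> frac_coeff \<gamma> k \<and> frac_coeff \<gamma> k \<le> real (Suc k) powr (- \<gamma>)"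
proof (induction k)
  case (Suc k)
  have g: "0 \<le> 1 - \<gamma> / real (Suc k)"
    using \<gamma> by (simp add: field_simps)
  have "1 - \<gamma> / real (Suc k) \<le> exp (- \<gamma> * (1 / real (Suc k)))"
    using exp_ge_add_one_self[of "- \<gamma> * (1 / real (Suc k))"] by simp
  also have "\<dots> \<le> exp (- \<gamma> * ln (1 + 1 / real (Suc k)))"
    using \<gamma> ln_add_one_self_le_self[of "1 / real (Suc k)"] by (simp add: divide_simps)
  also have "\<dots> = (1 + 1 / real (Suc k)) powr (- \<gamma>)"
    by (simp add: powr_def add_pos_pos less_imp_neq[symmetric])
  finally have "frac_coeff \<gamma> (Suc k) \<le> real (Suc k) powr (- \<gamma>) * (1 + 1 / real (Suc k)) powr (- \<gamma>)"
    unfolding frac_coeff_Suc using Suc.IH g by (intro mult_mono) auto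
  also have "\<dots> = (real (Suc k) * (1 + 1 / real (Suc k))) powr (- \<gamma>)"
    by (rule powr_mult[symmetric])
  also have "real (Suc k) * (1 + 1 / real (Suc k)) = real (Suc (Suc k))"
    by (simp add: field_simps)
  finally show ?case
    unfolding frac_coeff_Suc using Suc.IH g by simp
qed simp

lemma frac_coeff_decreasing: "frac_coeff \<gamma> (Suc k) \<le> frac_coeff \<gamma> k"
  unfolding frac_coeff_Suc using frac_coeff_bounds[of k] \<gamma> by (intro mult_left_le) auto

lemma frac_coeff_tendsto_0: "frac_coeff \<gamma> \<longlonglongrightarrow> 0"
proof (rule tendsto_sandwich[of "\<lambda>_. 0" _ _ "\<lambda>k. real (Suc k) powr (- \<gamma>)"])
  show "(\<lambda>k. real (Suc k) powr (- \<gamma>)) \<longlonglongrightarrow> 0"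
    using \<gamma> by (intro tendsto_neg_powr filterlim_compose[OF filterlim_real_sequentially filterlim_Suc]) auto
qed (use frac_coeff_bounds in auto)

text \<open>After index 0 all differences are nonpositive, so their absolute values telescope to the
  drop of \<open>frac_coeff\<close> from 1 to 0.\<close>

lemma summable_abs_frac_diff: "summable (\<lambda>k. \<bar>frac_diff \<gamma> k\<bar>)"
proof (subst summable_Suc_iff[symmetric])
  have "(\<lambda>k. frac_coeff \<gamma> k - frac_coeff \<gamma> (Suc k)) sums (frac_coeff \<gamma> 0 - 0)"
    by (rule telescope_sums'[OF frac_coeff_tendsto_0])
  moreover have "\<bar>frac_diff \<gamma> (Suc k)\<bar> = frac_coeff \<gamma> k - frac_coeff \<gamma> (Suc k)" for k
    using frac_coeff_decreasing[of k] by (simp add: frac_diff_def)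
  ultimately show "summable (\<lambda>k. \<bar>frac_diff \<gamma> (Suc k)\<bar>)"
    by (simp add: sums_iff)
qed

lemma frac_diff_sums_open: "\<bar>w\<bar> < 1 \<Longrightarrow> (\<lambda>k. frac_diff \<gamma> k * w ^ k) sums ((1 - w) powr \<gamma>)"
  using gen_binomial_real[of "- w" \<gamma>]
  by (simp add: frac_diff_eq mult_ac flip: power_mult_distrib)

text \<open>The closed interval matters: w = 1 corresponds to the point 0, the bottom of the range
  allowed for the spectrum of \<Delta>. The binomial theorem holds inside, and both sides are
  continuous up to the ends because \<gamma> > 0.\<close>

lemma frac_diff_uniform_limit:
  "uniform_limit {-1..1} (\<lambda>n w. \<Sum>k<n. frac_diff \<gamma> k * w ^ k) (\<lambda>w. (1 - w) powr \<gamma>) sequentially"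
proof -
  have lim: "uniform_limit {-1..1} (\<lambda>n w. \<Sum>k<n. frac_diff \<gamma> k * w ^ k)
      (\<lambda>w. \<Sum>k. frac_diff \<gamma> k * w ^ k) sequentially"
  proof (rule Weierstrass_m_test[OF _ summable_abs_frac_diff])
    fix k and w :: real assume "w \<in> {-1..1}"
    then have "\<bar>w\<bar> ^ k \<le> 1" by (intro power_le_one) auto
    then show "norm (frac_diff \<gamma> k * w ^ k) \<le> \<bar>frac_diff \<gamma> k\<bar>"
      by (simp add: abs_mult power_abs mult_left_le)
  qed
  have cont: "continuous_on {-1..1} (\<lambda>w. \<Sum>k. frac_diff \<gamma> k * w ^ k)"
    by (rule uniform_limit_theorem[OF _ lim]) (auto intro!: always_eventually continuous_intros)
  have "(\<Sum>k. frac_diff \<gamma> k * w ^ k) = (1 - w) powr \<gamma>" if "w \<in> {-1..1}" for w :: real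
  proof -
    have cl: "closure {-1<..<1::real} = {-1..1}" by simp
    show ?thesis
    proof (rule continuous_constant_on_closure[of "{-1<..<1}" "\<lambda>w. (\<Sum>k. frac_diff \<gamma> k * w ^ k) - (1 - w) powr \<gamma>" 0 w, simplified])
      show "continuous_on {-1..1} (\<lambda>w. (\<Sum>k. frac_diff \<gamma> k * w ^ k) - (1 - w) powr \<gamma>)"
        using \<gamma> by (intro continuous_intros cont continuous_on_powr') auto
      show "-1 \<le> w \<and> w \<le> 1" using that by simp
    qed (use frac_diff_sums_open in \<open>auto simp: sums_iff abs_less_iff\<close>)
  qed
  then show ?thesis
    using uniform_limit_cong'[THEN iffD1, OF refl _ lim] by simp
qed

end

section \<open>The Laplacian on \<open>L\<^sup>2\<close>\<close>

text \<open>The constant of (LB) may be decreased, so \<epsilon> \<le> 1/4 is harmless; it keeps 1 -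
  \<epsilon> and 1 - 2\<epsilon> nonnegative.\<close>

locale LB_graph =
  fixes \<mu> :: "'a \<Rightarrow> 'a \<Rightarrow> real" and \<epsilon> :: real
  assumes graph: "weighted_graph \<mu>"
    and loop: "(x, x) \<in> edges \<mu>"
    and \<epsilon>: "0 < \<epsilon>" "\<epsilon> \<le> 1/4"
    and edge_weight: "(x, y) \<in> edges \<mu> \<Longrightarrow> \<epsilon> * vmeas \<mu> x \<le> \<mu> x y"
begin

lemma weight_sym: "\<mu> x y = \<mu> y x"
  and weight_nonneg: "0 \<le> \<mu> x y"
  and weight_summable: "\<mu> x summable_on nbrs \<mu> x"
  using graph by (auto simp: weighted_graph_def)

lemma nbrs_sym: "y \<in> nbrs \<mu> x \<longleftrightarrow> x \<in> nbrs \<mu> y"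
  by (simp add: edges_def weight_sym[of x y])

lemma weight_eq_0: "y \<notin> nbrs \<mu> x \<Longrightarrow> \<mu> x y = 0"
  using weight_nonneg[of x y] by (simp add: edges_def)

lemma weight_sum_le: "finite F \<Longrightarrow> F \<subseteq> nbrs \<mu> x \<Longrightarrow> sum (\<mu> x) F \<le> vmeas \<mu> x"
  unfolding vmeas_def by (intro finite_sum_le_infsum weight_summable) (auto simp: weight_nonneg)

sublocale positive_measure \<mu>
proof
  fix x
  have "0 < \<mu> x x" using loop[of x] by (simp add: edges_def)
  then show "vmeas \<mu> x > 0"
    using weight_sum_le[of "{x}" x] loop[of x] by simp
qed

text \<open>Every neighbour takes at least the share \<epsilon> of \<open>m x\<close>, so there are
  at most 1/\<epsilon> of them. All neighbourhood sums become finite.\<close>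

lemma finite_nbrs [simp]: "finite (nbrs \<mu> x)"
proof (rule ccontr)
  assume "infinite (nbrs \<mu> x)"
  obtain n :: nat where n: "1 / \<epsilon> < real n"
    using reals_Archimedean2 by blast
  obtain F where F: "F \<subseteq> nbrs \<mu> x" "finite F" "card F = n"
    using infinite_arbitrarily_large[OF \<open>infinite (nbrs \<mu> x)\<close>] by metis
  have "real n * (\<epsilon> * m x) = (\<Sum>y\<in>F. \<epsilon> * m x)" using F by simp
  also have "\<dots> \<le> sum (\<mu> x) F"
    using F by (intro sum_mono edge_weight) auto
  also have "\<dots> \<le> m x" by (rule weight_sum_le[OF F(2,1)])
  finally have "real n * \<epsilon> \<le> 1" using vmeas_pos[of x] by simp
  then show False using n \<epsilon> by (simp add: field_simps)
qed

lemma vmeas_eq: "m x = sum (\<mu> x) (nbrs \<mu> x)"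
  by (simp add: vmeas_def)

lemma sum_nbrs_superset:
  fixes f :: "'a \<Rightarrow> 'b::real_normed_vector"
  assumes "finite A" "nbrs \<mu> x \<subseteq> A"
  shows "(\<Sum>y\<in>nbrs \<mu> x. \<mu> x y *\<^sub>R f y) = (\<Sum>y\<in>A. \<mu> x y *\<^sub>R f y)"
  using assms by (intro sum.mono_neutral_left) (auto simp: weight_eq_0)

lemma weight_sum_superset:
  assumes "finite A" "nbrs \<mu> x \<subseteq> A"
  shows "sum (\<mu> x) A = m x"
  using sum_nbrs_superset[OF assms, of "\<lambda>_. 1 :: real"] by (simp add: vmeas_eq)

lemma Pop_eq:
  fixes f :: "'a \<Rightarrow> 'b::real_normed_vector"
  shows "Pop \<mu> f x = (1 / m x) *\<^sub>R (\<Sum>y\<in>nbrs \<mu> x. \<mu> x y *\<^sub>R f y)"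
  by (simp add: Pop_def)

lemma vmeas_Pop: "of_real (m x) * Pop \<mu> f x = (\<Sum>y\<in>nbrs \<mu> x. of_real (\<mu> x y) * f y :: complex)"
  using vmeas_pos[of x] by (simp add: Pop_eq scaleR_conv_of_real)

lemma Pop_add:
  fixes f :: "'a \<Rightarrow> 'b::real_normed_vector"
  shows "Pop \<mu> (\<lambda>x. f x + g x) = (\<lambda>x. Pop \<mu> f x + Pop \<mu> g x)"
  by (auto simp: Pop_eq scaleR_add_right sum.distrib)

lemma Pop_diff:
  fixes f :: "'a \<Rightarrow> 'b::real_normed_vector"
  shows "Pop \<mu> (\<lambda>x. f x - g x) = (\<lambda>x. Pop \<mu> f x - Pop \<mu> g x)"
  by (auto simp: Pop_eq scaleR_diff_right sum_subtractf)

lemma Pop_scale: "Pop \<mu> (\<lambda>x. c * f x :: complex) = (\<lambda>x. c * Pop \<mu> f x)"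
  by (auto simp: Pop_eq sum_distrib_left scaleR_conv_of_real mult_ac)

lemma Pop_of_real: "Pop \<mu> (\<lambda>x. of_real (f x) :: complex) = (\<lambda>x. of_real (Pop \<mu> f x))"
  by (auto simp: Pop_eq scaleR_conv_of_real)

lemma Pop_funpow_of_real: "(Pop \<mu> ^^ k) (\<lambda>x. of_real (f x) :: complex) = (\<lambda>x. of_real ((Pop \<mu> ^^ k) f x))"
  by (induction k) (simp_all add: Pop_of_real)

text \<open>\<open>P - \<epsilon>\<close> is \<open>1 - \<epsilon>\<close> times a Markov operator, because of the loops.\<close>

lemma nrm_Pop_lazy:
  assumes f: "f \<in> L2"
  shows "(\<lambda>x. Pop \<mu> f x - of_real \<epsilon> * f x) \<in> L2" "nrm (\<lambda>x. Pop \<mu> f x - of_real \<epsilon> * f x) \<le> (1 - \<epsilon>) * nrm f"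
proof -
  \<comment> \<open>Weight with the mass \<epsilon> \<open>m x\<close> removed from the loop at x;
    still symmetric and nonnegative, of total mass (1 - \<epsilon>) \<open>m x\<close>.\<close>
  define \<nu> where "\<nu> x y = \<mu> x y - (if x = y then \<epsilon> * m x else 0)" for x y
  have \<nu>_nonneg: "0 \<le> \<nu> x y" for x y
    using edge_weight[OF loop[of x]] weight_nonneg[of x y] by (auto simp: \<nu>_def)
  have \<nu>_sym: "\<nu> x y = \<nu> y x" for x y
    by (auto simp: \<nu>_def weight_sym[of x y])
  have \<nu>_0: "\<nu> x y = 0" if "y \<notin> nbrs \<mu> x" for x y
    using weight_eq_0[OF that] loop[of x] that by (auto simp: \<nu>_def)
  have \<nu>_sum: "sum (\<nu> x) A = (1 - \<epsilon>) * m x" if "finite A" "nbrs \<mu> x \<subseteq> A" for A x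
  proof -
    have "x \<in> A" using loop[of x] that by auto
    then show ?thesis
      using that by (simp add: \<nu>_def[abs_def] sum_subtractf weight_sum_superset algebra_simps)
  qed
  define N where "N x = Pop \<mu> f x - of_real \<epsilon> * f x" for x
  have N_eq: "of_real (m x) * N x = (\<Sum>y\<in>nbrs \<mu> x. of_real (\<nu> x y) * f y)" for x
  proof -
    have "(\<Sum>y\<in>nbrs \<mu> x. of_real (\<nu> x y) * f y) =
        (\<Sum>y\<in>nbrs \<mu> x. of_real (\<mu> x y) * f y - (if x = y then of_real (\<epsilon> * m x) * f y else 0))"
      by (intro sum.cong) (auto simp: \<nu>_def algebra_simps)
    also have "\<dots> = (\<Sum>y\<in>nbrs \<mu> x. of_real (\<mu> x y) * f y) - of_real (\<epsilon> * m x) * f x"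
      using loop[of x] by (simp add: sum_subtractf)
    finally show ?thesis
      by (simp add: N_def right_diff_distrib vmeas_Pop)
  qed
  \<comment> \<open>Cauchy-Schwarz against \<nu> gives one factor 1 - \<epsilon>; the second comes
    from summing over x first, by symmetry of \<nu>.\<close>
  have point: "(cmod (N x))\<^sup>2 * m x \<le> (1 - \<epsilon>) * (\<Sum>y\<in>nbrs \<mu> x. \<nu> x y * (cmod (f y))\<^sup>2)" for x
  proof -
    have "m x * cmod (N x) = cmod (of_real (m x) * N x)"
      by (simp add: norm_mult vmeas_nonneg)
    also have "\<dots> \<le> (\<Sum>y\<in>nbrs \<mu> x. cmod (of_real (\<nu> x y) * f y))"
      unfolding N_eq by (rule norm_sum)
    also have "\<dots> = (\<Sum>y\<in>nbrs \<mu> x. sqrt (\<nu> x y) * (sqrt (\<nu> x y) * cmod (f y)))"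
      by (intro sum.cong refl) (simp add: norm_mult \<nu>_nonneg flip: mult.assoc)
    finally have "(m x * cmod (N x))\<^sup>2 \<le> (\<Sum>y\<in>nbrs \<mu> x. sqrt (\<nu> x y) * (sqrt (\<nu> x y) * cmod (f y)))\<^sup>2"
      by (intro power_mono) (auto simp: vmeas_nonneg)
    also have "\<dots> \<le> (\<Sum>y\<in>nbrs \<mu> x. (sqrt (\<nu> x y))\<^sup>2) * (\<Sum>y\<in>nbrs \<mu> x. (sqrt (\<nu> x y) * cmod (f y))\<^sup>2)"
      by (rule Cauchy_Schwarz_ineq_sum)
    also have "\<dots> = (1 - \<epsilon>) * m x * (\<Sum>y\<in>nbrs \<mu> x. \<nu> x y * (cmod (f y))\<^sup>2)"
      by (simp add: power_mult_distrib \<nu>_nonneg \<nu>_sum)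
    finally have "m x * ((cmod (N x))\<^sup>2 * m x) \<le> m x * ((1 - \<epsilon>) * (\<Sum>y\<in>nbrs \<mu> x. \<nu> x y * (cmod (f y))\<^sup>2))"
      by (simp add: power2_eq_square mult_ac)
    then show ?thesis using vmeas_pos[of x] by simp
  qed
  have "(\<Sum>x\<in>F. (cmod (N x))\<^sup>2 * m x) \<le> ((1 - \<epsilon>) * nrm f)\<^sup>2" if F: "finite F" for F
  proof -
    define A where "A = (\<Union>x\<in>F. nbrs \<mu> x)"
    have A: "finite A" using F by (auto simp: A_def)
    have "(\<Sum>x\<in>F. (cmod (N x))\<^sup>2 * m x) \<le> (\<Sum>x\<in>F. (1 - \<epsilon>) * (\<Sum>y\<in>A. \<nu> x y * (cmod (f y))\<^sup>2))"
    proof (rule sum_mono)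
      fix x assume "x \<in> F"
      then have "(\<Sum>y\<in>nbrs \<mu> x. \<nu> x y * (cmod (f y))\<^sup>2) = (\<Sum>y\<in>A. \<nu> x y * (cmod (f y))\<^sup>2)"
        using A by (intro sum.mono_neutral_left) (auto simp: A_def \<nu>_0)
      then show "(cmod (N x))\<^sup>2 * m x \<le> (1 - \<epsilon>) * (\<Sum>y\<in>A. \<nu> x y * (cmod (f y))\<^sup>2)"
        using point[of x] by simp
    qed
    also have "\<dots> = (1 - \<epsilon>) * (\<Sum>x\<in>F. \<Sum>y\<in>A. (cmod (f y))\<^sup>2 * \<nu> y x)"
      unfolding sum_distrib_left[symmetric]
      by (intro arg_cong[where f = "(*) (1 - \<epsilon>)"] sum.cong refl) (metis \<nu>_sym mult.commute)
    also have "\<dots> = (1 - \<epsilon>) * (\<Sum>y\<in>A. (cmod (f y))\<^sup>2 * (\<Sum>x\<in>F. \<nu> y x))"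
      by (subst sum.swap) (simp add: sum_distrib_left)
    also have "\<dots> \<le> (1 - \<epsilon>) * (\<Sum>y\<in>A. (cmod (f y))\<^sup>2 * ((1 - \<epsilon>) * m y))"
    proof -
      have "(\<Sum>x\<in>F. \<nu> y x) \<le> (1 - \<epsilon>) * m y" for y
      proof -
        have "(\<Sum>x\<in>F. \<nu> y x) \<le> (\<Sum>x\<in>F \<union> nbrs \<mu> y. \<nu> y x)"
          using F by (intro sum_mono2) (auto simp: \<nu>_nonneg)
        then show ?thesis using \<nu>_sum[of "F \<union> nbrs \<mu> y" y] F by simp
      qed
      then show ?thesis
        using \<epsilon> by (intro mult_left_mono sum_mono) auto
    qed
    also have "\<dots> = (1 - \<epsilon>)\<^sup>2 * (\<Sum>y\<in>A. (cmod (f y))\<^sup>2 * m y)"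
      by (simp add: power2_eq_square sum_distrib_left mult_ac)
    also have "\<dots> \<le> (1 - \<epsilon>)\<^sup>2 * (nrm f)\<^sup>2"
      by (intro mult_left_mono finite_sum_le_nrm_sq f A) auto
    finally show ?thesis by (simp add: power_mult_distrib)
  qed
  then show "(\<lambda>x. Pop \<mu> f x - of_real \<epsilon> * f x) \<in> L2" "nrm (\<lambda>x. Pop \<mu> f x - of_real \<epsilon> * f x) \<le> (1 - \<epsilon>) * nrm f"
    using L2_bounded_sums[of N "(1 - \<epsilon>) * nrm f"] \<epsilon> by (auto simp: N_def[abs_def])
qed

lemma Pop_L2: "f \<in> L2 \<Longrightarrow> Pop \<mu> f \<in> L2"
  and nrm_Pop: "f \<in> L2 \<Longrightarrow> nrm (Pop \<mu> f) \<le> nrm f"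
proof -
  assume f: "f \<in> L2"
  have eq: "Pop \<mu> f = (\<lambda>x. (Pop \<mu> f x - of_real \<epsilon> * f x) + of_real \<epsilon> * f x)" by auto
  show "Pop \<mu> f \<in> L2"
    using L2_add[OF nrm_Pop_lazy(1)[OF f] L2_scale[OF f, of "of_real \<epsilon>"]] by simp
  show "nrm (Pop \<mu> f) \<le> nrm f"
    using nrm_add_le[OF nrm_Pop_lazy(1)[OF f] L2_scale[OF f, of "of_real \<epsilon>"]] nrm_Pop_lazy(2)[OF f] \<epsilon>
    by (simp add: nrm_scale algebra_simps)
qed

text \<open>Fubini for the double sum over edges and symmetry of the weight. Absolute summability
  follows from 2ab \<le> a^2 + b^2, after which each square is summed first over the vertex it does
  not depend on.\<close>

lemma Pop_selfadjoint:
  assumes f: "f \<in> L2" and g: "g \<in> L2"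
  shows "ip (Pop \<mu> f) g = ip f (Pop \<mu> g)"
proof -
  define F where "F x y = of_real (\<mu> x y) * (f y * cnj (g x))" for x y
  have bound: "sum (\<lambda>(x, y). cmod (F x y)) S \<le> (nrm f)\<^sup>2 + (nrm g)\<^sup>2" if S: "finite S" for S
  proof -
    have half: "(\<Sum>(x, y)\<in>S. \<mu> x y * (cmod (h y))\<^sup>2) \<le> (nrm h)\<^sup>2" if h: "h \<in> L2" "finite S" for h S
    proof -
      have "(\<Sum>(x, y)\<in>S. \<mu> x y * (cmod (h y))\<^sup>2) \<le> (\<Sum>(x, y)\<in>fst ` S \<times> snd ` S. \<mu> x y * (cmod (h y))\<^sup>2)"
        using h by (intro sum_mono2) (auto simp: weight_nonneg image_iff, force+)
      also have "\<dots> = (\<Sum>y\<in>snd ` S. \<Sum>x\<in>fst ` S. (cmod (h y))\<^sup>2 * \<mu> y x)"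
        by (subst sum.cartesian_product[symmetric], subst sum.swap) (simp add: weight_sym mult_ac)
      also have "\<dots> \<le> (\<Sum>y\<in>snd ` S. (cmod (h y))\<^sup>2 * m y)"
      proof (rule sum_mono)
        fix y
        have "(\<Sum>x\<in>fst ` S. \<mu> y x) \<le> (\<Sum>x\<in>fst ` S \<union> nbrs \<mu> y. \<mu> y x)"
          using h by (intro sum_mono2) (auto simp: weight_nonneg)
        also have "\<dots> = m y" using h by (intro weight_sum_superset) auto
        finally show "(\<Sum>x\<in>fst ` S. (cmod (h y))\<^sup>2 * \<mu> y x) \<le> (cmod (h y))\<^sup>2 * m y"
          unfolding sum_distrib_left[symmetric] by (intro mult_left_mono) auto
      qed
      also have "\<dots> \<le> (nrm h)\<^sup>2"
        using h by (intro finite_sum_le_nrm_sq) auto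
      finally show ?thesis .
    qed
    have "sum (\<lambda>(x, y). cmod (F x y)) S \<le> (\<Sum>(x, y)\<in>S. \<mu> x y * (cmod (f y))\<^sup>2 + \<mu> x y * (cmod (g x))\<^sup>2)"
    proof (intro sum_mono, clarify)
      fix x y
      have "2 * (cmod (f y) * cmod (g x)) \<le> (cmod (f y))\<^sup>2 + (cmod (g x))\<^sup>2"
        using sum_squares_bound[of "cmod (f y)" "cmod (g x)"] by (simp add: mult.assoc)
      then have "cmod (f y) * cmod (g x) \<le> (cmod (f y))\<^sup>2 + (cmod (g x))\<^sup>2"
        using mult_nonneg_nonneg[OF norm_ge_zero[of "f y"] norm_ge_zero[of "g x"]] by linarith
      then show "cmod (F x y) \<le> \<mu> x y * (cmod (f y))\<^sup>2 + \<mu> x y * (cmod (g x))\<^sup>2"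
        unfolding F_def distrib_left[symmetric] norm_mult
        using weight_nonneg[of x y] by (simp add: mult_left_mono)
    qed
    also have "\<dots> = (\<Sum>(x, y)\<in>S. \<mu> x y * (cmod (f y))\<^sup>2) + (\<Sum>(x, y)\<in>prod.swap ` S. \<mu> x y * (cmod (g y))\<^sup>2)"
      by (simp add: case_prod_unfold sum.distrib sum.reindex weight_sym)
    also have "\<dots> \<le> (nrm f)\<^sup>2 + (nrm g)\<^sup>2"
      using S f g by (intro add_mono half) auto
    finally show ?thesis .
  qed
  have "(\<lambda>(x, y). cmod (F x y)) summable_on UNIV"
    using bound by (intro nonneg_bdd_above_summable_on) (auto simp: bdd_above_def)
  then have summ: "(\<lambda>(x, y). F x y) summable_on UNIV \<times> UNIV"
    by - (rule abs_summable_summable, simp add: case_prod_unfold)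
  have inner: "(\<Sum>\<^sub>\<infinity>y. of_real (\<mu> x y) * h y) = of_real (m x) * Pop \<mu> h x" for x and h :: "'a \<Rightarrow> complex"
  proof -
    have "(\<Sum>\<^sub>\<infinity>y. of_real (\<mu> x y) * h y) = (\<Sum>\<^sub>\<infinity>y\<in>nbrs \<mu> x. of_real (\<mu> x y) * h y)"
      by (rule infsum_cong_neutral) (auto simp: weight_eq_0)
    then show ?thesis
      by (simp add: vmeas_Pop)
  qed
  have "ip (Pop \<mu> f) g = (\<Sum>\<^sub>\<infinity>x. cnj (g x) * (of_real (m x) * Pop \<mu> f x))"
    unfolding ip_def by (simp add: mult_ac)
  also have "\<dots> = (\<Sum>\<^sub>\<infinity>x. \<Sum>\<^sub>\<infinity>y. F x y)"
    unfolding inner[symmetric] infsum_cmult_right'[symmetric] by (simp add: F_def mult_ac)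
  also have "\<dots> = (\<Sum>\<^sub>\<infinity>y. \<Sum>\<^sub>\<infinity>x. F x y)"
    by (rule infsum_swap_banach[OF summ])
  also have "\<dots> = (\<Sum>\<^sub>\<infinity>y. f y * cnj (of_real (m y) * Pop \<mu> g y))"
    unfolding inner[symmetric] infsum_cnj[symmetric] infsum_cmult_right'[symmetric]
    by (simp add: F_def weight_sym mult_ac)
  also have "\<dots> = ip f (Pop \<mu> g)"
    unfolding ip_def by (simp add: mult_ac)
  finally show ?thesis .
qed

text \<open>The upper bound 2 - 2\<epsilon> instead of 2 is the effect of the loops: since P -
  \<epsilon> has norm at most 1 - \<epsilon>, the form of P is at least 2\<epsilon> - 1 on unit
  vectors.\<close>

sublocale Lap: selfadjoint_operator \<mu> "Laplacian \<mu>" 2 0 "2 - 2 * \<epsilon>"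
proof
  fix f g :: "'a \<Rightarrow> complex" and c :: complex
  show "Laplacian \<mu> (\<lambda>x. f x + g x) = (\<lambda>x. Laplacian \<mu> f x + Laplacian \<mu> g x)"
    by (simp add: Laplacian_def[abs_def] Pop_add algebra_simps)
  show "Laplacian \<mu> (\<lambda>x. c * f x) = (\<lambda>x. c * Laplacian \<mu> f x)"
    by (simp add: Laplacian_def[abs_def] Pop_scale right_diff_distrib)
  assume f: "f \<in> L2"
  show "Laplacian \<mu> f \<in> L2"
    unfolding Laplacian_def[abs_def] by (intro L2_diff f Pop_L2)
  show "nrm (Laplacian \<mu> f) \<le> 2 * nrm f"
    using nrm_diff_le[OF f Pop_L2[OF f]] nrm_Pop[OF f] unfolding Laplacian_def[abs_def] by simp
  have "Re (ip (Pop \<mu> f) f) \<le> nrm f * nrm f"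
    using complex_Re_le_cmod[of "ip (Pop \<mu> f) f"] Cauchy_Schwarz_ip[OF Pop_L2[OF f] f]
      mult_right_mono[OF nrm_Pop[OF f] nrm_nonneg[of f]] by linarith
  then show "0 * (nrm f)\<^sup>2 \<le> Re (ip (Laplacian \<mu> f) f)"
    using f by (simp add: Laplacian_def[abs_def] ip_diff_left Pop_L2 ip_self power2_eq_square)
  let ?N = "\<lambda>x. Pop \<mu> f x - of_real \<epsilon> * f x"
  have "- Re (ip ?N f) \<le> (1 - \<epsilon>) * nrm f * nrm f"
    using abs_Re_le_cmod[of "ip ?N f"] Cauchy_Schwarz_ip[OF nrm_Pop_lazy(1)[OF f] f]
      mult_right_mono[OF nrm_Pop_lazy(2)[OF f] nrm_nonneg[of f]] by linarith
  moreover have "Re (ip ?N f) = Re (ip (Pop \<mu> f) f) - \<epsilon> * (nrm f)\<^sup>2"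
    using f by (simp add: ip_diff_left Pop_L2 L2_scale ip_scale_left ip_self flip: of_real_power)
  ultimately show "Re (ip (Laplacian \<mu> f) f) \<le> (2 - 2 * \<epsilon>) * (nrm f)\<^sup>2"
    using f by (simp add: Laplacian_def[abs_def] ip_diff_left Pop_L2 ip_self power2_eq_square algebra_simps)
  assume g: "g \<in> L2"
  show "ip (Laplacian \<mu> f) g = ip f (Laplacian \<mu> g)"
    using f g by (simp add: Laplacian_def[abs_def] ip_diff_left ip_diff_right Pop_L2 Pop_selfadjoint)
qed

end

section \<open>Decay of the powers of P and the series for the fractional power\<close>

context LB_graph
begin

lemma Laplacian_funpow_commute:
  fixes f :: "'a \<Rightarrow> 'b::real_normed_vector"
  shows "Laplacian \<mu> ((Pop \<mu> ^^ k) f) = (Pop \<mu> ^^ k) (Laplacian \<mu> f)"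
proof (induction k)
  case (Suc k)
  have "Laplacian \<mu> (Pop \<mu> g) = Pop \<mu> (Laplacian \<mu> g)" for g :: "'a \<Rightarrow> 'b"
    by (simp add: Laplacian_def[abs_def] Pop_diff)
  with Suc show ?case by simp
qed simp

lemma Pop_funpow_L2: "f \<in> L2 \<Longrightarrow> (Pop \<mu> ^^ k) f \<in> L2"
  by (induction k) (simp_all add: Pop_L2)

lemma nrm_Pop_funpow: "f \<in> L2 \<Longrightarrow> nrm ((Pop \<mu> ^^ k) f) \<le> nrm f"
  by (induction k) (auto intro: order_trans[OF nrm_Pop] Pop_funpow_L2)

lemma Pop_funpow_selfadjoint: "f \<in> L2 \<Longrightarrow> g \<in> L2 \<Longrightarrow> ip ((Pop \<mu> ^^ k) f) g = ip f ((Pop \<mu> ^^ k) g)"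
proof (induction k arbitrary: g)
  case (Suc k)
  then have "ip ((Pop \<mu> ^^ Suc k) f) g = ip ((Pop \<mu> ^^ k) f) (Pop \<mu> g)"
    by (simp add: Pop_selfadjoint Pop_funpow_L2)
  with Suc show ?case
    by (simp add: Pop_L2 funpow_swap1)
qed simp

text \<open>The coefficient list \<open>[:1, -1:]\<close> is the polynomial 1 - X, which turns
  \<Delta> into P.\<close>

lemma Lap_Q_power: "Lap.Q ([:1, -1:] ^ k) f = (Pop \<mu> ^^ k) f"
proof (induction k)
  case 0
  show ?case using Lap.Q_const[of 1 f] by (simp add: one_pCons)
next
  case (Suc k)
  have "Lap.Q [:1, -1:] g = Pop \<mu> g" for g
    using Lap.T_scale[of "-1" g] by (simp add: Lap.Q_pCons Lap.Q_0 Lap.T_zero) (simp add: Laplacian_def)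
  with Suc show ?case by (simp add: Lap.Q_mult del: mult_pCons_left)
qed

text \<open>For t \<le> 1 the quantity is the smallest of k + 1 terms of a geometric sum that is at
  most 1. For t > 1 the base |1 - t| is at most 1 - 2\<epsilon>, and the same comparison bounds its
  k-th power by a multiple of 1/(k + 1).\<close>

lemma power_decay:
  fixes t :: real
  assumes t: "0 \<le> t" "t \<le> 2 - 2 * \<epsilon>"
  shows "t * \<bar>1 - t\<bar> ^ k \<le> (1 / \<epsilon>) / real (Suc k)"
proof (cases "t \<le> 1")
  case True
  have "real (Suc k) * (t * (1 - t) ^ k) \<le> (\<Sum>j\<le>k. t * (1 - t) ^ j)"
  proof -
    have "(\<Sum>j\<le>k. t * (1 - t) ^ k) \<le> (\<Sum>j\<le>k. t * (1 - t) ^ j)"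
      using t True by (intro sum_mono mult_left_mono power_decreasing) auto
    then show ?thesis by simp
  qed
  also have "\<dots> = 1 - (1 - t) ^ Suc k"
    using sum_gp_basic[of "1 - t" k] by (simp add: sum_distrib_left del: power_Suc)
  also have "\<dots> \<le> 1"
    using True by (simp del: power_Suc)
  also have "1 \<le> 1 / \<epsilon>"
    using \<epsilon> by simp
  finally show ?thesis
    using True by (subst pos_le_divide_eq) (simp_all add: mult.commute del: of_nat_Suc)
next
  case False
  define \<rho> where "\<rho> = 1 - 2 * \<epsilon>"
  have \<rho>: "0 \<le> \<rho>" "\<rho> < 1" using \<epsilon> by (auto simp: \<rho>_def)
  have "real (Suc k) * \<rho> ^ k \<le> (\<Sum>j\<le>k. \<rho> ^ j)"
  proof -
    have "(\<Sum>j\<le>k. \<rho> ^ k) \<le> (\<Sum>j\<le>k. \<rho> ^ j)"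
      using \<rho> by (intro sum_mono power_decreasing) auto
    then show ?thesis by simp
  qed
  also have "\<dots> = (1 - \<rho> ^ Suc k) / (2 * \<epsilon>)"
    using sum_gp_basic[of \<rho> k] \<epsilon> by (simp add: \<rho>_def field_simps)
  also have "\<dots> \<le> 1 / (2 * \<epsilon>)"
    using \<rho> \<epsilon> by (intro divide_right_mono) auto
  finally have *: "real (Suc k) * \<rho> ^ k \<le> 1 / (2 * \<epsilon>)" .
  have "t * \<bar>1 - t\<bar> ^ k \<le> 2 * \<rho> ^ k"
    using t False \<epsilon> by (intro mult_mono power_mono) (auto simp: \<rho>_def)
  also have "\<dots> \<le> 2 * (1 / (2 * \<epsilon>) / real (Suc k))"
    using * by (intro mult_left_mono, subst pos_le_divide_eq) (simp_all add: mult.commute del: of_nat_Suc)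
  finally show ?thesis by simp
qed

text \<open>Analyticity of P: the spectral bound applied to the polynomial X (1 - X)^k. This is the
  source of the time derivative gain in the kernel estimates.\<close>

lemma nrm_Laplacian_funpow:
  assumes f: "f \<in> L2"
  shows "nrm (Laplacian \<mu> ((Pop \<mu> ^^ k) f)) \<le> (1 / \<epsilon>) / real (Suc k) * nrm f"
proof -
  have eq: "Laplacian \<mu> ((Pop \<mu> ^^ k) f) = Lap.Q ([:0, 1:] * [:1, -1:] ^ k) f"
    unfolding Lap.Q_mult Lap_Q_power by (simp add: Lap.Q_pCons Lap.Q_0 Lap.T_zero)
  show ?thesis
    unfolding eq
  proof (rule Lap.nrm_Q_le[OF _ f])
    fix z assume z: "z \<in> Lap.\<sigma>"
    define t where "t = Re z"
    have t: "z = of_real t" "0 \<le> t" "t \<le> 2 - 2 * \<epsilon>"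
      using Lap.spectrum_real[OF z] by (auto simp: t_def)
    have "cmod (1 - complex_of_real t) = \<bar>1 - t\<bar>"
      by (metis norm_of_real of_real_1 of_real_diff)
    then have "cmod (poly ([:0, 1:] * [:1, -1:] ^ k) z) = t * \<bar>1 - t\<bar> ^ k"
      using t(2) by (simp add: t(1) norm_mult norm_power)
    then show "cmod (poly ([:0, 1:] * [:1, -1:] ^ k) z) \<le> (1 / \<epsilon>) / real (Suc k)"
      using power_decay[OF t(2,3)] by simp
  qed
qed

text \<open>The partial sums of the binomial series in 1 - z are polynomials converging uniformly on
  the spectrum. The same partial sums in P converge in operator norm, because P is a contraction and
  the coefficients are absolutely summable; so \<open>fun_calc_eqI\<close> applies.\<close>

lemma Laplacian_powr_series:
  assumes \<gamma>: "0 < \<gamma>" "\<gamma> < 1" and f: "f \<in> L2"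
  shows "(\<lambda>k. of_real (frac_diff \<gamma> k) * (Pop \<mu> ^^ k) f x) sums Laplacian_powr \<mu> \<gamma> f x"
proof -
  define p :: "nat \<Rightarrow> complex poly" where "p n = (\<Sum>k<n. smult (of_real (frac_diff \<gamma> k)) ([:1, -1:] ^ k))" for n
  \<comment> \<open>The value 0 outside \<open>L2\<close> is the one prescribed by
    \<open>has_fun_calc\<close>.\<close>
  define S where "S f = (if f \<in> L2 then \<lambda>x. \<Sum>k. of_real (frac_diff \<gamma> k) * (Pop \<mu> ^^ k) f x else (\<lambda>x. 0))" for f
  define e where "e n = (\<Sum>k. \<bar>frac_diff \<gamma> (k + n)\<bar>)" for n
  note sm = summable_abs_frac_diff[OF \<gamma>]
  have term_L2: "(\<lambda>x. of_real (frac_diff \<gamma> k) * (Pop \<mu> ^^ k) f x) \<in> L2" if "f \<in> L2" for k f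
    by (intro L2_scale Pop_funpow_L2 that)
  have term_le: "nrm (\<lambda>x. of_real (frac_diff \<gamma> k) * (Pop \<mu> ^^ k) f x) \<le> \<bar>frac_diff \<gamma> k\<bar> * nrm f" if "f \<in> L2" for k f
    using nrm_Pop_funpow[OF that, of k] by (simp add: nrm_scale mult_left_mono)
  note series = L2_series[OF term_L2 term_le summable_mult2[OF sm]]
  have sums: "summable (\<lambda>k. of_real (frac_diff \<gamma> k) * (Pop \<mu> ^^ k) f x)" if "f \<in> L2" for f x
    using series(1)[OF that that] .
  have e0: "0 \<le> e n" for n
    unfolding e_def using sm by (intro suminf_nonneg) (auto simp: summable_iff_shift[of "\<lambda>k. \<bar>frac_diff \<gamma> k\<bar>"])
  have tail: "nrm (\<lambda>x. Lap.Q (p n) f x - S f x) \<le> e n * nrm f" if f: "f \<in> L2" for f n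
  proof -
    have "Lap.Q (p n) f = (\<lambda>x. \<Sum>k<n. of_real (frac_diff \<gamma> k) * (Pop \<mu> ^^ k) f x)"
      unfolding p_def Lap.Q_sum Lap.Q_smult Lap_Q_power ..
    then have "nrm (\<lambda>x. Lap.Q (p n) f x - S f x) =
        nrm (\<lambda>x. S f x - (\<Sum>k<n. of_real (frac_diff \<gamma> k) * (Pop \<mu> ^^ k) f x))"
      using nrm_uminus[of "\<lambda>x. Lap.Q (p n) f x - S f x"] by simp
    also have "\<dots> \<le> (\<Sum>k. \<bar>frac_diff \<gamma> (k + n)\<bar> * nrm f)"
      unfolding S_def using f series(3)[OF f f] by simp
    also have "\<dots> = e n * nrm f"
      unfolding e_def using sm
      by (intro suminf_mult2[symmetric]) (simp add: summable_iff_shift[of "\<lambda>k. \<bar>frac_diff \<gamma> k\<bar>"])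
    finally show ?thesis .
  qed
  have S_L2: "S f \<in> L2" if "f \<in> L2" for f
    using series(2)[OF that that] that by (simp add: S_def)
  have "Laplacian_powr \<mu> \<gamma> = S"
    unfolding Laplacian_powr_def
  proof (rule Lap.fun_calc_eqI)
    show "uniform_limit Lap.\<sigma> (\<lambda>n. poly (p n)) (\<lambda>z. z powr complex_of_real \<gamma>) sequentially"
    proof (rule uniform_limitI)
      fix r :: real assume "r > 0"
      have "\<forall>\<^sub>F n in sequentially. \<forall>w\<in>{-1..1}. dist (\<Sum>k<n. frac_diff \<gamma> k * w ^ k) ((1 - w) powr \<gamma>) < r"
        by (rule uniform_limitD[OF frac_diff_uniform_limit[OF \<gamma>] \<open>r > 0\<close>])
      then show "\<forall>\<^sub>F n in sequentially. \<forall>z\<in>Lap.\<sigma>. dist (poly (p n) z) (z powr complex_of_real \<gamma>) < r"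
      proof eventually_elim
        case (elim n)
        show ?case
        proof
          fix z assume z: "z \<in> Lap.\<sigma>"
          define t where "t = Re z"
          have t: "z = of_real t" "0 \<le> t" "t \<le> 2"
            using Lap.spectrum_real[OF z] \<epsilon> by (auto simp: t_def)
          have "poly (p n) z = of_real (\<Sum>k<n. frac_diff \<gamma> k * (1 - t) ^ k)"
            by (simp add: p_def poly_sum t(1))
          moreover have "z powr of_real \<gamma> = of_real ((1 - (1 - t)) powr \<gamma>)"
            using t(2) by (simp add: t(1) powr_of_real)
          ultimately have "dist (poly (p n) z) (z powr complex_of_real \<gamma>) =
              dist (\<Sum>k<n. frac_diff \<gamma> k * (1 - t) ^ k) ((1 - (1 - t)) powr \<gamma>)"
            by (simp only: dist_of_real)
          also have "\<dots> < r"
            using elim t by (intro bspec[of _ _ "1 - t", rotated]) auto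
          finally show "dist (poly (p n) z) (z powr complex_of_real \<gamma>) < r" .
        qed
      qed
    qed
    show "S f = (\<lambda>x. 0)" if "f \<notin> L2" for f
      using that by (simp add: S_def)
    show "e \<longlonglongrightarrow> 0"
      unfolding e_def[abs_def] by (rule suminf_exist_split2[OF sm])
    show "L2_operator \<mu> S"
      unfolding L2_operator_def
    proof (intro conjI ballI allI exI)
      show "S f \<in> L2" if "f \<in> L2" for f by (rule S_L2[OF that])
      show "S (\<lambda>x. f x + g x) = (\<lambda>x. S f x + S g x)" if "f \<in> L2" "g \<in> L2" for f g
      proof -
        have "(Pop \<mu> ^^ k) (\<lambda>x. f x + g x) = (\<lambda>x. (Pop \<mu> ^^ k) f x + (Pop \<mu> ^^ k) g x)" for k
          by (induction k) (simp_all add: Pop_add)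
        then show ?thesis
          using that by (simp add: S_def L2_add distrib_left suminf_add[OF sums sums])
      qed
      show "S (\<lambda>x. c * f x) = (\<lambda>x. c * S f x)" if "f \<in> L2" for f c
      proof -
        have "(Pop \<mu> ^^ k) (\<lambda>x. c * f x) = (\<lambda>x. c * (Pop \<mu> ^^ k) f x)" for k
          by (induction k) (simp_all add: Pop_scale)
        then show ?thesis
          using that by (simp add: S_def L2_scale suminf_mult[OF sums] mult.left_commute[of _ c])
      qed
      show "nrm (S f) \<le> e 0 * nrm f" if "f \<in> L2" for f
        \<comment> \<open>For n = 0 the polynomial is 0, so the tail estimate bounds S
          itself.\<close>
        using tail[OF that, of 0] by (simp add: p_def Lap.Q_0 nrm_uminus)
    qed
  qed (use tail e0 in auto)
  then have "Laplacian_powr \<mu> \<gamma> f x = (\<Sum>k. of_real (frac_diff \<gamma> k) * (Pop \<mu> ^^ k) f x)"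
    using f by (simp add: S_def)
  then show ?thesis
    using sums[OF f, of x] by (simp add: summable_sums)
qed

text \<open>Summation by parts with \<Delta> = I - P: n + 1 terms with \<open>frac_diff\<close>
  equal n terms with \<open>frac_coeff\<close> applied to \<Delta>f plus a boundary term. The latter
  tends to 0 because P^n f stays bounded while the coefficient tends to 0.\<close>

lemma Laplacian_powr_limit:
  assumes \<gamma>: "0 < \<gamma>" "\<gamma> < 1" and f: "finite {x. f x \<noteq> 0}"
  shows "(\<lambda>n. \<Sum>k<n. of_real (frac_coeff \<gamma> k) * (Pop \<mu> ^^ k) (Laplacian \<mu> f) x) \<longlonglongrightarrow> Laplacian_powr \<mu> \<gamma> f x"
proof -
  have L2: "f \<in> L2" by (rule L2_finite_support[OF f])
  define B where "B = (\<Sum>y\<in>{x. f x \<noteq> 0}. cmod (f y))"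
  have B: "cmod (f y) \<le> B" for y
    unfolding B_def using f by (cases "f y = 0") (auto intro: sum_nonneg member_le_sum)
  have bd: "cmod ((Pop \<mu> ^^ k) f x) \<le> B" for k
    by (rule norm_Pop_funpow_le[OF graph B vmeas_pos])
  have split: "(\<Sum>k<Suc n. of_real (frac_diff \<gamma> k) * (Pop \<mu> ^^ k) f x) =
      (\<Sum>k<n. of_real (frac_coeff \<gamma> k) * (Pop \<mu> ^^ k) (Laplacian \<mu> f) x) +
      of_real (frac_coeff \<gamma> n) * (Pop \<mu> ^^ n) f x" for n
  proof (induction n)
    case 0
    show ?case by (simp add: frac_diff_def)
  next
    case (Suc n)
    have "(Pop \<mu> ^^ n) (Laplacian \<mu> f) x = (Pop \<mu> ^^ n) f x - (Pop \<mu> ^^ Suc n) f x"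
      unfolding Laplacian_funpow_commute[symmetric] by (simp add: Laplacian_def)
    then have "of_real (frac_coeff \<gamma> n) * (Pop \<mu> ^^ n) (Laplacian \<mu> f) x =
        of_real (frac_coeff \<gamma> n) * (Pop \<mu> ^^ n) f x - of_real (frac_coeff \<gamma> n) * (Pop \<mu> ^^ Suc n) f x"
      by (simp only: right_diff_distrib)
    then show ?case
      unfolding sum.lessThan_Suc[of _ "Suc n"] Suc.IH
      by (simp add: frac_diff_def left_diff_distrib del: funpow.simps)
  qed
  have "(\<lambda>n. of_real (frac_coeff \<gamma> n) * (Pop \<mu> ^^ n) f x) \<longlonglongrightarrow> 0"
  proof (rule Lim_null_comparison)
    show "(\<lambda>n. frac_coeff \<gamma> n * B) \<longlonglongrightarrow> 0"
      using tendsto_mult_right[OF frac_coeff_tendsto_0[OF \<gamma>], of B] by simp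
    show "\<forall>\<^sub>F n in sequentially. norm (of_real (frac_coeff \<gamma> n) * (Pop \<mu> ^^ n) f x) \<le> frac_coeff \<gamma> n * B"
      using bd frac_coeff_bounds[OF \<gamma>] by (intro always_eventually) (simp add: norm_mult mult_left_mono)
  qed
  moreover have "(\<lambda>n. \<Sum>k<Suc n. of_real (frac_diff \<gamma> k) * (Pop \<mu> ^^ k) f x) \<longlonglongrightarrow> Laplacian_powr \<mu> \<gamma> f x"
    using Laplacian_powr_series[OF \<gamma> L2, of x] unfolding sums_def by (rule LIMSEQ_Suc)
  ultimately have "(\<lambda>n. (\<Sum>k<Suc n. of_real (frac_diff \<gamma> k) * (Pop \<mu> ^^ k) f x) -
      of_real (frac_coeff \<gamma> n) * (Pop \<mu> ^^ n) f x) \<longlonglongrightarrow> Laplacian_powr \<mu> \<gamma> f x - 0"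
    by (rule tendsto_diff[rotated])
  then show ?thesis unfolding split by simp
qed

end

section \<open>Green's formula and the heat kernel\<close>

context LB_graph
begin

text \<open>The finite set A contains the support of u and its neighbours, so every edge with u
  nonzero at an end lies in A \<times> A. Then v may be arbitrary, with no support
  condition.\<close>

lemma green_formula:
  fixes u :: "'a \<Rightarrow> 'b::real_normed_vector" and v :: "'a \<Rightarrow> real"
  assumes A: "finite A" "\<And>x. u x \<noteq> 0 \<Longrightarrow> nbrs \<mu> x \<subseteq> A"
  shows "(\<Sum>x\<in>A. (v x * m x) *\<^sub>R Laplacian \<mu> u x) =
    (1/2) *\<^sub>R (\<Sum>x\<in>A. \<Sum>y\<in>A. (\<mu> x y * (v x - v y)) *\<^sub>R (u x - u y))"
proof -
  have supp: "x \<in> A" if "u x \<noteq> 0" for x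
    using A(2)[OF that] loop[of x] by auto
  have local: "m x *\<^sub>R Laplacian \<mu> u x = (\<Sum>y\<in>A. \<mu> x y *\<^sub>R (u x - u y))" for x
  proof -
    have "m x *\<^sub>R Pop \<mu> u x = (\<Sum>y\<in>nbrs \<mu> x. \<mu> x y *\<^sub>R u y)"
      using vmeas_pos[of x] by (simp add: Pop_eq)
    also have "\<dots> = (\<Sum>y\<in>A. \<mu> x y *\<^sub>R u y)"
      using supp A(1) by (intro sum.mono_neutral_cong) (auto simp: weight_eq_0)
    finally have 1: "m x *\<^sub>R Pop \<mu> u x = (\<Sum>y\<in>A. \<mu> x y *\<^sub>R u y)" .
    \<comment> \<open>Where u vanishes, x may have neighbours outside A and the weights over A need
      not add up to \<open>m x\<close>; but then both sides are 0.\<close>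
    have 2: "m x *\<^sub>R u x = (\<Sum>y\<in>A. \<mu> x y *\<^sub>R u x)"
    proof (cases "u x = 0")
      case False
      then show ?thesis
        using weight_sum_superset[OF A(1) A(2)[OF False]] by (simp flip: scaleR_left.sum)
    qed simp
    show ?thesis
      by (simp add: Laplacian_def scaleR_diff_right 1 2 sum_subtractf)
  qed
  define E where "E = (\<Sum>x\<in>A. \<Sum>y\<in>A. (\<mu> x y * v x) *\<^sub>R (u x - u y))"
  \<comment> \<open>Renaming x and y replaces v x by -(v y); adding the two expressions for E
    produces the difference of v.\<close>
  have "E = (\<Sum>y\<in>A. \<Sum>x\<in>A. (\<mu> x y * v x) *\<^sub>R (u x - u y))"
    unfolding E_def by (rule sum.swap)
  also have "\<dots> = (\<Sum>x\<in>A. \<Sum>y\<in>A. - ((\<mu> x y * v y) *\<^sub>R (u x - u y)))"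
    by (intro sum.cong refl) (simp add: weight_sym flip: scaleR_minus_right)
  finally have "E + E = (\<Sum>x\<in>A. \<Sum>y\<in>A. (\<mu> x y * (v x - v y)) *\<^sub>R (u x - u y))"
    unfolding E_def by (simp add: right_diff_distrib scaleR_diff_left sum_negf flip: sum.distrib)
      (simp add: sum_subtractf sum_negf)
  moreover have "(\<Sum>x\<in>A. (v x * m x) *\<^sub>R Laplacian \<mu> u x) = E"
    unfolding E_def
  proof (intro sum.cong refl)
    fix x
    have "(v x * m x) *\<^sub>R Laplacian \<mu> u x = v x *\<^sub>R (m x *\<^sub>R Laplacian \<mu> u x)" by simp
    also have "\<dots> = (\<Sum>y\<in>A. (\<mu> x y * v x) *\<^sub>R (u x - u y))"
      unfolding local scaleR_sum_right by (simp add: mult.commute)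
    finally show "(v x * m x) *\<^sub>R Laplacian \<mu> u x = (\<Sum>y\<in>A. (\<mu> x y * v x) *\<^sub>R (u x - u y))" .
  qed
  moreover have "E = (1/2) *\<^sub>R (E + E)" by (simp flip: scaleR_2)
  ultimately show ?thesis by simp
qed

text \<open>Test \<open>\<Delta>u\<close> against the truncation of \<open>u\<close> to the range between \<open>u z\<close> and \<open>u y\<close>: the current
  through an edge is at most the total mass of the sources.\<close>

lemma edge_difference_le_aux:
  fixes u :: "'a \<Rightarrow> real"
  assumes A: "finite A" "\<And>x. u x \<noteq> 0 \<Longrightarrow> nbrs \<mu> x \<subseteq> A" and yz: "z \<in> nbrs \<mu> y" and less: "u z < u y"
  shows "\<mu> y z * (u y - u z) \<le> (\<Sum>x\<in>A. m x * \<bar>Laplacian \<mu> u x\<bar>)"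
proof -
  define b where "b = u y - u z"
  define v where "v x = max (u z) (min (u y) (u x)) - u z" for x
  have v: "0 \<le> v x" "v x \<le> b" for x
    using less by (auto simp: v_def b_def)
  \<comment> \<open>v is a nondecreasing 1-Lipschitz function of u, so its differences have the sign
    of those of u and are no larger.\<close>
  have mono: "(v x - v w)\<^sup>2 \<le> (v x - v w) * (u x - u w)" for x w
  proof -
    have "0 \<le> (v x - v w) \<and> v x - v w \<le> u x - u w \<or> (v x - v w) \<le> 0 \<and> u x - u w \<le> v x - v w"
      using less by (auto simp: v_def max_def min_def)
    then show ?thesis
      by (auto simp: power2_eq_square mult_left_mono mult_left_mono_neg)
  qed
  define t where "t x w = \<mu> x w * (v x - v w)\<^sup>2" for x w
  have t: "0 \<le> t x w" for x w by (simp add: t_def weight_nonneg)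
  have AA: "y \<in> A" "z \<in> A"
    using A(2)[of y] A(2)[of z] yz nbrs_sym[of z y] loop less by (cases "u y = 0"; auto)+
  have vyz: "v y = b" "v z = 0" using less by (auto simp: v_def b_def)
  \<comment> \<open>The edge is counted in both orientations, which makes up for the 1/2 in Green's
    formula.\<close>
  have "2 * (\<mu> y z * b\<^sup>2) = sum (\<lambda>(x, w). t x w) {(y, z), (z, y)}"
  proof -
    have "y \<noteq> z" using less by auto
    then show ?thesis by (simp add: t_def vyz weight_sym[of z y])
  qed
  also have "\<dots> \<le> sum (\<lambda>(x, w). t x w) (A \<times> A)"
    using A(1) AA t by (intro sum_mono2) auto
  also have "\<dots> = (\<Sum>x\<in>A. \<Sum>w\<in>A. t x w)"
    by (rule sum.cartesian_product[symmetric])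
  also have "\<dots> \<le> (\<Sum>x\<in>A. \<Sum>w\<in>A. (\<mu> x w * (v x - v w)) *\<^sub>R (u x - u w))"
    unfolding t_def using mono by (intro sum_mono) (simp add: mult.assoc mult_left_mono weight_nonneg)
  also have "\<dots> = 2 * (\<Sum>x\<in>A. (v x * m x) *\<^sub>R Laplacian \<mu> u x)"
    using green_formula[of A u v, OF A] by simp
  also have "(\<Sum>x\<in>A. (v x * m x) *\<^sub>R Laplacian \<mu> u x) \<le> (\<Sum>x\<in>A. b * (m x * \<bar>Laplacian \<mu> u x\<bar>))"
  proof (rule sum_mono)
    fix x
    have "(v x * m x) *\<^sub>R Laplacian \<mu> u x \<le> v x * (m x * \<bar>Laplacian \<mu> u x\<bar>)"
      using v(1)[of x] vmeas_nonneg[of x] by (simp add: mult.assoc mult_left_mono)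
    also have "\<dots> \<le> b * (m x * \<bar>Laplacian \<mu> u x\<bar>)"
      using v(2)[of x] vmeas_nonneg[of x] by (intro mult_right_mono) auto
    finally show "(v x * m x) *\<^sub>R Laplacian \<mu> u x \<le> b * (m x * \<bar>Laplacian \<mu> u x\<bar>)" .
  qed
  finally have "b * (\<mu> y z * b) \<le> b * (\<Sum>x\<in>A. m x * \<bar>Laplacian \<mu> u x\<bar>)"
    unfolding sum_distrib_left[of b] power2_eq_square by (simp add: mult.left_commute)
  moreover have "0 < b" using less by (simp add: b_def)
  ultimately show ?thesis by (simp add: b_def)
qed

lemma edge_difference_le:
  fixes u :: "'a \<Rightarrow> real"
  assumes A: "finite A" "\<And>x. u x \<noteq> 0 \<Longrightarrow> nbrs \<mu> x \<subseteq> A" and yz: "z \<in> nbrs \<mu> y"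
  shows "\<mu> y z * \<bar>u y - u z\<bar> \<le> (\<Sum>x\<in>A. m x * \<bar>Laplacian \<mu> u x\<bar>)"
proof -
  consider "u z < u y" | "u y < u z" | "u y = u z" by linarith
  then show ?thesis
  proof cases
    case 1
    then show ?thesis using edge_difference_le_aux[of A u, OF A yz 1] by simp
  next
    case 2
    moreover have "y \<in> nbrs \<mu> z" using yz nbrs_sym by blast
    ultimately show ?thesis
      using edge_difference_le_aux[of A u, OF A _ 2] weight_sym[of y z] by simp
  next
    case 3
    then show ?thesis by (simp add: sum_nonneg vmeas_nonneg)
  qed
qed

lemma finite_nbrhood: "finite S \<Longrightarrow> finite (\<Union>x\<in>S. nbrs \<mu> x)"
  by auto

lemma Pop_funpow_finite_support:
  fixes f :: "'a \<Rightarrow> 'b::real_normed_vector"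
  assumes "finite {x. f x \<noteq> 0}"
  shows "finite {x. (Pop \<mu> ^^ n) f x \<noteq> 0}"
proof (induction n)
  case (Suc n)
  let ?g = "(Pop \<mu> ^^ n) f"
  have "{x. Pop \<mu> ?g x \<noteq> 0} \<subseteq> (\<Union>y\<in>{x. ?g x \<noteq> 0}. nbrs \<mu> y)"
  proof
    fix x assume "x \<in> {x. Pop \<mu> ?g x \<noteq> 0}"
    then have "(\<Sum>y\<in>nbrs \<mu> x. \<mu> x y *\<^sub>R ?g y) \<noteq> 0" by (auto simp: Pop_eq)
    then obtain y where "y \<in> nbrs \<mu> x" "\<mu> x y *\<^sub>R ?g y \<noteq> 0" by (rule sum.not_neutral_contains_not_neutral)
    then show "x \<in> (\<Union>y\<in>{x. ?g x \<noteq> 0}. nbrs \<mu> y)" using nbrs_sym[of y x] by auto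
  qed
  then show ?case using finite_nbrhood[OF Suc.IH] finite_subset by auto
qed (use assms in simp)

section \<open>Positivity, symmetry and time differences of the heat kernel\<close>

abbreviation "ker \<equiv> kernel \<mu>"

lemma Pop_funpow_nonneg: "(\<And>x. 0 \<le> f x) \<Longrightarrow> 0 \<le> (Pop \<mu> ^^ n) f x" for f :: "'a \<Rightarrow> real"
  by (induction n arbitrary: x) (auto simp: Pop_eq vmeas_nonneg weight_nonneg intro!: divide_nonneg_nonneg mult_nonneg_nonneg sum_nonneg)

lemma kernel_nonneg: "0 \<le> ker n x y"
  unfolding kernel_def by (intro divide_nonneg_nonneg Pop_funpow_nonneg vmeas_nonneg) simp

lemma kernel_finite_support: "finite {x. ker n x y \<noteq> 0}"
proof -
  have "finite {x. (indicator {y} x :: real) \<noteq> 0}" by (simp add: indicator_def)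
  from Pop_funpow_finite_support[OF this, of n] show ?thesis
    using vmeas_pos[of y] by (simp add: kernel_def)
qed

lemma Laplacian_kernel: "Laplacian \<mu> (\<lambda>x. ker n x y) x = ker n x y - ker (Suc n) x y"
proof -
  have "Pop \<mu> (\<lambda>x. g x / c) x = Pop \<mu> g x / c" for g :: "'a \<Rightarrow> real" and c
    by (simp add: Pop_eq sum_divide_distrib mult.commute)
  then show ?thesis
    by (simp add: Laplacian_def kernel_def)
qed

definition delta :: "'a \<Rightarrow> 'a \<Rightarrow> complex" where
  "delta y x = of_real (indicator {y} x)"

lemma delta_L2: "delta y \<in> L2"
  by (rule L2_finite_support) (simp add: delta_def indicator_def)

lemma ip_delta: "ip f (delta y) = f y * of_real (m y)"
proof -
  have "ip f (delta y) = (\<Sum>\<^sub>\<infinity>x\<in>{y}. f x * cnj (delta y x) * of_real (m x))"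
    unfolding ip_def by (rule infsum_cong_neutral) (auto simp: delta_def)
  then show ?thesis by (simp add: delta_def)
qed

lemma Pop_funpow_delta: "(Pop \<mu> ^^ n) (delta y) x = of_real (ker n x y * m y)"
  using Pop_funpow_of_real[of n "indicator {y}"] vmeas_pos[of y]
  by (simp add: delta_def[abs_def] kernel_def)

text \<open>Self-adjointness of P^n tested on two point masses, the kernel being real.\<close>

lemma kernel_sym: "ker n x y = ker n y x"
proof -
  have "ip ((Pop \<mu> ^^ n) (delta y)) (delta x) = cnj (ip ((Pop \<mu> ^^ n) (delta x)) (delta y))"
    by (simp add: Pop_funpow_selfadjoint delta_L2 ip_cnj)
  then have "complex_of_real (ker n x y * m y * m x) = of_real (ker n y x * m x * m y)"
    unfolding ip_delta Pop_funpow_delta by simp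
  then have "ker n x y * m y * m x = ker n y x * m x * m y"
    by (simp only: of_real_eq_iff)
  then show ?thesis using vmeas_pos[of x] vmeas_pos[of y] by simp
qed

lemma nrm_Pop_funpow_delta: "nrm ((Pop \<mu> ^^ a) (delta y)) = m y * sqrt (ker (2 * a) y y)"
proof -
  have "complex_of_real ((nrm ((Pop \<mu> ^^ a) (delta y)))\<^sup>2) = ip ((Pop \<mu> ^^ a) ((Pop \<mu> ^^ a) (delta y))) (delta y)"
    by (simp add: ip_self[symmetric] Pop_funpow_L2 delta_L2 Pop_funpow_selfadjoint del: of_real_power)
  also have "(Pop \<mu> ^^ a) ((Pop \<mu> ^^ a) (delta y)) = (Pop \<mu> ^^ (2 * a)) (delta y)"
    by (simp add: mult_2 funpow_add)
  also have "ip \<dots> (delta y) = of_real (ker (2 * a) y y * m y * m y)"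
    unfolding ip_delta Pop_funpow_delta by simp
  finally have "(nrm ((Pop \<mu> ^^ a) (delta y)))\<^sup>2 = (m y)\<^sup>2 * ker (2 * a) y y"
    by (simp only: of_real_eq_iff) (simp add: power2_eq_square mult_ac)
  then have "nrm ((Pop \<mu> ^^ a) (delta y)) = sqrt ((m y)\<^sup>2 * ker (2 * a) y y)"
    by (metis nrm_nonneg real_sqrt_unique)
  then show ?thesis by (simp add: real_sqrt_mult vmeas_nonneg)
qed

text \<open>Write \<Delta>P^(2a+b) as P^a (\<Delta>P^b) P^a between two point masses. By
  Cauchy-Schwarz the outer factors give the diagonal values of the kernel at time 2a, and the middle
  one gives the operator norm decay in b.\<close>

lemma Laplacian_kernel_sup:
  "\<bar>ker (2 * a + b) x y - ker (Suc (2 * a + b)) x y\<bar>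
    \<le> (1 / \<epsilon>) / real (Suc b) * sqrt (ker (2 * a) x x * ker (2 * a) y y)"
proof -
  let ?f = "(Pop \<mu> ^^ a) (delta y)" and ?g = "(Pop \<mu> ^^ a) (delta x)"
  have [simp]: "?f \<in> L2" "?g \<in> L2" by (auto intro: Pop_funpow_L2 delta_L2)
  let ?h = "Laplacian \<mu> ((Pop \<mu> ^^ b) ?f)"
  have hL2: "?h \<in> L2" by (intro Lap.T_L2 Pop_funpow_L2 delta_L2)
  have "(Pop \<mu> ^^ a) ((Pop \<mu> ^^ b) ((Pop \<mu> ^^ a) g)) = (Pop \<mu> ^^ (2 * a + b)) g" for g :: "'a \<Rightarrow> complex"
  proof -
    have "2 * a + b = a + (b + a)" by simp
    then show ?thesis by (simp only: funpow_add o_apply)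
  qed
  then have "(Pop \<mu> ^^ a) ?h x = Laplacian \<mu> ((Pop \<mu> ^^ (2 * a + b)) (delta y)) x"
    by (simp only: Laplacian_funpow_commute)
  also have "\<dots> = of_real ((ker (2 * a + b) x y - ker (Suc (2 * a + b)) x y) * m y)"
    unfolding Laplacian_def using Pop_funpow_delta[of "2 * a + b" y x] Pop_funpow_delta[of "Suc (2 * a + b)" y x]
    by (simp add: left_diff_distrib)
  finally have val: "(Pop \<mu> ^^ a) ?h x = of_real ((ker (2 * a + b) x y - ker (Suc (2 * a + b)) x y) * m y)" .
  have "ip ?h ?g = ip ((Pop \<mu> ^^ a) ?h) (delta x)"
    by (rule Pop_funpow_selfadjoint[symmetric]) (auto intro: hL2 delta_L2)
  also have "\<dots> = of_real ((ker (2 * a + b) x y - ker (Suc (2 * a + b)) x y) * m y * m x)"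
    unfolding ip_delta val by simp
  finally have "cmod (ip ?h ?g) = \<bar>ker (2 * a + b) x y - ker (Suc (2 * a + b)) x y\<bar> * m y * m x"
    by (simp add: abs_mult vmeas_nonneg del: of_real_mult of_real_diff)
  moreover have "cmod (ip ?h ?g) \<le> nrm ?h * nrm ?g"
    by (intro Cauchy_Schwarz_ip hL2) simp
  moreover have "nrm ?h * nrm ?g \<le> ((1 / \<epsilon>) / real (Suc b) * nrm ?f) * nrm ?g"
    by (intro mult_right_mono nrm_Laplacian_funpow) auto
  ultimately have "\<bar>ker (2 * a + b) x y - ker (Suc (2 * a + b)) x y\<bar> * (m y * m x) \<le>
      ((1 / \<epsilon>) / real (Suc b) * sqrt (ker (2 * a) x x * ker (2 * a) y y)) * (m y * m x)"
    unfolding nrm_Pop_funpow_delta by (simp add: real_sqrt_mult mult_ac)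
  then show ?thesis
    using vmeas_pos[of x] vmeas_pos[of y] by (simp only: mult_le_cancel_right_pos mult_pos_pos)
qed

section \<open>Moving a gradient onto the kernel\<close>

lemma grad_nonneg: "0 \<le> grad \<mu> f y"
  unfolding grad_def
  by (intro real_sqrt_ge_zero mult_nonneg_nonneg infsum_nonneg) (auto simp: vmeas_nonneg weight_nonneg)

text \<open>Green's formula with v the kernel in its second argument. Since M bounds the kernel
  differences at y uniformly over the neighbours, the remaining sum over z involves f alone and is
  controlled by its gradient.\<close>

lemma Pop_funpow_Laplacian_le:
  fixes f :: "'a \<Rightarrow> complex"
  assumes A: "finite A" "\<And>x. f x \<noteq> 0 \<Longrightarrow> nbrs \<mu> x \<subseteq> A"
    and M: "\<And>y z. z \<in> nbrs \<mu> y \<Longrightarrow> \<bar>ker n x y - ker n x z\<bar> \<le> M y"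
  shows "cmod ((Pop \<mu> ^^ n) (Laplacian \<mu> f) x) \<le> (\<Sum>y\<in>A. M y * m y * grad \<mu> f y)"
proof -
  have supp: "x \<in> A" if "f x \<noteq> 0" for x
    using A(2)[OF that] loop[of x] by auto
  have Lap0: "Laplacian \<mu> f y = 0" if "y \<notin> A" for y
  proof -
    have "f z = 0" if "z \<in> nbrs \<mu> y" for z
      using A(2)[of z] nbrs_sym[of z y] that \<open>y \<notin> A\<close> by blast
    then show ?thesis using supp[of y] that by (auto simp: Laplacian_def Pop_eq)
  qed
  have "{y. Laplacian \<mu> f y \<noteq> 0} \<subseteq> A" using Lap0 by auto
  then have fin: "finite {y. Laplacian \<mu> f y \<noteq> 0}" using A(1) finite_subset by blast
  have "(Pop \<mu> ^^ n) (Laplacian \<mu> f) x = (\<Sum>\<^sub>\<infinity>y. (ker n x y * m y) *\<^sub>R Laplacian \<mu> f y)"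
    by (rule Pop_funpow_kernel[OF graph vmeas_pos fin])
  also have "\<dots> = (\<Sum>\<^sub>\<infinity>y\<in>A. (ker n x y * m y) *\<^sub>R Laplacian \<mu> f y)"
    by (rule infsum_cong_neutral) (auto simp: Lap0)
  also have "\<dots> = (\<Sum>y\<in>A. (ker n x y * m y) *\<^sub>R Laplacian \<mu> f y)"
    using A(1) by simp
  also have "\<dots> = (1/2) *\<^sub>R (\<Sum>y\<in>A. \<Sum>z\<in>A. (\<mu> y z * (ker n x y - ker n x z)) *\<^sub>R (f y - f z))"
    by (rule green_formula[of A f, OF A])
  finally have "cmod ((Pop \<mu> ^^ n) (Laplacian \<mu> f) x) =
      1/2 * cmod (\<Sum>y\<in>A. \<Sum>z\<in>A. (\<mu> y z * (ker n x y - ker n x z)) *\<^sub>R (f y - f z))"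
    by simp
  also have "\<dots> \<le> 1/2 * (\<Sum>y\<in>A. \<Sum>z\<in>A. \<mu> y z * \<bar>ker n x y - ker n x z\<bar> * cmod (f y - f z))"
    by (intro mult_left_mono sum_norm_le) (auto simp: abs_mult weight_nonneg)
  also have "\<dots> \<le> 1/2 * (\<Sum>y\<in>A. M y * (2 * (m y * grad \<mu> f y)))"
  proof (intro mult_left_mono sum_mono)
    fix y
    have M0: "0 \<le> M y" using M[of y y] loop[of y] by simp
    have "(\<Sum>z\<in>A. \<mu> y z * \<bar>ker n x y - ker n x z\<bar> * cmod (f y - f z)) \<le>
        (\<Sum>z\<in>A. M y * (\<mu> y z * cmod (f y - f z)))"
    proof (rule sum_mono)
      fix z
      show "\<mu> y z * \<bar>ker n x y - ker n x z\<bar> * cmod (f y - f z) \<le> M y * (\<mu> y z * cmod (f y - f z))"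
      proof (cases "z \<in> nbrs \<mu> y")
        case True
        then show ?thesis
          using mult_right_mono[OF M[OF True], of "\<mu> y z * cmod (f y - f z)"] weight_nonneg[of y z]
          by (simp add: mult_ac)
      qed (simp add: weight_eq_0)
    qed
    also have "\<dots> = M y * (\<Sum>z\<in>A. \<mu> y z * cmod (f y - f z))"
      by (simp add: sum_distrib_left)
    \<comment> \<open>Cauchy-Schwarz gives the factor sqrt 2; it is rounded up to 2, which cancels
      the 1/2 of Green's formula.\<close>
    also have "(\<Sum>z\<in>A. \<mu> y z * cmod (f y - f z)) \<le> 2 * (m y * grad \<mu> f y)"
    proof -
      have "(\<Sum>z\<in>A. \<mu> y z * cmod (f y - f z)) \<le> (\<Sum>z\<in>A \<union> nbrs \<mu> y. \<mu> y z * cmod (f y - f z))"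
        using A(1) by (intro sum_mono2) (auto simp: weight_nonneg)
      also have "\<dots> = (\<Sum>z\<in>nbrs \<mu> y. \<mu> y z * cmod (f y - f z))"
        using A(1) by (intro sum.mono_neutral_right) (auto simp: weight_eq_0)
      also have "\<dots> = (\<Sum>z\<in>nbrs \<mu> y. sqrt (\<mu> y z) * (sqrt (\<mu> y z) * cmod (f y - f z)))"
        by (intro sum.cong refl) (simp add: weight_nonneg flip: mult.assoc)
      finally have le: "(\<Sum>z\<in>A. \<mu> y z * cmod (f y - f z)) \<le> \<dots>" .
      have "(\<Sum>z\<in>A. \<mu> y z * cmod (f y - f z))\<^sup>2 \<le> (\<Sum>z\<in>nbrs \<mu> y. sqrt (\<mu> y z) * (sqrt (\<mu> y z) * cmod (f y - f z)))\<^sup>2"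
        using le by (intro power_mono sum_nonneg) (auto simp: weight_nonneg)
      also have "\<dots> \<le> (\<Sum>z\<in>nbrs \<mu> y. (sqrt (\<mu> y z))\<^sup>2) * (\<Sum>z\<in>nbrs \<mu> y. (sqrt (\<mu> y z) * cmod (f y - f z))\<^sup>2)"
        by (rule Cauchy_Schwarz_ineq_sum)
      also have "\<dots> = m y * (\<Sum>z\<in>nbrs \<mu> y. \<mu> y z * (cmod (f y - f z))\<^sup>2)"
        by (simp add: power_mult_distrib weight_nonneg vmeas_eq)
      also have "\<dots> = 2 * (m y * grad \<mu> f y)\<^sup>2"
      proof -
        have "(grad \<mu> f y)\<^sup>2 = 1 / (2 * m y) * (\<Sum>z\<in>nbrs \<mu> y. \<mu> y z * (cmod (f y - f z))\<^sup>2)"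
          unfolding grad_def
          by (subst real_sqrt_pow2) (auto intro!: divide_nonneg_nonneg sum_nonneg simp: weight_nonneg vmeas_nonneg)
        then show ?thesis
          using vmeas_pos[of y] by (simp add: power2_eq_square field_simps)
      qed
      also have "\<dots> \<le> (2 * (m y * grad \<mu> f y))\<^sup>2"
        by (simp add: power_mult_distrib)
      finally show ?thesis
        by (rule power2_le_imp_le) (simp add: vmeas_nonneg grad_nonneg)
    qed
    finally show "(\<Sum>z\<in>A. \<mu> y z * \<bar>ker n x y - ker n x z\<bar> * cmod (f y - f z)) \<le> M y * (2 * (m y * grad \<mu> f y))"
      using M0 by (simp add: mult_left_mono)
  qed simp
  also have "\<dots> = (\<Sum>y\<in>A. M y * m y * grad \<mu> f y)"
    by (simp add: sum_distrib_left mult_ac)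
  finally show ?thesis .
qed

end

section \<open>Sub-Gaussian estimates\<close>

lemma le_geometric_mean:
  fixes q :: real
  assumes "0 \<le> q" "q \<le> X" "q \<le> Y" "0 \<le> \<eta>" "\<eta> \<le> 1"
  shows "q \<le> X powr (1 - \<eta>) * Y powr \<eta>"
proof -
  have "q = q powr (1 - \<eta>) * q powr \<eta>"
    using assms by (simp flip: powr_add)
  also have "\<dots> \<le> X powr (1 - \<eta>) * Y powr \<eta>"
    using assms by (intro mult_mono powr_mono2) auto
  finally show ?thesis .
qed

lemma powr_minus_double:
  fixes a b N :: real
  assumes "0 < a" "a \<le> 2 * b" "0 \<le> N"
  shows "b powr (- N) \<le> 2 powr N * a powr (- N)"
proof -
  have "b powr (- N) = 2 powr N * (2 * b) powr (- N)"
    using assms by (simp add: powr_mult powr_minus)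
  also have "(2 * b) powr (- N) \<le> a powr (- N)"
    using assms by (intro powr_mono2') auto
  finally show ?thesis by simp
qed

text \<open>The second bound is assumed with exponent E/\<eta> so that E is left after raising it to
  the power \<eta>.\<close>

lemma interpolate:
  fixes q :: real
  assumes q: "0 \<le> q" "q \<le> A * K powr a" "q \<le> B * K powr b * w powr (- (E / \<eta>))"
    and \<eta>: "0 < \<eta>" "\<eta> \<le> 1" and K: "0 < K"
  shows "q \<le> (A powr (1 - \<eta>) * B powr \<eta>) * K powr (a * (1 - \<eta>) + b * \<eta>) * w powr (- E)"
proof -
  have "q \<le> (A * K powr a) powr (1 - \<eta>) * (B * K powr b * w powr (- (E / \<eta>))) powr \<eta>"
    using q \<eta> by (intro le_geometric_mean) auto
  also have "\<dots> = (A powr (1 - \<eta>) * B powr \<eta>) * (K powr (a * (1 - \<eta>)) * K powr (b * \<eta>)) * w powr (- E)"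
    using \<eta> by (simp add: powr_mult powr_powr mult_ac)
  finally show ?thesis by (simp add: powr_add)
qed

text \<open>For q \<ge> 1 one has \<rho> powr q \<ge> \<rho> - 1 = (1 + \<rho>) - 2, the source of
  exp (2c); then ln s \<le> s at s = (c/N)(1 + \<rho>) turns the exponential into a power.\<close>

lemma exp_le_powr:
  fixes c N q :: real
  assumes c: "0 < c" and N: "0 < N" and q: "1 \<le> q"
  shows "\<exists>C>0. \<forall>\<rho>\<ge>0. exp (- c * \<rho> powr q) \<le> C * (1 + \<rho>) powr (- N)"
proof (intro exI[of _ "exp (2 * c) * (c / N) powr (- N)"] conjI allI impI)
  fix \<rho> :: real assume \<rho>: "0 \<le> \<rho>"
  have "\<rho> - 1 \<le> \<rho> powr q"
  proof (cases "1 \<le> \<rho>")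
    case True
    then have "\<rho> powr 1 \<le> \<rho> powr q" using q by (intro powr_mono) auto
    then show ?thesis using True by simp
  next
    case False
    then show ?thesis using powr_ge_zero[of \<rho> q] by linarith
  qed
  then have "c * (\<rho> - 1) \<le> c * \<rho> powr q"
    using c by (intro mult_left_mono) auto
  then have "exp (- c * \<rho> powr q) \<le> exp (2 * c - c * (1 + \<rho>))"
    by (simp add: algebra_simps)
  also have "\<dots> = exp (2 * c) * exp (- c * (1 + \<rho>))"
    by (simp flip: exp_add)
  also have "exp (- c * (1 + \<rho>)) \<le> (c / N * (1 + \<rho>)) powr (- N)"
  proof -
    have pos: "0 < c / N * (1 + \<rho>)" using c N \<rho> by simp
    have "N * ln (c / N * (1 + \<rho>)) \<le> N * (c / N * (1 + \<rho>))"
      using N ln_less_self[OF pos] by (intro mult_left_mono) auto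
    also have "\<dots> = c * (1 + \<rho>)" using N by simp
    finally show ?thesis
      using pos by (simp only: powr_def less_imp_neq[THEN not_sym] if_False) simp
  qed
  also have "\<dots> = (c / N) powr (- N) * (1 + \<rho>) powr (- N)"
    by (rule powr_mult)
  finally show "exp (- c * \<rho> powr q) \<le> exp (2 * c) * (c / N) powr (- N) * (1 + \<rho>) powr (- N)"
    by (simp add: mult.assoc)
qed (use c N in simp)

locale subgaussian_graph = LB_graph +
  fixes D \<beta> C\<^sub>V C\<^sub>U c\<^sub>U :: real
  assumes connected: "connected_graph \<mu>"
    and D: "0 < D" and \<beta>: "2 \<le> \<beta>"
    and C\<^sub>V: "0 < C\<^sub>V"
    and vol_lower: "0 < r \<Longrightarrow> inverse C\<^sub>V * (1 + r) powr D \<le> vol \<mu> x r"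
    and vol_upper: "0 < r \<Longrightarrow> vol \<mu> x r \<le> C\<^sub>V * (1 + r) powr D"
    and C\<^sub>U: "0 < C\<^sub>U" "0 < c\<^sub>U"
    and UE: "1 \<le> k \<Longrightarrow> kernel \<mu> (k - 1) x y \<le> C\<^sub>U / vol \<mu> x (real k powr (1 / \<beta>)) *
          exp (- c\<^sub>U * (real (graph_dist \<mu> x y) powr \<beta> / real k) powr (1 / (\<beta> - 1)))"
begin

section \<open>Distances, volumes and scaled weights\<close>

abbreviation "dst x y \<equiv> real (graph_dist \<mu> x y)"

lemma graph_dist_path: "(x, y) \<in> edges \<mu> ^^ graph_dist \<mu> x y"
proof -
  have "(x, y) \<in> (edges \<mu>)\<^sup>*" using connected by (simp add: connected_graph_def)
  then obtain n where "(x, y) \<in> edges \<mu> ^^ n" using rtrancl_power by blast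
  then show ?thesis unfolding graph_dist_def by (rule LeastI)
qed

lemma graph_dist_le: "(x, y) \<in> edges \<mu> ^^ n \<Longrightarrow> graph_dist \<mu> x y \<le> n"
  unfolding graph_dist_def by (rule Least_le)

lemma path_sym: "(x, y) \<in> edges \<mu> ^^ n \<Longrightarrow> (y, x) \<in> edges \<mu> ^^ n"
proof (induction n arbitrary: y)
  case (Suc n)
  then obtain z where z: "(x, z) \<in> edges \<mu> ^^ n" "(z, y) \<in> edges \<mu>" by auto
  then have "(y, z) \<in> edges \<mu>" by (simp add: edges_def weight_sym[of y z])
  then show ?case using Suc.IH[OF z(1)] by (rule relpow_Suc_I2)
qed simp

lemma graph_dist_sym: "graph_dist \<mu> x y = graph_dist \<mu> y x"
  using graph_dist_le[OF path_sym[OF graph_dist_path]] by (rule antisym) (rule graph_dist_le[OF path_sym[OF graph_dist_path]])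

lemma graph_dist_nbr: "z \<in> nbrs \<mu> y \<Longrightarrow> dst x y \<le> dst x z + 1"
proof -
  assume "z \<in> nbrs \<mu> y"
  then have "(z, y) \<in> edges \<mu>" by (simp add: edges_def weight_sym[of y z])
  then have "(x, y) \<in> edges \<mu> ^^ Suc (graph_dist \<mu> x z)"
    using graph_dist_path[of x z] by auto
  from graph_dist_le[OF this] show ?thesis by simp
qed

lemma gball_1: "gball \<mu> x 1 = {x}"
proof -
  have "graph_dist \<mu> x y = 0 \<longleftrightarrow> x = y" for y
    using graph_dist_path[of x y] graph_dist_le[of x y 0] by (metis le_zero_eq pair_in_Id_conv relpow.simps(1))
  then show ?thesis by (auto simp: gball_def)
qed

text \<open>Balls are open, so the ball of radius 1 is a single vertex and (AR) bounds its measure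
  from below.\<close>

lemma vmeas_lower: "inverse C\<^sub>V \<le> m x"
proof -
  have "inverse C\<^sub>V * 1 \<le> inverse C\<^sub>V * (1 + 1) powr D"
    using C\<^sub>V D by (intro mult_left_mono ge_one_powr_ge_zero) auto
  also have "\<dots> \<le> vol \<mu> x 1" by (rule vol_lower) simp
  also have "\<dots> = m x" by (simp add: vol_def gball_1)
  finally show ?thesis by simp
qed

text \<open>A divergent \<open>infsum\<close> would make the volume 0; the lower bound in (AR)
  excludes this, so finite sums are dominated by it.\<close>

lemma sum_le_vol:
  assumes "0 < r" "finite F" "F \<subseteq> gball \<mu> x r"
  shows "sum m F \<le> vol \<mu> x r"
proof -
  have "0 < inverse C\<^sub>V * (1 + r) powr D" using C\<^sub>V assms(1) by simp
  then have "vol \<mu> x r \<noteq> 0" using vol_lower[OF assms(1), of x] by linarith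
  then have "m summable_on gball \<mu> x r"
    unfolding vol_def using infsum_not_exists by blast
  then show ?thesis
    unfolding vol_def using assms by (intro finite_sum_le_infsum) (auto simp: vmeas_nonneg)
qed

text \<open>Distance in units of the diffusion length at time n + 1, the time at which (UE)
  evaluates p_n. The summand 1 keeps negative powers bounded by 1.\<close>

definition W :: "nat \<Rightarrow> 'a \<Rightarrow> 'a \<Rightarrow> real" where
  "W n x y = 1 + dst x y / real (Suc n) powr (1 / \<beta>)"

lemma W_ge_1: "1 \<le> W n x y"
  by (simp add: W_def)

lemma W_sym: "W n x y = W n y x"
  by (simp add: W_def graph_dist_sym)

text \<open>The diffusion length is at least 1, so a step to a neighbour changes W by at most 1,
  which is at most W.\<close>

lemma W_nbr:
  assumes "z \<in> nbrs \<mu> y"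
  shows "W n x y \<le> 2 * W n x z"
proof -
  let ?R = "real (Suc n) powr (1 / \<beta>)"
  have R: "1 \<le> ?R" using \<beta> by (intro ge_one_powr_ge_zero) auto
  have "dst x y / ?R \<le> (dst x z + 1) / ?R"
    using graph_dist_nbr[OF assms] by (intro divide_right_mono) auto
  also have "\<dots> \<le> dst x z / ?R + 1"
    using R by (simp add: add_divide_distrib del: of_nat_Suc)
  finally have "1 + dst x y / ?R \<le> 2 + dst x z / ?R" by simp
  moreover have "0 \<le> dst x z / ?R" by simp
  ultimately show ?thesis unfolding W_def distrib_left by linarith
qed

lemma W_Suc: "W n x y \<le> 2 * W (Suc n) x y"
proof -
  let ?R = "real (Suc n) powr (1 / \<beta>)" and ?R' = "real (Suc (Suc n)) powr (1 / \<beta>)"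
  have "?R' \<le> (2 * real (Suc n)) powr (1 / \<beta>)"
    using \<beta> by (intro powr_mono2) auto
  also have "\<dots> = 2 powr (1 / \<beta>) * ?R" by (rule powr_mult)
  also have "2 powr (1 / \<beta>) \<le> 2 powr 1"
    using \<beta> by (intro powr_mono) auto
  finally have R: "?R' \<le> 2 * ?R" by (simp del: of_nat_Suc)
  have "2 * (dst x y / (2 * ?R)) \<le> 2 * (dst x y / ?R')"
    using R by (intro mult_left_mono divide_left_mono) (auto simp del: of_nat_Suc)
  then show ?thesis by (simp add: W_def del: of_nat_Suc)
qed

text \<open>The exponential in (UE) is a function of the scaled distance raised to \<beta>/(\<beta>
  - 1) \<ge> 1, hence dominated by any negative power of W.\<close>

lemma kernel_upper:
  assumes N: "0 < N"
  shows "\<exists>C>0. \<forall>n x y. ker n x y \<le> C * real (Suc n) powr (- (D / \<beta>)) * W n x y powr (- N)"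
proof -
  have q: "1 \<le> \<beta> / (\<beta> - 1)" using \<beta> by simp
  obtain C where C: "C > 0" "\<And>\<rho>. \<rho> \<ge> 0 \<Longrightarrow> exp (- c\<^sub>U * \<rho> powr (\<beta> / (\<beta> - 1))) \<le> C * (1 + \<rho>) powr (- N)"
    using exp_le_powr[OF C\<^sub>U(2) N q] by blast
  have "ker n x y \<le> (C\<^sub>U * C\<^sub>V * C) * real (Suc n) powr (- (D / \<beta>)) * W n x y powr (- N)" for n x y
  proof -
    define k where "k = Suc n"
    define R where "R = real k powr (1 / \<beta>)"
    have R: "0 < R" by (simp add: R_def k_def)
    have "real k = R powr \<beta>"
      using \<beta> by (simp add: R_def powr_powr k_def)
    then have "(dst x y powr \<beta> / real k) = (dst x y / R) powr \<beta>"
      using R by (simp add: powr_divide)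
    then have e: "(dst x y powr \<beta> / real k) powr (1 / (\<beta> - 1)) = (dst x y / R) powr (\<beta> / (\<beta> - 1))"
      by (simp add: powr_powr)
    have v: "C\<^sub>U / vol \<mu> x R \<le> C\<^sub>U * C\<^sub>V * R powr (- D)"
    proof -
      have "inverse C\<^sub>V * R powr D \<le> inverse C\<^sub>V * (1 + R) powr D"
        using C\<^sub>V D R by (intro mult_left_mono powr_mono2) auto
      also have "\<dots> \<le> vol \<mu> x R" by (rule vol_lower[OF R])
      finally have le: "inverse C\<^sub>V * R powr D \<le> vol \<mu> x R" .
      moreover have pos: "0 < inverse C\<^sub>V * R powr D" using C\<^sub>V R by simp
      ultimately have "C\<^sub>U / vol \<mu> x R \<le> C\<^sub>U / (inverse C\<^sub>V * R powr D)"
        using C\<^sub>U by (intro divide_left_mono mult_pos_pos) (auto simp: C\<^sub>V R)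
      also have "\<dots> = C\<^sub>U * C\<^sub>V * R powr (- D)"
        using C\<^sub>V by (simp add: powr_minus field_simps)
      finally show ?thesis .
    qed
    have "ker n x y \<le> C\<^sub>U / vol \<mu> x R * exp (- c\<^sub>U * (dst x y / R) powr (\<beta> / (\<beta> - 1)))"
      using UE[of k x y] unfolding R_def[symmetric] e by (simp add: k_def)
    also have "\<dots> \<le> (C\<^sub>U * C\<^sub>V * R powr (- D)) * (C * (1 + dst x y / R) powr (- N))"
      using v C(2)[of "dst x y / R"] C\<^sub>U C\<^sub>V R by (intro mult_mono) auto
    also have "R powr (- D) = real k powr (- (D / \<beta>))"
      by (simp add: R_def powr_powr)
    finally show ?thesis
      by (simp add: W_def R_def k_def mult_ac)
  qed
  moreover have "0 < C\<^sub>U * C\<^sub>V * C" using C\<^sub>U C\<^sub>V C by simp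
  ultimately show ?thesis by blast
qed

text \<open>Decompose into shells of integer scaled distance. The i-th shell has volume at most a
  multiple of ((i+1) R)^D, and the exponent D + 2 leaves the convergent series of
  (i+1)^(-2).\<close>

lemma sum_W_le:
  "\<exists>C>0. \<forall>n x S. finite S \<longrightarrow> (\<Sum>y\<in>S. m y * W n x y powr (- (D + 2))) \<le> C * real (Suc n) powr (D / \<beta>)"
proof -
  define \<zeta> where "\<zeta> = (\<Sum>j. inverse (real (Suc j) ^ 2))"
  have sm: "summable (\<lambda>j. inverse (real (Suc j) ^ 2))"
    using inverse_power_summable[of 2, where ?'a = real] by (subst summable_Suc_iff) simp
  have \<zeta>: "0 < \<zeta>" unfolding \<zeta>_def by (rule suminf_pos[OF sm]) simp
  have "(\<Sum>y\<in>S. m y * W n x y powr (- (D + 2))) \<le> (C\<^sub>V * 2 powr D * \<zeta>) * real (Suc n) powr (D / \<beta>)"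
    if S: "finite S" for n x S
  proof -
    define R where "R = real (Suc n) powr (1 / \<beta>)"
    have R: "1 \<le> R" using \<beta> by (simp add: R_def ge_one_powr_ge_zero)
    define j where "j y = nat \<lfloor>dst x y / R\<rfloor>" for y
    have j: "real (j y) \<le> dst x y / R" "dst x y / R < real (j y) + 1" for y
      using R by (auto simp: j_def)
    have shell: "(\<Sum>y\<in>{y \<in> S. j y = i}. m y * W n x y powr (- (D + 2))) \<le>
        C\<^sub>V * 2 powr D * R powr D * inverse (real (Suc i) ^ 2)" for i
    proof -
      have "(\<Sum>y\<in>{y \<in> S. j y = i}. m y * W n x y powr (- (D + 2))) \<le>
          (\<Sum>y\<in>{y \<in> S. j y = i}. m y * real (Suc i) powr (- (D + 2)))"
      proof (rule sum_mono)
        fix y assume "y \<in> {y \<in> S. j y = i}"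
        then have "real (Suc i) \<le> W n x y" using j(1)[of y] by (simp add: W_def R_def)
        then show "m y * W n x y powr (- (D + 2)) \<le> m y * real (Suc i) powr (- (D + 2))"
          using D by (intro mult_left_mono powr_mono2' vmeas_nonneg) auto
      qed
      also have "\<dots> = sum m {y \<in> S. j y = i} * real (Suc i) powr (- (D + 2))"
        by (simp add: sum_distrib_right)
      also have "sum m {y \<in> S. j y = i} \<le> vol \<mu> x (real (Suc i) * R)"
      proof (rule sum_le_vol)
        show "{y \<in> S. j y = i} \<subseteq> gball \<mu> x (real (Suc i) * R)"
        proof
          fix y assume "y \<in> {y \<in> S. j y = i}"
          then have "dst x y / R < real (Suc i)" using j(2)[of y] by simp
          then show "y \<in> gball \<mu> x (real (Suc i) * R)"
            using R by (simp add: gball_def pos_divide_less_eq del: of_nat_Suc)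
        qed
      qed (use S R in auto)
      also have "\<dots> \<le> C\<^sub>V * (1 + real (Suc i) * R) powr D"
        using R by (intro vol_upper) simp
      also have "\<dots> \<le> C\<^sub>V * (2 * (real (Suc i) * R)) powr D"
      proof -
        have "1 * 1 \<le> real (Suc i) * R" using R by (intro mult_mono) auto
        then show ?thesis using C\<^sub>V D by (intro mult_left_mono powr_mono2) (auto simp: mult.commute)
      qed
      also have "\<dots> = C\<^sub>V * 2 powr D * R powr D * real (Suc i) powr D"
        by (simp add: powr_mult del: of_nat_Suc)
      finally have "(\<Sum>y\<in>{y \<in> S. j y = i}. m y * W n x y powr (- (D + 2))) \<le>
          C\<^sub>V * 2 powr D * R powr D * (real (Suc i) powr D * real (Suc i) powr (- (D + 2)))"
        by (simp add: mult_right_mono mult.assoc)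
      also have "real (Suc i) powr D * real (Suc i) powr (- (D + 2)) = real (Suc i) powr (- 2)"
        by (simp flip: powr_add)
      also have "\<dots> = inverse (real (Suc i) ^ 2)"
        by (simp add: powr_minus powr_numeral del: of_nat_Suc)
      finally show ?thesis .
    qed
    have "(\<Sum>y\<in>S. m y * W n x y powr (- (D + 2))) =
        (\<Sum>i\<in>j ` S. \<Sum>y\<in>{y \<in> S. j y = i}. m y * W n x y powr (- (D + 2)))"
      by (rule sum.image_gen[OF S])
    also have "\<dots> \<le> (\<Sum>i\<in>j ` S. C\<^sub>V * 2 powr D * R powr D * inverse (real (Suc i) ^ 2))"
      by (intro sum_mono shell)
    also have "\<dots> = C\<^sub>V * 2 powr D * R powr D * (\<Sum>i\<in>j ` S. inverse (real (Suc i) ^ 2))"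
      by (simp only: sum_distrib_left)
    also have "\<dots> \<le> C\<^sub>V * 2 powr D * R powr D * \<zeta>"
      unfolding \<zeta>_def using C\<^sub>V S by (intro mult_left_mono sum_le_suminf sm) auto
    also have "R powr D = real (Suc n) powr (D / \<beta>)"
      by (simp add: R_def powr_powr)
    finally show ?thesis by (simp add: mult_ac)
  qed
  moreover have "0 < C\<^sub>V * 2 powr D * \<zeta>" using C\<^sub>V \<zeta> by simp
  ultimately show ?thesis by blast
qed

text \<open>Apply \<open>Laplacian_kernel_sup\<close> with n cut into thirds, so that both b and 2a
  are comparable to n: b yields the factor 1/n, the diagonal values yield n powr
  (-D/\<beta>).\<close>

lemma kernel_diff_sup:
  "\<exists>C>0. \<forall>n x y. \<bar>ker n x y - ker (Suc n) x y\<bar> \<le> C * real (Suc n) powr (- 1 - D / \<beta>)"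
proof -
  obtain C where C: "C > 0" "\<And>n x y. ker n x y \<le> C * real (Suc n) powr (- (D / \<beta>)) * W n x y powr (- 1)"
    using kernel_upper[of 1] by auto
  define C' where "C' = C * 3 powr (D / \<beta>)"
  have "\<bar>ker n x y - ker (Suc n) x y\<bar> \<le> (3 / \<epsilon> * C') * real (Suc n) powr (- 1 - D / \<beta>)" for n x y
  proof -
    define a where "a = n div 3"
    define b where "b = n - 2 * a"
    have n: "n = 2 * a + b" by (simp add: a_def b_def)
    have "3 * a \<le> n"
      by (simp add: a_def)
    moreover have "n < 3 * Suc a"
      using dividend_less_times_div[of 3 n] by (simp add: a_def)
    ultimately have "Suc n \<le> 3 * Suc b" "Suc n \<le> 3 * Suc (2 * a)"
      by (auto simp: b_def)
    then have le1: "real (Suc n) \<le> 3 * real (Suc b)" and le2: "real (Suc n) \<le> 3 * real (Suc (2 * a))"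
      by linarith+
    have diag: "ker (2 * a) z z \<le> C' * real (Suc n) powr (- (D / \<beta>))" for z
    proof -
      have "W (2 * a) z z powr (- 1) \<le> 1"
        using W_ge_1[of "2 * a" z z] by (simp add: powr_minus_divide)
      then have "C * real (Suc (2 * a)) powr (- (D / \<beta>)) * W (2 * a) z z powr (- 1) \<le>
          C * real (Suc (2 * a)) powr (- (D / \<beta>)) * 1"
        using C(1) by (intro mult_left_mono) auto
      then have "ker (2 * a) z z \<le> C * real (Suc (2 * a)) powr (- (D / \<beta>))"
        using C(2)[of "2 * a" z z] by simp
      also have "real (Suc (2 * a)) powr (- (D / \<beta>)) \<le> (real (Suc n) / 3) powr (- (D / \<beta>))"
        using le2 D \<beta> by (intro powr_mono2') auto
      also have "(real (Suc n) / 3) powr (- (D / \<beta>)) = 3 powr (D / \<beta>) * real (Suc n) powr (- (D / \<beta>))"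
        by (simp add: powr_divide powr_minus field_simps del: of_nat_Suc)
      finally show ?thesis using C(1) by (simp add: C'_def mult_ac)
    qed
    have "sqrt (ker (2 * a) x x * ker (2 * a) y y) \<le> sqrt ((C' * real (Suc n) powr (- (D / \<beta>)))\<^sup>2)"
      unfolding power2_eq_square
      using C(1) by (intro real_sqrt_le_mono mult_mono diag kernel_nonneg) (auto simp: C'_def)
    also have "\<dots> = C' * real (Suc n) powr (- (D / \<beta>))"
      using C(1) by (simp add: C'_def)
    finally have s: "sqrt (ker (2 * a) x x * ker (2 * a) y y) \<le> C' * real (Suc n) powr (- (D / \<beta>))" .
    have "1 / real (Suc b) \<le> 3 / real (Suc n)"
      using le1 by (simp add: divide_simps)
    then have t: "(1 / \<epsilon>) / real (Suc b) \<le> 1 / \<epsilon> * (3 * real (Suc n) powr (- 1))"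
      using mult_left_mono[of "1 / real (Suc b)" "3 / real (Suc n)" "1 / \<epsilon>"] \<epsilon>
      by (simp add: powr_minus_divide del: of_nat_Suc)
    have "\<bar>ker n x y - ker (Suc n) x y\<bar> \<le> (1 / \<epsilon>) / real (Suc b) * sqrt (ker (2 * a) x x * ker (2 * a) y y)"
      using Laplacian_kernel_sup[of a b x y] by (simp add: n del: of_nat_Suc)
    also have "\<dots> \<le> (1 / \<epsilon> * (3 * real (Suc n) powr (- 1))) * (C' * real (Suc n) powr (- (D / \<beta>)))"
      using \<epsilon> by (intro mult_mono s t) (auto intro!: mult_nonneg_nonneg kernel_nonneg)
    also have "\<dots> = (3 / \<epsilon> * C') * (real (Suc n) powr (- 1) * real (Suc n) powr (- (D / \<beta>)))"
      by (simp add: mult_ac)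
    also have "real (Suc n) powr (- 1) * real (Suc n) powr (- (D / \<beta>)) = real (Suc n) powr (- 1 - D / \<beta>)"
      by (simp only: powr_add[symmetric]) simp
    finally show ?thesis .
  qed
  moreover have "0 < 3 / \<epsilon> * C'" using \<epsilon> C(1) by (simp add: C'_def)
  ultimately show ?thesis by blast
qed

text \<open>No cancellation is exploited: both kernels are nonnegative and obey the bound, the later
  one after comparing W at consecutive times.\<close>

lemma kernel_diff_weighted:
  assumes N: "0 < N"
  shows "\<exists>C>0. \<forall>n x y. \<bar>ker n x y - ker (Suc n) x y\<bar> \<le> C * real (Suc n) powr (- (D / \<beta>)) * W n x y powr (- N)"
proof -
  obtain C where C: "C > 0" "\<And>n x y. ker n x y \<le> C * real (Suc n) powr (- (D / \<beta>)) * W n x y powr (- N)"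
    using kernel_upper[OF N] by blast
  have "\<bar>ker n x y - ker (Suc n) x y\<bar> \<le> (C * 2 powr N) * real (Suc n) powr (- (D / \<beta>)) * W n x y powr (- N)" for n x y
  proof -
    have "1 \<le> (2::real) powr N" using N by (intro ge_one_powr_ge_zero) auto
    then have "C * 1 * (real (Suc n) powr (- (D / \<beta>)) * W n x y powr (- N)) \<le>
        C * 2 powr N * (real (Suc n) powr (- (D / \<beta>)) * W n x y powr (- N))"
      using C(1) by (intro mult_right_mono mult_left_mono) auto
    then have 1: "ker n x y \<le> (C * 2 powr N) * real (Suc n) powr (- (D / \<beta>)) * W n x y powr (- N)"
      using C(2)[of n x y] by (simp add: mult.assoc)
    have "W (Suc n) x y powr (- N) \<le> 2 powr N * W n x y powr (- N)"
      using W_ge_1[of n x y] W_Suc[of n x y] N by (intro powr_minus_double) auto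
    moreover have "real (Suc (Suc n)) powr (- (D / \<beta>)) \<le> real (Suc n) powr (- (D / \<beta>))"
      using D \<beta> by (intro powr_mono2') auto
    ultimately have "C * real (Suc (Suc n)) powr (- (D / \<beta>)) * W (Suc n) x y powr (- N) \<le>
        C * real (Suc n) powr (- (D / \<beta>)) * (2 powr N * W n x y powr (- N))"
      using C(1) by (intro mult_mono mult_left_mono) auto
    then have 2: "ker (Suc n) x y \<le> (C * 2 powr N) * real (Suc n) powr (- (D / \<beta>)) * W n x y powr (- N)"
      using C(2)[of "Suc n" x y] by (simp add: mult_ac)
    show ?thesis
      using 1 2 kernel_nonneg[of n x y] kernel_nonneg[of "Suc n" x y] by linarith
  qed
  moreover have "0 < C * 2 powr N" using C(1) by simp
  ultimately show ?thesis by blast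
qed

text \<open>Interpolating the sup bound with the weighted one leaves n powr (-(1 - \<eta>) -
  D/\<beta>) times an integrable power of W; the volume n powr (D/\<beta>) cancels the last part of
  the exponent.\<close>

lemma kernel_diff_L1:
  assumes \<eta>: "0 < \<eta>" "\<eta> \<le> 1"
  shows "\<exists>C>0. \<forall>n x S. finite S \<longrightarrow>
    (\<Sum>y\<in>S. m y * \<bar>ker n x y - ker (Suc n) x y\<bar>) \<le> C * real (Suc n) powr (- (1 - \<eta>))"
proof -
  obtain A where A: "A > 0" "\<And>n x y. \<bar>ker n x y - ker (Suc n) x y\<bar> \<le> A * real (Suc n) powr (- 1 - D / \<beta>)"
    using kernel_diff_sup by blast
  have "0 < (D + 2) / \<eta>" using D \<eta> by simp
  from kernel_diff_weighted[OF this] obtain B where B: "B > 0"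
    "\<And>n x y. \<bar>ker n x y - ker (Suc n) x y\<bar> \<le> B * real (Suc n) powr (- (D / \<beta>)) * W n x y powr (- ((D + 2) / \<eta>))"
    by blast
  obtain S\<^sub>0 where S\<^sub>0: "S\<^sub>0 > 0" "\<And>n x S. finite S \<Longrightarrow> (\<Sum>y\<in>S. m y * W n x y powr (- (D + 2))) \<le> S\<^sub>0 * real (Suc n) powr (D / \<beta>)"
    using sum_W_le by blast
  define C where "C = A powr (1 - \<eta>) * B powr \<eta>"
  have C: "C > 0" using A B by (simp add: C_def)
  have "(\<Sum>y\<in>S. m y * \<bar>ker n x y - ker (Suc n) x y\<bar>) \<le> (C * S\<^sub>0) * real (Suc n) powr (- (1 - \<eta>))"
    if S: "finite S" for n x S
  proof -
    have exponent: "(- 1 - \<alpha>) * (1 - \<eta>) + - \<alpha> * \<eta> = - (1 - \<eta>) - \<alpha>" for \<alpha>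
      by (simp add: algebra_simps)
    have point: "\<bar>ker n x y - ker (Suc n) x y\<bar> \<le> C * real (Suc n) powr (- (1 - \<eta>) - D / \<beta>) * W n x y powr (- (D + 2))" for y
      using interpolate[OF abs_ge_zero A(2)[of n x y] B(2)[of n x y] \<eta>]
      unfolding exponent C_def by simp
    have "(\<Sum>y\<in>S. m y * \<bar>ker n x y - ker (Suc n) x y\<bar>) \<le>
        (\<Sum>y\<in>S. m y * (C * real (Suc n) powr (- (1 - \<eta>) - D / \<beta>) * W n x y powr (- (D + 2))))"
      by (intro sum_mono mult_left_mono point vmeas_nonneg)
    also have "\<dots> = C * real (Suc n) powr (- (1 - \<eta>) - D / \<beta>) * (\<Sum>y\<in>S. m y * W n x y powr (- (D + 2)))"
      by (simp add: sum_distrib_left mult_ac)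
    also have "\<dots> \<le> C * real (Suc n) powr (- (1 - \<eta>) - D / \<beta>) * (S\<^sub>0 * real (Suc n) powr (D / \<beta>))"
      using C by (intro mult_left_mono S\<^sub>0(2) S) auto
    also have "\<dots> = (C * S\<^sub>0) * (real (Suc n) powr (- (1 - \<eta>) - D / \<beta>) * real (Suc n) powr (D / \<beta>))"
      by (simp add: mult_ac)
    also have "real (Suc n) powr (- (1 - \<eta>) - D / \<beta>) * real (Suc n) powr (D / \<beta>) = real (Suc n) powr (- (1 - \<eta>))"
      by (simp flip: powr_add)
    finally show ?thesis .
  qed
  moreover have "0 < C * S\<^sub>0" using C S\<^sub>0 by simp
  ultimately show ?thesis by blast
qed

text \<open>Flow bound for u = p_n(., x), whose sources were just bounded in L^1. By (LB) and the
  lower bound for the measure, edge weights are at least \<epsilon>/\<open>C\<^sub>V\<close>;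
  symmetry of the kernel moves the difference to the first argument.\<close>

lemma kernel_grad_sup:
  assumes \<eta>: "0 < \<eta>" "\<eta> \<le> 1"
  shows "\<exists>C>0. \<forall>n x y z. z \<in> nbrs \<mu> y \<longrightarrow> \<bar>ker n x y - ker n x z\<bar> \<le> C * real (Suc n) powr (- (1 - \<eta>))"
proof -
  obtain C where C: "C > 0" "\<And>n x S. finite S \<Longrightarrow>
      (\<Sum>y\<in>S. m y * \<bar>ker n x y - ker (Suc n) x y\<bar>) \<le> C * real (Suc n) powr (- (1 - \<eta>))"
    using kernel_diff_L1[OF \<eta>] by blast
  have "\<bar>ker n x y - ker n x z\<bar> \<le> (C\<^sub>V / \<epsilon> * C) * real (Suc n) powr (- (1 - \<eta>))" if z: "z \<in> nbrs \<mu> y" for n x y z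
  proof -
    define A where "A = (\<Union>v\<in>{v. ker n v x \<noteq> 0}. nbrs \<mu> v)"
    have A: "finite A" unfolding A_def by (intro finite_nbrhood kernel_finite_support)
    have "\<epsilon> * inverse C\<^sub>V \<le> \<epsilon> * m y" using \<epsilon> vmeas_lower[of y] by (intro mult_left_mono) auto
    also have "\<dots> \<le> \<mu> y z" using z by (intro edge_weight) auto
    finally have "\<epsilon> * inverse C\<^sub>V * \<bar>ker n x y - ker n x z\<bar> \<le> \<mu> y z * \<bar>ker n x y - ker n x z\<bar>"
      by (intro mult_right_mono) auto
    also have "\<dots> = \<mu> y z * \<bar>ker n y x - ker n z x\<bar>"
      by (simp only: kernel_sym[of n x])
    also have "\<dots> \<le> (\<Sum>v\<in>A. m v * \<bar>Laplacian \<mu> (\<lambda>v. ker n v x) v\<bar>)"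
      by (rule edge_difference_le[OF A _ z]) (auto simp: A_def)
    also have "\<dots> = (\<Sum>v\<in>A. m v * \<bar>ker n x v - ker (Suc n) x v\<bar>)"
      unfolding Laplacian_kernel by (simp only: kernel_sym[of _ x])
    also have "\<dots> \<le> C * real (Suc n) powr (- (1 - \<eta>))"
      by (rule C(2)[OF A])
    finally show ?thesis
      using \<epsilon> C\<^sub>V by (simp add: field_simps del: of_nat_Suc)
  qed
  moreover have "0 < C\<^sub>V / \<epsilon> * C" using C \<epsilon> C\<^sub>V by simp
  ultimately show ?thesis by blast
qed

lemma kernel_grad_weighted:
  assumes N: "0 < N"
  shows "\<exists>C>0. \<forall>n x y z. z \<in> nbrs \<mu> y \<longrightarrow>
    \<bar>ker n x y - ker n x z\<bar> \<le> C * real (Suc n) powr (- (D / \<beta>)) * W n x y powr (- N)"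
proof -
  obtain C where C: "C > 0" "\<And>n x y. ker n x y \<le> C * real (Suc n) powr (- (D / \<beta>)) * W n x y powr (- N)"
    using kernel_upper[OF N] by blast
  have "\<bar>ker n x y - ker n x z\<bar> \<le> (C * 2 powr N) * real (Suc n) powr (- (D / \<beta>)) * W n x y powr (- N)"
    if z: "z \<in> nbrs \<mu> y" for n x y z
  proof -
    have bound: "ker n x v \<le> (C * 2 powr N) * real (Suc n) powr (- (D / \<beta>)) * W n x y powr (- N)"
      if v: "v \<in> nbrs \<mu> y" for v
    proof -
      have "W n x v powr (- N) \<le> 2 powr N * W n x y powr (- N)"
        using W_ge_1[of n x y] W_nbr[OF v, of n x] N by (intro powr_minus_double) auto
      then have "C * real (Suc n) powr (- (D / \<beta>)) * W n x v powr (- N) \<le>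
          C * real (Suc n) powr (- (D / \<beta>)) * (2 powr N * W n x y powr (- N))"
        using C(1) by (intro mult_left_mono) auto
      then show ?thesis using C(2)[of n x v] by (simp add: mult_ac)
    qed
    show ?thesis
      using bound[OF z] bound[of y] loop[of y] kernel_nonneg[of n x y] kernel_nonneg[of n x z] by force
  qed
  moreover have "0 < C * 2 powr N" using C(1) by simp
  ultimately show ?thesis by blast
qed

text \<open>Second interpolation. Its time exponent is -(1 - \<eta>)^2 - \<eta> D/\<beta>, which is
  at most -(1 - 2\<eta>).\<close>

lemma kernel_grad:
  assumes \<eta>: "0 < \<eta>" "\<eta> \<le> 1"
  shows "\<exists>C>0. \<forall>n x y z. z \<in> nbrs \<mu> y \<longrightarrow>
    \<bar>ker n x y - ker n x z\<bar> \<le> C * real (Suc n) powr (- (1 - 2 * \<eta>)) * W n x y powr (- (D + 2))"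
proof -
  obtain A where A: "A > 0" "\<And>n x y z. z \<in> nbrs \<mu> y \<Longrightarrow> \<bar>ker n x y - ker n x z\<bar> \<le> A * real (Suc n) powr (- (1 - \<eta>))"
    using kernel_grad_sup[OF \<eta>] by blast
  have "0 < (D + 2) / \<eta>" using D \<eta> by simp
  from kernel_grad_weighted[OF this] obtain B where B: "B > 0"
    "\<And>n x y z. z \<in> nbrs \<mu> y \<Longrightarrow> \<bar>ker n x y - ker n x z\<bar> \<le> B * real (Suc n) powr (- (D / \<beta>)) * W n x y powr (- ((D + 2) / \<eta>))"
    by blast
  define C where "C = A powr (1 - \<eta>) * B powr \<eta>"
  have C: "C > 0" using A B by (simp add: C_def)
  have "\<bar>ker n x y - ker n x z\<bar> \<le> C * real (Suc n) powr (- (1 - 2 * \<eta>)) * W n x y powr (- (D + 2))"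
    if z: "z \<in> nbrs \<mu> y" for n x y z
  proof -
    have "\<bar>ker n x y - ker n x z\<bar> \<le>
        C * real (Suc n) powr (- (1 - \<eta>) * (1 - \<eta>) + - (D / \<beta>) * \<eta>) * W n x y powr (- (D + 2))"
      unfolding C_def by (rule interpolate[OF abs_ge_zero A(2)[OF z] B(2)[OF z] \<eta>]) simp
    also have "\<dots> \<le> C * real (Suc n) powr (- (1 - 2 * \<eta>)) * W n x y powr (- (D + 2))"
    proof -
      have "- (1 - \<eta>) * (1 - \<eta>) = - (1 - 2 * \<eta>) - \<eta>\<^sup>2"
        by (simp add: algebra_simps power2_eq_square)
      moreover have "0 \<le> (D / \<beta>) * \<eta>" using D \<beta> \<eta> by simp
      ultimately have "- (1 - \<eta>) * (1 - \<eta>) + - (D / \<beta>) * \<eta> \<le> - (1 - 2 * \<eta>)"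
        using zero_le_power2[of \<eta>] by linarith
      then show ?thesis
        using C by (intro mult_right_mono mult_left_mono powr_mono) auto
    qed
    finally show ?thesis .
  qed
  then show ?thesis using C by blast
qed

end

section \<open>Schur's test\<close>

lemma weighted_Jensen_powr:
  fixes w g :: "'b \<Rightarrow> real"
  assumes A: "finite A" and w: "\<And>y. y \<in> A \<Longrightarrow> 0 \<le> w y" and g: "\<And>y. y \<in> A \<Longrightarrow> 0 \<le> g y"
    and B: "sum w A \<le> B" and p: "1 \<le> p"
  shows "(\<Sum>y\<in>A. w y * g y) powr p \<le> B powr (p - 1) * (\<Sum>y\<in>A. w y * g y powr p)"
proof -
  \<comment> \<open>Points with g = 0 contribute nothing; without them convexity of the power is
    applied to positive values only.\<close>
  define A' where "A' = {y \<in> A. 0 < g y}"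
  define V where "V = sum w A'"
  have A': "finite A'" "A' \<subseteq> A" using A by (auto simp: A'_def)
  have "V \<le> sum w A"
    unfolding V_def using A A' w by (intro sum_mono2) auto
  then have V: "0 \<le> V" "V \<le> B"
    using B A' w by (auto simp: V_def intro: sum_nonneg)
  have zero: "g y = 0" if "y \<in> A - A'" for y
    using g[of y] that by (auto simp: A'_def)
  have "(\<Sum>y\<in>A. w y * g y) powr p = (\<Sum>y\<in>A'. w y * g y) powr p"
    using A A' zero by (subst sum.mono_neutral_right[of A A']) auto
  also have "\<dots> \<le> V powr (p - 1) * (\<Sum>y\<in>A'. w y * g y powr p)"
  proof (cases "V = 0")
    case True
    then have "\<forall>y\<in>A'. w y = 0"
      unfolding V_def using A' w by (subst (asm) sum_nonneg_eq_0_iff) auto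
    then show ?thesis using True by simp
  next
    case False
    then have pos: "0 < V" using V by simp
    have "A' \<noteq> {}" using False by (auto simp: V_def)
    have "(\<Sum>y\<in>A'. (w y / V) *\<^sub>R g y) powr p \<le> (\<Sum>y\<in>A'. (w y / V) * g y powr p)"
      by (rule convex_on_sum[OF A'(1) \<open>A' \<noteq> {}\<close> powr_convex[OF p]])
        (use w pos A' in \<open>auto simp: A'_def V_def simp flip: sum_divide_distrib\<close>)
    then have "((\<Sum>y\<in>A'. w y * g y) / V) powr p \<le> (\<Sum>y\<in>A'. w y * g y powr p) / V"
      by (simp add: sum_divide_distrib)
    then have "V powr p * (((\<Sum>y\<in>A'. w y * g y) / V) powr p) \<le> V powr p * ((\<Sum>y\<in>A'. w y * g y powr p) / V)"
      by (intro mult_left_mono) auto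
    moreover have "V powr p * (((\<Sum>y\<in>A'. w y * g y) / V) powr p) = (\<Sum>y\<in>A'. w y * g y) powr p"
      using pos by (simp flip: powr_mult)
    moreover have "V powr p * ((\<Sum>y\<in>A'. w y * g y powr p) / V) = V powr (p - 1) * (\<Sum>y\<in>A'. w y * g y powr p)"
      using pos by (simp add: powr_diff)
    ultimately show ?thesis by simp
  qed
  also have "\<dots> \<le> B powr (p - 1) * (\<Sum>y\<in>A. w y * g y powr p)"
    using V p A A' w by (intro mult_mono powr_mono2 sum_mono2 sum_nonneg) auto
  finally show ?thesis .
qed

context positive_measure
begin

text \<open>Jensen with row weights T x y \<open>m y\<close> gives B^(p-1); summing over x then uses
  the column sums, equal to row sums by symmetry, for the last factor B.\<close>

lemma Schur_test:
  assumes T: "\<And>x y. 0 \<le> T x y" "\<And>x y. T x y = T y x"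
    and B: "\<And>x S. finite S \<Longrightarrow> (\<Sum>y\<in>S. T x y * m y) \<le> B"
    and fin: "finite F" "finite A" and g: "\<And>y. 0 \<le> g y" and p: "1 \<le> p"
  shows "(\<Sum>x\<in>F. (\<Sum>y\<in>A. T x y * m y * g y) powr p * m x) \<le> B powr p * (\<Sum>y\<in>A. g y powr p * m y)"
proof -
  have B0: "0 \<le> B" using B[of "{}"] by simp
  have "(\<Sum>x\<in>F. (\<Sum>y\<in>A. T x y * m y * g y) powr p * m x) \<le>
      (\<Sum>x\<in>F. (B powr (p - 1) * (\<Sum>y\<in>A. T x y * m y * g y powr p)) * m x)"
    using T fin g p vmeas_nonneg B[OF fin(2)]
    by (intro sum_mono mult_right_mono weighted_Jensen_powr) auto
  also have "\<dots> = B powr (p - 1) * (\<Sum>x\<in>F. \<Sum>y\<in>A. g y powr p * m y * (T y x * m x))"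
    unfolding sum_distrib_left sum_distrib_right
    by (intro sum.cong refl) (simp add: T(2)[of _ "_ :: 'a"] mult_ac)
  also have "\<dots> = B powr (p - 1) * (\<Sum>y\<in>A. g y powr p * m y * (\<Sum>x\<in>F. T y x * m x))"
    by (subst sum.swap) (simp add: sum_distrib_left)
  also have "\<dots> \<le> B powr (p - 1) * (\<Sum>y\<in>A. g y powr p * m y * B)"
    using B[OF fin(1)] vmeas_nonneg by (intro mult_left_mono sum_mono) auto
  also have "\<dots> = (B powr (p - 1) * B) * (\<Sum>y\<in>A. g y powr p * m y)"
    by (simp add: sum_distrib_right mult_ac flip: sum_distrib_left)
  also have "B powr (p - 1) * B = B powr p"
    using B0 p by (cases "B = 0") (simp_all add: powr_diff)
  finally show ?thesis .
qed

end

section \<open>Summation of the series and the L^p bound\<close>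

context subgaussian_graph
begin

lemma Laplacian_powr_Lp_bound:
  assumes "D / \<beta> < \<gamma>" "\<gamma> < 1" and p: "1 < p"
  shows "\<exists>C>0. \<forall>f :: 'a \<Rightarrow> complex. finite {x. f x \<noteq> 0} \<longrightarrow>
    Laplacian_powr \<mu> \<gamma> f \<in> Lp \<mu> p \<and>
    Lp_norm \<mu> p (Laplacian_powr \<mu> \<gamma> f) \<le> C * Lp_norm \<mu> p (grad \<mu> f)"
proof -
  have D\<beta>: "0 < D / \<beta>" using D \<beta> by simp
  have \<gamma>: "0 < \<gamma>" "\<gamma> < 1" using assms D\<beta> by linarith+
  \<comment> \<open>The gradient loses 2\<eta> of the room 4\<eta> between \<gamma> and D/\<beta>;
    the other 2\<eta> makes the exponents -1 - 2\<eta> summable.\<close>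
  define \<eta> where "\<eta> = (\<gamma> - D / \<beta>) / 4"
  have \<eta>4: "4 * \<eta> = \<gamma> - D / \<beta>" by (simp add: \<eta>_def)
  have \<eta>: "0 < \<eta>" "\<eta> \<le> 1" using assms D\<beta> by (auto simp: \<eta>_def)
  obtain C where C: "C > 0" "\<And>n x y z. z \<in> nbrs \<mu> y \<Longrightarrow>
      \<bar>ker n x y - ker n x z\<bar> \<le> C * real (Suc n) powr (- (1 - 2 * \<eta>)) * W n x y powr (- (D + 2))"
    using kernel_grad[OF \<eta>] by blast
  obtain S\<^sub>0 where S\<^sub>0: "S\<^sub>0 > 0" "\<And>n x S. finite S \<Longrightarrow> (\<Sum>y\<in>S. m y * W n x y powr (- (D + 2))) \<le> S\<^sub>0 * real (Suc n) powr (D / \<beta>)"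
    using sum_W_le by blast
  define Z where "Z = (\<Sum>k. real (Suc k) powr (- 1 - 2 * \<eta>))"
  have sZ: "summable (\<lambda>k. real (Suc k) powr (- 1 - 2 * \<eta>))"
    using \<eta> by (subst summable_Suc_iff[of "\<lambda>k. real k powr (- 1 - 2 * \<eta>)"]) (simp add: summable_real_powr_iff)
  have Z: "0 < Z" unfolding Z_def by (rule suminf_pos[OF sZ]) simp
  define B where "B = C * S\<^sub>0 * Z"
  have B: "0 < B" using C S\<^sub>0 Z by (simp add: B_def)
  \<comment> \<open>Symmetric majorant of the kernel gradient, as required by Schur's test.\<close>
  define M where "M k x y = C * real (Suc k) powr (- (1 - 2 * \<eta>)) * W k x y powr (- (D + 2))" for k x y
  define T where "T n x y = (\<Sum>k<n. frac_coeff \<gamma> k * M k x y)" for n x y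
  have a0: "0 \<le> frac_coeff \<gamma> k" and a1: "frac_coeff \<gamma> k \<le> real (Suc k) powr (- \<gamma>)" for k
    using frac_coeff_bounds[OF \<gamma>, of k] by auto
  have M0: "0 \<le> M k x y" for k x y using C by (simp add: M_def)
  have T0: "0 \<le> T n x y" for n x y
    unfolding T_def by (intro sum_nonneg mult_nonneg_nonneg a0 M0)
  have T_sym: "T n x y = T n y x" for n x y
    by (simp only: T_def M_def W_sym[of _ x y])
  have T_sum: "(\<Sum>y\<in>S. T n x y * m y) \<le> B" if S: "finite S" for n x S
  proof -
    have "(\<Sum>y\<in>S. T n x y * m y) = (\<Sum>k<n. \<Sum>y\<in>S. frac_coeff \<gamma> k * M k x y * m y)"
      unfolding T_def sum_distrib_right by (rule sum.swap)
    also have "\<dots> \<le> (\<Sum>k<n. C * S\<^sub>0 * real (Suc k) powr (- 1 - 2 * \<eta>))"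
    proof (rule sum_mono)
      fix k
      have "(\<Sum>y\<in>S. frac_coeff \<gamma> k * M k x y * m y) =
          frac_coeff \<gamma> k * (C * real (Suc k) powr (- (1 - 2 * \<eta>)) * (\<Sum>y\<in>S. m y * W k x y powr (- (D + 2))))"
        by (simp add: M_def sum_distrib_left mult_ac)
      also have "\<dots> \<le> real (Suc k) powr (- \<gamma>) *
          (C * real (Suc k) powr (- (1 - 2 * \<eta>)) * (S\<^sub>0 * real (Suc k) powr (D / \<beta>)))"
        using C S\<^sub>0(2)[OF S, of k x]
        by (intro mult_mono mult_left_mono a1 mult_nonneg_nonneg sum_nonneg) (auto simp: vmeas_nonneg)
      also have "\<dots> = C * S\<^sub>0 * (real (Suc k) powr (- \<gamma>) * real (Suc k) powr (- (1 - 2 * \<eta>)) * real (Suc k) powr (D / \<beta>))"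
        by (simp add: mult_ac)
      also have "real (Suc k) powr (- \<gamma>) * real (Suc k) powr (- (1 - 2 * \<eta>)) * real (Suc k) powr (D / \<beta>) =
          real (Suc k) powr (- \<gamma> + - (1 - 2 * \<eta>) + D / \<beta>)"
        by (simp only: powr_add)
      also have "- \<gamma> + - (1 - 2 * \<eta>) + D / \<beta> = - 1 - 2 * \<eta>"
        using \<eta>4 by linarith
      finally show "(\<Sum>y\<in>S. frac_coeff \<gamma> k * M k x y * m y) \<le> C * S\<^sub>0 * real (Suc k) powr (- 1 - 2 * \<eta>)" .
    qed
    also have "\<dots> = C * S\<^sub>0 * (\<Sum>k<n. real (Suc k) powr (- 1 - 2 * \<eta>))"
      by (simp only: sum_distrib_left)
    also have "\<dots> \<le> C * S\<^sub>0 * Z"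
      unfolding Z_def using C S\<^sub>0 by (intro mult_left_mono sum_le_suminf sZ) auto
    finally show ?thesis by (simp add: B_def)
  qed
  have "Laplacian_powr \<mu> \<gamma> f \<in> Lp \<mu> p \<and>
      Lp_norm \<mu> p (Laplacian_powr \<mu> \<gamma> f) \<le> B * Lp_norm \<mu> p (grad \<mu> f)"
    if f: "finite {x. f x \<noteq> 0}" for f :: "'a \<Rightarrow> complex"
  proof -
    define A where "A = (\<Union>x\<in>{x. f x \<noteq> 0}. nbrs \<mu> x)"
    have A: "finite A" "\<And>x. f x \<noteq> 0 \<Longrightarrow> nbrs \<mu> x \<subseteq> A"
      using f by (auto simp: A_def)
    define L where "L = Laplacian_powr \<mu> \<gamma> f"
    define s where "s n x = (\<Sum>k<n. of_real (frac_coeff \<gamma> k) * (Pop \<mu> ^^ k) (Laplacian \<mu> f) x)" for n x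
    define G where "G = (\<Sum>y\<in>A. grad \<mu> f y powr p * m y)"
    have G0: "0 \<le> G" unfolding G_def by (intro sum_nonneg mult_nonneg_nonneg vmeas_nonneg) auto
    have s_lim: "(\<lambda>n. s n x) \<longlonglongrightarrow> L x" for x
      unfolding s_def L_def by (rule Laplacian_powr_limit[OF \<gamma> f])
    have s_le: "cmod (s n x) \<le> (\<Sum>y\<in>A. T n x y * m y * grad \<mu> f y)" for n x
    proof -
      have "cmod (s n x) \<le> (\<Sum>k<n. cmod (of_real (frac_coeff \<gamma> k) * (Pop \<mu> ^^ k) (Laplacian \<mu> f) x))"
        unfolding s_def by (rule norm_sum)
      also have "\<dots> \<le> (\<Sum>k<n. frac_coeff \<gamma> k * (\<Sum>y\<in>A. M k x y * m y * grad \<mu> f y))"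
      proof (rule sum_mono)
        fix k
        have "cmod ((Pop \<mu> ^^ k) (Laplacian \<mu> f) x) \<le> (\<Sum>y\<in>A. M k x y * m y * grad \<mu> f y)"
          unfolding M_def by (rule Pop_funpow_Laplacian_le[of A f, OF A C(2)])
        then show "cmod (of_real (frac_coeff \<gamma> k) * (Pop \<mu> ^^ k) (Laplacian \<mu> f) x) \<le>
            frac_coeff \<gamma> k * (\<Sum>y\<in>A. M k x y * m y * grad \<mu> f y)"
          using a0[of k] by (simp add: norm_mult mult_left_mono)
      qed
      also have "\<dots> = (\<Sum>y\<in>A. T n x y * m y * grad \<mu> f y)"
        unfolding T_def sum_distrib_right sum_distrib_left
        by (subst sum.swap) (simp add: mult_ac)
      finally show ?thesis .
    qed
    \<comment> \<open>Fatou's argument on a finite set: the Schur bound is uniform in the number n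
      of terms and passes to the pointwise limit.\<close>
    have bound: "(\<Sum>x\<in>F. norm (L x) powr p * m x) \<le> B powr p * G" if F: "finite F" for F
    proof (rule LIMSEQ_le_const2)
      show "(\<lambda>n. \<Sum>x\<in>F. norm (s n x) powr p * m x) \<longlonglongrightarrow> (\<Sum>x\<in>F. norm (L x) powr p * m x)"
        using p by (intro tendsto_sum tendsto_mult_right tendsto_powr' tendsto_norm s_lim tendsto_const) auto
      have "(\<Sum>x\<in>F. norm (s n x) powr p * m x) \<le> B powr p * G" for n
      proof -
        have "(\<Sum>x\<in>F. norm (s n x) powr p * m x) \<le>
            (\<Sum>x\<in>F. (\<Sum>y\<in>A. T n x y * m y * grad \<mu> f y) powr p * m x)"
          using p by (intro sum_mono mult_right_mono powr_mono2 s_le vmeas_nonneg) auto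
        also have "\<dots> \<le> B powr p * G"
          unfolding G_def using p F A(1)
          by (intro Schur_test T0 T_sym T_sum grad_nonneg) auto
        finally show ?thesis .
      qed
      then show "\<exists>N. \<forall>n\<ge>N. (\<Sum>x\<in>F. norm (s n x) powr p * m x) \<le> B powr p * G" by blast
    qed
    have summ: "(\<lambda>x. norm (L x) powr p * m x) summable_on UNIV"
      using bound by (intro nonneg_bdd_above_summable_on) (auto simp: bdd_above_def vmeas_nonneg)
    \<comment> \<open>The gradient vanishes off A, so the finite sum G of the Schur bound is the
      full p-th power of the gradient norm.\<close>
    have "(\<Sum>\<^sub>\<infinity>x. norm (grad \<mu> f x) powr p * m x) = (\<Sum>\<^sub>\<infinity>x\<in>A. norm (grad \<mu> f x) powr p * m x)"
    proof (rule infsum_cong_neutral)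
      fix x assume "x \<in> UNIV - A"
      have "f y = 0" if "y \<in> nbrs \<mu> x" for y
        using A(2)[of y] nbrs_sym[of y x] that \<open>x \<in> UNIV - A\<close> by blast
      then have "grad \<mu> f x = 0"
        using loop[of x] by (simp add: grad_def)
      then show "norm (grad \<mu> f x) powr p * m x = 0" by simp
    qed auto
    then have G: "(\<Sum>\<^sub>\<infinity>x. norm (grad \<mu> f x) powr p * m x) = G"
      using A(1) by (simp add: G_def grad_nonneg)
    have "(\<Sum>\<^sub>\<infinity>x. norm (L x) powr p * m x) \<le> B powr p * G"
      using bound by (intro infsum_le_finite_sums summ) auto
    then have "Lp_norm \<mu> p L \<le> (B powr p * G) powr (1 / p)"
      unfolding Lp_norm_def using p by (intro powr_mono2 infsum_nonneg) (auto simp: vmeas_nonneg)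
    also have "\<dots> = B * Lp_norm \<mu> p (grad \<mu> f)"
      unfolding Lp_norm_def G using p B by (simp add: powr_mult powr_powr)
    finally show ?thesis
      using summ by (simp add: Lp_def L_def)
  qed
  then show ?thesis using B by blast
qed

end

theorem corollary1p5:
  fixes \<mu> :: "'a \<Rightarrow> 'a \<Rightarrow> real" and D \<beta> p \<gamma> :: real
  assumes "infinite (UNIV :: 'a set)"
    and "weighted_graph \<mu>"
    and "connected_graph \<mu>"
    and "cond_LB \<mu>"
    and "D > 0" and "cond_AR \<mu> D"
    and "\<beta> \<ge> 2" and "cond_UE \<mu> \<beta>"
    and "D < \<beta>"
    and "1 < p"
    and "D / \<beta> < \<gamma>" and "\<gamma> < 1"
  shows "\<exists>C>0. \<forall>f :: 'a \<Rightarrow> complex. finite {x. f x \<noteq> 0} \<longrightarrow>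
           Laplacian_powr \<mu> \<gamma> f \<in> Lp \<mu> p \<and>
           Lp_norm \<mu> p (Laplacian_powr \<mu> \<gamma> f) \<le> C * Lp_norm \<mu> p (grad \<mu> f)"
proof -
  obtain e where e: "e > 0" "\<And>x y. (x, y) \<in> edges \<mu> \<Longrightarrow> e * vmeas \<mu> x \<le> \<mu> x y"
    and loop: "\<And>x. (x, x) \<in> edges \<mu>"
    using assms(4) unfolding cond_LB_def by blast
  obtain C\<^sub>V where V: "C\<^sub>V > 0" "\<And>x r. r > 0 \<Longrightarrow> inverse C\<^sub>V * (1 + r) powr D \<le> vol \<mu> x r \<and> vol \<mu> x r \<le> C\<^sub>V * (1 + r) powr D"
    using assms(6) unfolding cond_AR_def by blast
  obtain C\<^sub>U c\<^sub>U where U: "C\<^sub>U > 0" "c\<^sub>U > 0" "\<And>x y k. k \<ge> 1 \<Longrightarrow>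
        kernel \<mu> (k - 1) x y \<le> C\<^sub>U / vol \<mu> x (real k powr (1 / \<beta>)) *
          exp (- c\<^sub>U * (real (graph_dist \<mu> x y) powr \<beta> / real k) powr (1 / (\<beta> - 1)))"
    using assms(8) unfolding cond_UE_def by blast
  have vm: "0 \<le> vmeas \<mu> x" for x
    using assms(2) by (auto simp: vmeas_def weighted_graph_def intro: infsum_nonneg)
  interpret subgaussian_graph \<mu> "min e (1/4)" D \<beta> C\<^sub>V C\<^sub>U c\<^sub>U
  proof
    show "min e (1/4) * vmeas \<mu> x \<le> \<mu> x y" if "(x, y) \<in> edges \<mu>" for x y
      using mult_right_mono[OF min.cobounded1[of e "1/4"] vm[of x]] e(2)[OF that] by linarith
  qed (use assms e loop V U in auto)
  show ?thesis
    by (rule Laplacian_powr_Lp_bound[OF assms(11,12,10)])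
qed

end
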